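(* Consider real-analytic graphed surfaces $\{u=F(x,y)\}\subset\mathbb{R}^3$ with $F_{xx}\neq 0\equiv F_{xx}F_{yy}-F_{xy}^2$ and with $$\mathsf S=\frac{F_{xx}F_{xxy}-F_{xy}F_{xxx}}{F_{xx}^2}\neq 0$$ everywhere. For such surfaces there is, under the action of $\mathsf{SA}_3(\mathbb{R})$, exactly one differential invariant of fourth order, namely $$\mathsf W=\frac{F_{xx}^2F_{xxxy}-F_{xx}F_{xy}F_{xxxx}+2F_{xy}F_{xxx}^2-2F_{xx}F_{xxx}F_{xxy}}{F_{xx}^2\,\big(F_{xx}F_{xxy}-F_{xy}F_{xxx}\big)^{2/3}}.$$ That is, $\mathsf W$ is a differential invariant, and every differential invariant of order at most $4$ is locally a function of $\mathsf W$.
   Context: $\mathsf{SA}_3(\mathbb{R})=\mathsf{SL}_3(\mathbb{R})\ltimes\mathbb{R}^3$ acts on $\mathbb{R}^3\ni(x,y,u)$ by affine transformations with linear part of determinant $1$, hence on surfaces. Since $F_{yy}=F_{xy}^2/F_{xx}$, every derivative $F_{x^jy^k}$ with $k\ge2$ is a rational expression in the derivatives $F_{x^{j'}}$ and $F_{x^{j''}y}$; the parabolic jet space of order $n$ has coordinates $x,y,u,\{u_{x^j}\}_{1\le j\le n},\{u_{x^jy}\}_{0\le j\le n-1}$. A differential invariant of order (at most) $n$ is a (locally defined, analytic) function $\mathsf I$ on the part of this jet space where $u_{xx}\ne0$ and $u_{xx}u_{xxy}-u_{xy}u_{xxx}\neq0$ such that, whenever a transformation in $\mathsf{SA}_3(\mathbb{R})$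 (close to the identity) maps $\{u=F(x,y)\}$ to $\{v=G(s,t)\}$, the value of $\mathsf I$ on the jet of $G$ at $(s,t)$ equals its value on the jet of $F$ at the corresponding point $(x,y)$. Fractional powers with denominator $3$ denote real powers of the real cube root. *)

theory Defs
  imports "HOL-Analysis.Analysis"
begin

(* Multi-indices on a Euclidean space are the extensional functions Basis -> nat.  On the reals,
   has_sum is unconditional (i.e. absolute) convergence, so this is the usual notion of a function
   given near a by a convergent power series in the coordinates of x - a. *)
definition real_analytic_at :: "('a::euclidean_space \<Rightarrow> real) \<Rightarrow> 'a \<Rightarrow> bool" where
  "real_analytic_at f a \<longleftrightarrow>
     (\<exists>(c :: ('a \<Rightarrow> nat) \<Rightarrow> real) r. r > 0 \<and>
        (\<forall>x\<in>ball a r.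
           ((\<lambda>\<alpha>. c \<alpha> * (\<Prod>b\<in>Basis. ((x - a) \<bullet> b) ^ \<alpha> b)) has_sum f x) (Basis \<rightarrow>\<^sub>E UNIV)))"

definition real_analytic_on :: "('a::euclidean_space \<Rightarrow> real) \<Rightarrow> 'a set \<Rightarrow> bool" where
  "real_analytic_on f S \<longleftrightarrow> (\<forall>a\<in>S. real_analytic_at f a)"

definition partial_x :: "(real \<times> real \<Rightarrow> real) \<Rightarrow> real \<times> real \<Rightarrow> real" where
  "partial_x F = (\<lambda>(x, y). deriv (\<lambda>t. F (t, y)) x)"

definition partial_y :: "(real \<times> real \<Rightarrow> real) \<Rightarrow> real \<times> real \<Rightarrow> real" where
  "partial_y F = (\<lambda>(x, y). deriv (\<lambda>t. F (x, t)) y)"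

definition partial :: "nat \<Rightarrow> nat \<Rightarrow> (real \<times> real \<Rightarrow> real) \<Rightarrow> real \<times> real \<Rightarrow> real" where
  "partial j k F = (partial_x ^^ j) ((partial_y ^^ k) F)"

definition S_fun :: "(real \<times> real \<Rightarrow> real) \<Rightarrow> real \<times> real \<Rightarrow> real" where
  "S_fun F p =
     (partial 2 0 F p * partial 2 1 F p - partial 1 1 F p * partial 3 0 F p) / (partial 2 0 F p)\<^sup>2"

definition parabolic_surface :: "(real \<times> real) set \<Rightarrow> (real \<times> real \<Rightarrow> real) \<Rightarrow> bool" where
  "parabolic_surface U F \<longleftrightarrow> open U \<and> real_analytic_on F U \<and>
     (\<forall>p\<in>U. partial 2 0 F p \<noteq> 0
          \<and> partial 2 0 F p * partial 0 2 F p - (partial 1 1 F p)\<^sup>2 = 0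
          \<and> S_fun F p \<noteq> 0)"

definition graph_point :: "(real \<times> real \<Rightarrow> real) \<Rightarrow> real \<times> real \<Rightarrow> real^3" where
  "graph_point F p = vector [fst p, snd p, F p]"

definition SA3 :: "((real^3^3) \<times> (real^3)) set" where
  "SA3 = {(A, b). det A = 1}"

definition affine_act :: "(real^3^3) \<times> (real^3) \<Rightarrow> real^3 \<Rightarrow> real^3" where
  "affine_act g p = fst g *v p + snd g"

(* Order of the coordinates: x, y, u, u_x, u_xx, u_xxx, u_xxxx, u_y, u_xy, u_xxy, u_xxxy. *)
type_synonym jet4 =
  "real \<times> real \<times> real \<times> real \<times> real \<times> real \<times> real \<times> real \<times> real \<times> real \<times> real"

definition jet :: "(real \<times> real \<Rightarrow> real) \<Rightarrow> real \<times> real \<Rightarrow> jet4" where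
  "jet F p = (fst p, snd p, F p,
     partial 1 0 F p, partial 2 0 F p, partial 3 0 F p, partial 4 0 F p,
     partial 0 1 F p, partial 1 1 F p, partial 2 1 F p, partial 3 1 F p)"

definition jet_region :: "jet4 set" where
  "jet_region = {(x, y, u, u_x, u_xx, u_xxx, u_xxxx, u_y, u_xy, u_xxy, u_xxxy).
     u_xx \<noteq> 0 \<and> u_xx * u_xxy - u_xy * u_xxx \<noteq> 0}"

(* The real cube root of a negative number is root 3 of it (odd roots are odd functions here),
   whereas z powr (2/3) would not give the intended value for z < 0. *)
definition W :: "jet4 \<Rightarrow> real" where
  "W = (\<lambda>(x, y, u, u_x, u_xx, u_xxx, u_xxxx, u_y, u_xy, u_xxy, u_xxxy).
     (u_xx\<^sup>2 * u_xxxy - u_xx * u_xy * u_xxxx + 2 * u_xy * u_xxx\<^sup>2 - 2 * u_xx * u_xxx * u_xxy)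
     / (u_xx\<^sup>2 * (root 3 (u_xx * u_xxy - u_xy * u_xxx))\<^sup>2))"

(* I is a locally defined differential invariant of order at most 4, with domain D.  How close to
   the identity the transformation has to be may depend on the jet at which it is applied. *)
definition differential_invariant :: "jet4 set \<Rightarrow> (jet4 \<Rightarrow> real) \<Rightarrow> bool" where
  "differential_invariant D I \<longleftrightarrow>
     open D \<and> D \<subseteq> jet_region \<and> real_analytic_on I D \<and>
     (\<forall>j\<in>D. \<exists>\<epsilon>>0. \<forall>g\<in>SA3. dist g (mat 1, 0) < \<epsilon> \<longrightarrow>
        (\<forall>U F V G. parabolic_surface U F \<longrightarrow> parabolic_surface V G \<longrightarrow>
           affine_act g ` graph_point F ` U = graph_point G ` V \<longrightarrow>
           (\<forall>p\<in>U. \<forall>q\<in>V. affine_act g (graph_point F p) = graph_point G q \<longrightarrow>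
              jet F p = j \<longrightarrow> jet G q \<in> D \<longrightarrow> I (jet G q) = I (jet F p))))"

end

theory Submission
  imports Defs "HOL-Computational_Algebra.Polynomial"
begin

text \<open>
  Let \<open>h = u\<^sub>x\<^sub>y / u\<^sub>x\<^sub>x\<close> be the slope of the projected rulings; \<open>u\<^sub>x\<close>, \<open>u\<^sub>y\<close> and \<open>h\<close> are constant
  along the rulings, \<open>S = h\<^sub>x\<close>, and
  \<open>W = h\<^sub>x\<^sub>x / (u\<^sub>x\<^sub>x\<^bsup>1/3\<^esup> h\<^sub>x\<^bsup>2/3\<^esup>)\<close>.
  An affine map with Jacobian \<open>J\<close> on the base, whose second base component has derivative \<open>D\<close> along the
  ruling field \<open>\<partial>\<^sub>y - h \<partial>\<^sub>x\<close>, sends \<open>u\<^sub>x\<^sub>x\<close> to \<open>D\<^sup>2 u\<^sub>x\<^sub>x / J\<^sup>3\<close>, \<open>h\<^sub>x\<close> to \<open>h\<^sub>x / D\<close> and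
  \<open>h\<^sub>x\<^sub>x\<close> to \<open>h\<^sub>x\<^sub>x / J\<close>, so \<open>W\<close> is invariant.

  Conversely, take \<open>W\<close> together with \<open>x, y, u, u\<^sub>x, u\<^sub>y, h, u\<^sub>x\<^sub>x, h\<^sub>x, u\<^sub>x\<^sub>x\<^sub>x, u\<^sub>x\<^sub>x\<^sub>x\<^sub>x\<close> as coordinates
  on the jet space. At every jet the velocities of suitable one-parameter families of transformations span
  the last ten directions, so the derivative of a differential invariant vanishes in these directions.
  That the invariance may be used at an arbitrary jet requires a surface with this jet, together with
  its image: both are envelopes of polynomial one-parameter families of planes, whose parameter
  at the point \<open>(x, y)\<close> solves an equation that is linear in \<open>x\<close> and \<open>y\<close>; its solution is analytic
  by the contraction principle for power series with absolutely summable coefficients.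
\<close>

section \<open>Power series with absolutely summable coefficients\<close>


text \<open>The group and the jet space both have dimension 11, so an invariant exists because
  orbits lose a dimension, and it is the only one because ten independent velocities show that they
  lose no more. The obstacle is the definition of an invariant. It speaks of pairs of surfaces
  instead of an action on jets, and it grants invariance only for maps within an
  \<open>\<epsilon>\<close> that depends on the jet. Hence each jet yields infinitesimal information
  only, and each use of it needs two analytic graphs of which one is exactly the image of the other.
  Pushing a graph forward would call for an analytic inverse function theorem. Planes avoid this: an
  affine map acts linearly on their coefficients, an envelope is parabolic by construction, and the
  parameter of the plane matches a point with its image. Vanishing derivatives give constancy only
  on convex pieces of a level set of \<open>W\<close>, whence the local form of the
  conclusion.\<close>

abbreviation multi_indices :: "('a::euclidean_space \<Rightarrow> nat) set" where
  "multi_indices \<equiv> Basis \<rightarrow>\<^sub>E UNIV"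

definition mdeg :: "('a::euclidean_space \<Rightarrow> nat) \<Rightarrow> nat" where
  "mdeg \<alpha> = (\<Sum>b\<in>Basis. \<alpha> b)"

definition mmono :: "'a::euclidean_space \<Rightarrow> ('a \<Rightarrow> nat) \<Rightarrow> real" where
  "mmono v \<alpha> = (\<Prod>b\<in>Basis. (v \<bullet> b) ^ \<alpha> b)"

text \<open>Cubes instead of balls: at a corner every monomial has absolute value exactly
  \<open>\<rho> ^ mdeg \<alpha>\<close>, so convergence there amounts to summability of the weighted
  coefficients.\<close>

definition pbox :: "'a::euclidean_space \<Rightarrow> real \<Rightarrow> 'a set" where
  "pbox a \<rho> = {x. \<forall>b\<in>Basis. \<bar>(x - a) \<bullet> b\<bar> \<le> \<rho>}"

text \<open>The coefficients are a parameter because differentiation is carried out on them;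
  \<open>pser\<close> retains only the bound on their norm.\<close>

definition pcoef :: "'a::euclidean_space \<Rightarrow> real \<Rightarrow> (('a \<Rightarrow> nat) \<Rightarrow> real) \<Rightarrow> ('a \<Rightarrow> real) \<Rightarrow> bool" where
  "pcoef a \<rho> c f \<longleftrightarrow> \<rho> > 0 \<and> (\<lambda>\<alpha>. \<bar>c \<alpha>\<bar> * \<rho> ^ mdeg \<alpha>) summable_on multi_indices \<and>
     (\<forall>x\<in>pbox a \<rho>. ((\<lambda>\<alpha>. c \<alpha> * mmono (x - a) \<alpha>) has_sum f x) multi_indices)"

text \<open>\<open>pser a \<rho> N f\<close>: on the closed cube of half side \<open>\<rho>\<close> around \<open>a\<close>, \<open>f\<close> is a power series of weighted
  \<open>\<ell>\<^sup>1\<close> norm at most \<open>N\<close>. These norms are submultiplicative and add up along infinite sums, which gives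
  the closure properties of analytic functions without any rearrangement of multiple series.\<close>

definition pser :: "'a::euclidean_space \<Rightarrow> real \<Rightarrow> real \<Rightarrow> ('a \<Rightarrow> real) \<Rightarrow> bool" where
  "pser a \<rho> N f \<longleftrightarrow> (\<exists>c. pcoef a \<rho> c f \<and> infsum (\<lambda>\<alpha>. \<bar>c \<alpha>\<bar> * \<rho> ^ mdeg \<alpha>) multi_indices \<le> N)"

section \<open>Monomials on cubes and the weighted norm\<close>

lemma mmono_bound:
  assumes "\<And>b. b \<in> Basis \<Longrightarrow> \<bar>v \<bullet> b\<bar> \<le> \<rho>"
  shows "\<bar>mmono v \<alpha>\<bar> \<le> \<rho> ^ mdeg \<alpha>"
proof -
  have "\<bar>mmono v \<alpha>\<bar> = (\<Prod>b\<in>Basis. \<bar>v \<bullet> b\<bar> ^ \<alpha> b)"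
    by (simp add: mmono_def abs_prod power_abs)
  also have "\<dots> \<le> (\<Prod>b\<in>Basis. \<rho> ^ \<alpha> b)"
  proof (rule prod_mono)
    fix b :: 'a assume "b \<in> Basis"
    then show "0 \<le> \<bar>v \<bullet> b\<bar> ^ \<alpha> b \<and> \<bar>v \<bullet> b\<bar> ^ \<alpha> b \<le> \<rho> ^ \<alpha> b"
      using power_mono[OF assms] by simp
  qed
  finally show ?thesis by (simp add: mdeg_def power_sum)
qed

lemma pbox_mono: "\<rho>' \<le> \<rho> \<Longrightarrow> pbox a \<rho>' \<subseteq> pbox a \<rho>"
  by (fastforce simp: pbox_def)

lemma center_in_pbox: "\<rho> \<ge> 0 \<Longrightarrow> a \<in> pbox a \<rho>"
  by (simp add: pbox_def)

lemma ball_subset_pbox: "ball a \<rho> \<subseteq> pbox a \<rho>"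
proof
  fix x assume "x \<in> ball a \<rho>"
  then have "norm (x - a) < \<rho>" by (simp add: dist_norm norm_minus_commute)
  then show "x \<in> pbox a \<rho>"
    using Basis_le_norm[of _ "x - a"] by (force simp: pbox_def)
qed

lemma pbox_subset_ball:
  assumes "r > 0"
  obtains \<rho> where "\<rho> > 0" "pbox (a::'a::euclidean_space) \<rho> \<subseteq> ball a r"
proof -
  define \<rho> where "\<rho> = r / (2 * DIM('a))"
  have "x \<in> ball a r" if "x \<in> pbox a \<rho>" for x
  proof -
    have "norm (x - a) \<le> (\<Sum>b\<in>Basis. \<bar>(x - a) \<bullet> b\<bar>)" by (rule norm_le_l1)
    also have "\<dots> \<le> (\<Sum>b\<in>(Basis::'a set). \<rho>)"
      using that by (intro sum_mono) (auto simp: pbox_def)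
    also have "\<dots> < r" using assms by (simp add: \<rho>_def)
    finally show ?thesis by (simp add: dist_norm norm_minus_commute)
  qed
  moreover have "\<rho> > 0" using assms by (simp add: \<rho>_def)
  ultimately show ?thesis using that by blast
qed

lemma pser_bound:
  assumes "pser a \<rho> N f" "x \<in> pbox a \<rho>"
  shows "\<bar>f x\<bar> \<le> N"
proof -
  obtain c where c: "pcoef a \<rho> c f" "infsum (\<lambda>\<alpha>. \<bar>c \<alpha>\<bar> * \<rho> ^ mdeg \<alpha>) multi_indices \<le> N"
    using assms(1) by (auto simp: pser_def)
  have "norm (f x) \<le> infsum (\<lambda>\<alpha>. \<bar>c \<alpha>\<bar> * \<rho> ^ mdeg \<alpha>) multi_indices"
  proof (rule norm_infsum_le)
    show "((\<lambda>\<alpha>. c \<alpha> * mmono (x - a) \<alpha>) has_sum f x) multi_indices"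
      using c(1) assms(2) by (auto simp: pcoef_def)
    show "((\<lambda>\<alpha>. \<bar>c \<alpha>\<bar> * \<rho> ^ mdeg \<alpha>) has_sum infsum (\<lambda>\<alpha>. \<bar>c \<alpha>\<bar> * \<rho> ^ mdeg \<alpha>) multi_indices) multi_indices"
      using c(1) by (auto simp: pcoef_def)
    show "norm (c \<alpha> * mmono (x - a) \<alpha>) \<le> \<bar>c \<alpha>\<bar> * \<rho> ^ mdeg \<alpha>" for \<alpha>
      using assms(2) mmono_bound[of "x - a" \<rho> \<alpha>]
      by (auto simp: abs_mult pbox_def intro!: mult_left_mono)
  qed
  then show ?thesis using c(2) by simp
qed

lemma pser_nonneg: "pser a \<rho> N f \<Longrightarrow> N \<ge> 0"
  using pser_bound[of a \<rho> N f a] center_in_pbox[of \<rho> a] by (force simp: pser_def pcoef_def)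

lemma pser_pos: "pser a \<rho> N f \<Longrightarrow> \<rho> > 0"
  by (auto simp: pser_def pcoef_def)

lemma pser_mono: "pser a \<rho> N f \<Longrightarrow> N \<le> N' \<Longrightarrow> pser a \<rho> N' f"
  by (force simp: pser_def)

lemma pser_cong:
  assumes "pser a \<rho> N f" "\<And>x. x \<in> pbox a \<rho> \<Longrightarrow> f x = g x"
  shows "pser a \<rho> N g"
  using assms by (auto simp: pser_def pcoef_def)

lemma pcoef_shrink:
  assumes "pcoef a \<rho> c f" "0 < \<rho>'" "\<rho>' \<le> \<rho>"
  shows "pcoef a \<rho>' c f"
proof -
  have "(\<lambda>\<alpha>. \<bar>c \<alpha>\<bar> * \<rho>' ^ mdeg \<alpha>) summable_on multi_indices"
    by (rule summable_on_comparison_test[where f="\<lambda>\<alpha>. \<bar>c \<alpha>\<bar> * \<rho> ^ mdeg \<alpha>"])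
       (use assms in \<open>auto simp: pcoef_def intro!: mult_left_mono power_mono\<close>)
  then show ?thesis
    using assms pbox_mono[of \<rho>' \<rho> a] by (auto simp: pcoef_def)
qed

lemma pser_shrink:
  assumes "pser a \<rho> N f" "0 < \<rho>'" "\<rho>' \<le> \<rho>"
  shows "pser a \<rho>' N f"
proof -
  obtain c where c: "pcoef a \<rho> c f" "infsum (\<lambda>\<alpha>. \<bar>c \<alpha>\<bar> * \<rho> ^ mdeg \<alpha>) multi_indices \<le> N"
    using assms(1) by (auto simp: pser_def)
  have c': "pcoef a \<rho>' c f" using pcoef_shrink[OF c(1) assms(2,3)] .
  have "infsum (\<lambda>\<alpha>. \<bar>c \<alpha>\<bar> * \<rho>' ^ mdeg \<alpha>) multi_indices \<le> infsum (\<lambda>\<alpha>. \<bar>c \<alpha>\<bar> * \<rho> ^ mdeg \<alpha>) multi_indices"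
    by (rule infsum_mono) (use assms c(1) c' in \<open>auto simp: pcoef_def intro!: mult_left_mono power_mono\<close>)
  then show ?thesis using c c' by (auto simp: pser_def intro!: exI[of _ c])
qed

lemma pser_monomial:
  assumes "\<rho> > 0" "\<gamma> \<in> multi_indices"
  shows "pser a \<rho> (\<bar>k\<bar> * \<rho> ^ mdeg \<gamma>) (\<lambda>x. k * mmono (x - a) \<gamma>)"
proof -
  define c where "c = (\<lambda>\<alpha>. if \<alpha> = \<gamma> then k else 0)"
  have "((\<lambda>\<alpha>. \<bar>c \<alpha>\<bar> * \<rho> ^ mdeg \<alpha>) has_sum \<bar>k\<bar> * \<rho> ^ mdeg \<gamma>) multi_indices"
    by (rule has_sum_finite_neutralI[of "{\<gamma>}"]) (use assms in \<open>auto simp: c_def\<close>)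
  moreover have "((\<lambda>\<alpha>. c \<alpha> * mmono (x - a) \<alpha>) has_sum k * mmono (x - a) \<gamma>) multi_indices" for x
    by (rule has_sum_finite_neutralI[of "{\<gamma>}"]) (use assms in \<open>auto simp: c_def\<close>)
  ultimately show ?thesis
    unfolding pser_def pcoef_def using assms(1)
    by (intro exI[of _ c]) (auto simp: infsumI has_sum_imp_summable)
qed

definition mzero :: "'a::euclidean_space \<Rightarrow> nat" where
  "mzero = (\<lambda>b\<in>Basis. 0)"

definition munit :: "'a \<Rightarrow> 'a::euclidean_space \<Rightarrow> nat" where
  "munit b = (\<lambda>b'\<in>Basis. if b' = b then 1 else 0)"

lemma mzero [simp]: "mzero \<in> multi_indices" "mdeg mzero = 0" "mmono v mzero = 1"
  by (simp_all add: mzero_def mdeg_def mmono_def)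

lemma munit [simp]:
  assumes "b \<in> Basis"
  shows "munit b \<in> multi_indices" "mdeg (munit b) = 1" "mmono v (munit b) = v \<bullet> b"
proof -
  show "munit b \<in> multi_indices" by (simp add: munit_def)
  show "mdeg (munit b) = 1" using assms by (simp add: mdeg_def munit_def)
  have "mmono v (munit b) = (\<Prod>b'\<in>Basis. if b' = b then v \<bullet> b else 1)"
    unfolding mmono_def by (intro prod.cong) (auto simp: munit_def)
  then show "mmono v (munit b) = v \<bullet> b" using assms by simp
qed

lemma pser_const: "\<rho> > 0 \<Longrightarrow> pser a \<rho> \<bar>k\<bar> (\<lambda>_. k)"
  using pser_monomial[of \<rho> mzero a k] by simp

lemma pser_coord: "\<rho> > 0 \<Longrightarrow> b \<in> Basis \<Longrightarrow> pser a \<rho> \<rho> (\<lambda>x. (x - a) \<bullet> b)"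
  using pser_monomial[of \<rho> "munit b" a 1] by simp

text \<open>Fubini for the family of all terms of all series: its norm is summable over pairs of an
  index and a multi-index, so summing over the index first gives the coefficients of the limit.
  Sums, products, compositions and the limit of the fixed point iteration are all reduced to this
  exchange.\<close>

lemma pser_infsum:
  fixes a :: "'a::euclidean_space"
  assumes f: "\<And>i. i \<in> X \<Longrightarrow> pser a \<rho> (N i) (f i)"
    and N: "(N has_sum K) X" and "\<rho> > 0"
    and g: "\<And>x. x \<in> pbox a \<rho> \<Longrightarrow> ((\<lambda>i. f i x) has_sum g x) X"
  shows "pser a \<rho> K g"
proof -
  have "\<forall>i\<in>X. \<exists>c. pcoef a \<rho> c (f i) \<and> infsum (\<lambda>\<alpha>. \<bar>c \<alpha>\<bar> * \<rho> ^ mdeg \<alpha>) multi_indices \<le> N i"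
    using f by (auto simp: pser_def)
  then obtain c where c: "\<And>i. i \<in> X \<Longrightarrow> pcoef a \<rho> (c i) (f i)"
      "\<And>i. i \<in> X \<Longrightarrow> infsum (\<lambda>\<alpha>. \<bar>c i \<alpha>\<bar> * \<rho> ^ mdeg \<alpha>) multi_indices \<le> N i"
    by metis
  let ?M = "multi_indices :: ('a \<Rightarrow> nat) set"
  let ?w = "\<lambda>(i, \<alpha>). \<bar>c i \<alpha>\<bar> * \<rho> ^ mdeg \<alpha>"
  define n where "n i = infsum (\<lambda>\<alpha>. \<bar>c i \<alpha>\<bar> * \<rho> ^ mdeg \<alpha>) ?M" for i
  have n: "((\<lambda>\<alpha>. \<bar>c i \<alpha>\<bar> * \<rho> ^ mdeg \<alpha>) has_sum n i) ?M" if "i \<in> X" for i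
    using c(1)[OF that] by (auto simp: pcoef_def n_def)
  have n0: "n i \<ge> 0" for i unfolding n_def using \<open>\<rho> > 0\<close> by (intro infsum_nonneg) auto
  have nX: "n summable_on X"
    by (rule summable_on_comparison_test[OF has_sum_imp_summable[OF N]]) (use c(2) n0 in \<open>auto simp: n_def\<close>)
  have nK: "infsum n X \<le> K"
    using c(2) by (intro has_sum_mono[OF has_sum_infsum[OF nX] N]) (auto simp: n_def)
  \<comment> \<open>The norms \<open>n i\<close> of the single series are dominated by
    \<open>N i\<close>, which makes the whole double family summable.\<close>
  have w: "?w summable_on X \<times> ?M"
    by (rule summable_on_SigmaI[where g=n]) (use n nX \<open>\<rho> > 0\<close> in auto)
  have wsum: "(?w has_sum infsum n X) (X \<times> ?M)"
    by (rule has_sum_SigmaI[where g=n]) (use n nX w in auto)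
  have wsum': "((\<lambda>(\<alpha>, i). \<bar>c i \<alpha>\<bar> * \<rho> ^ mdeg \<alpha>) has_sum infsum n X) (?M \<times> X)"
    using wsum by (subst (asm) has_sum_swap) (simp add: case_prod_unfold)
  have cX: "(\<lambda>i. \<bar>c i \<alpha>\<bar>) summable_on X" if "\<alpha> \<in> ?M" for \<alpha>
  proof -
    have "(\<lambda>i. \<bar>c i \<alpha>\<bar> * \<rho> ^ mdeg \<alpha>) summable_on X"
      using summable_on_SigmaD1[OF has_sum_imp_summable[OF wsum'] that] by simp
    from summable_on_cmult_left[OF this, of "inverse (\<rho> ^ mdeg \<alpha>)"] show ?thesis
      using \<open>\<rho> > 0\<close> by (simp add: mult.assoc)
  qed
  define d where "d \<alpha> = infsum (\<lambda>i. c i \<alpha>) X" for \<alpha>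
  have d: "((\<lambda>i. c i \<alpha>) has_sum d \<alpha>) X" if "\<alpha> \<in> ?M" for \<alpha>
    using abs_summable_summable[of "\<lambda>i. c i \<alpha>"] cX[OF that] by (simp add: d_def)
  have dle: "\<bar>d \<alpha>\<bar> \<le> infsum (\<lambda>i. \<bar>c i \<alpha>\<bar>) X" if "\<alpha> \<in> ?M" for \<alpha>
    using norm_infsum_bound[of "\<lambda>i. c i \<alpha>" X] cX[OF that] by (simp add: d_def)
  have e: "((\<lambda>\<alpha>. infsum (\<lambda>i. \<bar>c i \<alpha>\<bar>) X * \<rho> ^ mdeg \<alpha>) has_sum infsum n X) ?M"
  proof (rule has_sum_SigmaD[OF wsum'])
    fix \<alpha> assume "\<alpha> \<in> ?M"
    show "((\<lambda>i. case (\<alpha>, i) of (\<alpha>, i) \<Rightarrow> \<bar>c i \<alpha>\<bar> * \<rho> ^ mdeg \<alpha>) has_sum infsum (\<lambda>i. \<bar>c i \<alpha>\<bar>) X * \<rho> ^ mdeg \<alpha>) X"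
      using has_sum_cmult_left[OF has_sum_infsum[OF cX[OF \<open>\<alpha> \<in> ?M\<close>]]] by simp
  qed
  have dsum: "(\<lambda>\<alpha>. \<bar>d \<alpha>\<bar> * \<rho> ^ mdeg \<alpha>) summable_on ?M"
    by (rule summable_on_comparison_test[OF has_sum_imp_summable[OF e]])
       (use dle \<open>\<rho> > 0\<close> in \<open>auto intro!: mult_right_mono\<close>)
  have dK: "infsum (\<lambda>\<alpha>. \<bar>d \<alpha>\<bar> * \<rho> ^ mdeg \<alpha>) ?M \<le> K"
  proof -
    have "infsum (\<lambda>\<alpha>. \<bar>d \<alpha>\<bar> * \<rho> ^ mdeg \<alpha>) ?M \<le> infsum n X"
      by (rule has_sum_mono[OF has_sum_infsum[OF dsum] e])
         (use dle \<open>\<rho> > 0\<close> in \<open>auto intro!: mult_right_mono\<close>)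
    then show ?thesis using nK by simp
  qed
  have "((\<lambda>\<alpha>. d \<alpha> * mmono (x - a) \<alpha>) has_sum g x) ?M" if x: "x \<in> pbox a \<rho>" for x
  proof -
    let ?u = "\<lambda>(i, \<alpha>). c i \<alpha> * mmono (x - a) \<alpha>"
    have "(\<lambda>p. norm (?u p)) summable_on X \<times> ?M"
      by (rule Infinite_Sum.abs_summable_on_comparison_test'[OF w])
         (use x mmono_bound[of "x - a" \<rho>] in \<open>auto simp: abs_mult pbox_def intro!: mult_left_mono\<close>)
    then have u: "?u summable_on X \<times> ?M" by (rule abs_summable_summable)
    have "(?u has_sum g x) (X \<times> ?M)"
      by (rule has_sum_SigmaI[where g="\<lambda>i. f i x"]) (use c(1) x g u in \<open>auto simp: pcoef_def\<close>)
    then have "((\<lambda>(\<alpha>, i). c i \<alpha> * mmono (x - a) \<alpha>) has_sum g x) (?M \<times> X)"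
      by (subst (asm) has_sum_swap) (simp add: case_prod_unfold)
    then show ?thesis
      by (rule has_sum_SigmaD) (use has_sum_cmult_left[OF d] in auto)
  qed
  then show ?thesis
    unfolding pser_def pcoef_def using dsum dK \<open>\<rho> > 0\<close> by (intro exI[of _ d]) auto
qed

lemma pser_add:
  assumes "pser a \<rho> N f" "pser a \<rho> M g"
  shows "pser a \<rho> (N + M) (\<lambda>x. f x + g x)"
\<comment> \<open>A sum of two terms is treated as a sum over a two-element index type.\<close>
proof (rule pser_infsum[where X="UNIV :: bool set" and N="\<lambda>i. if i then N else M"
      and f="\<lambda>i. if i then f else g"])
  show "((\<lambda>i. if i then N else M) has_sum N + M) (UNIV :: bool set)"
    by (rule has_sum_finiteI) (auto simp: UNIV_bool)
  show "((\<lambda>i. (if i then f else g) x) has_sum f x + g x) (UNIV :: bool set)" for x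
    by (rule has_sum_finiteI) (auto simp: UNIV_bool)
qed (use assms pser_pos[OF assms(1)] in auto)

lemma has_sum_product:
  fixes f :: "'a \<Rightarrow> real" and g :: "'b \<Rightarrow> real"
  assumes "(f has_sum S) A" "(g has_sum T) B"
  shows "((\<lambda>(x, y). f x * g y) has_sum S * T) (A \<times> B)"
proof -
  have f': "(\<lambda>x. \<bar>f x\<bar>) summable_on A" and g': "(\<lambda>x. \<bar>g x\<bar>) summable_on B"
    using has_sum_imp_summable[OF assms(1)] has_sum_imp_summable[OF assms(2)]
    by (auto dest: iffD1[OF summable_on_iff_abs_summable_on_real])
  have "(\<lambda>(x, y). \<bar>f x\<bar> * \<bar>g y\<bar>) summable_on A \<times> B"
    by (rule summable_on_SigmaI[where g="\<lambda>x. \<bar>f x\<bar> * infsum (\<lambda>y. \<bar>g y\<bar>) B"])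
       (use has_sum_cmult_right[OF has_sum_infsum[OF g']] summable_on_cmult_left[OF f'] in auto)
  then have "(\<lambda>p. norm (case p of (x, y) \<Rightarrow> f x * g y)) summable_on A \<times> B"
    by (simp add: case_prod_unfold abs_mult)
  then have s: "(\<lambda>(x, y). f x * g y) summable_on A \<times> B" by (rule abs_summable_summable)
  show ?thesis
    by (rule has_sum_SigmaI[where g="\<lambda>x. f x * T"])
       (use has_sum_cmult_right[OF assms(2)] has_sum_cmult_left[OF assms(1)] s in auto)
qed

text \<open>The product is summed over pairs of multi-indices, each pair giving one monomial with
  exponent \<open>pl \<alpha> \<beta>\<close>. Terms with equal exponents are collected by
  \<open>pser_infsum\<close>, so no Cauchy product has to be formed.\<close>

lemma pser_mult:
  fixes a :: "'a::euclidean_space"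
  assumes "pser a \<rho> N f" "pser a \<rho> M g"
  shows "pser a \<rho> (N * M) (\<lambda>x. f x * g x)"
proof -
  obtain c where c: "pcoef a \<rho> c f" "infsum (\<lambda>\<alpha>. \<bar>c \<alpha>\<bar> * \<rho> ^ mdeg \<alpha>) multi_indices \<le> N"
    using assms(1) by (auto simp: pser_def)
  obtain d where d: "pcoef a \<rho> d g" "infsum (\<lambda>\<alpha>. \<bar>d \<alpha>\<bar> * \<rho> ^ mdeg \<alpha>) multi_indices \<le> M"
    using assms(2) by (auto simp: pser_def)
  have \<rho>: "\<rho> > 0" using assms(1) by (rule pser_pos)
  let ?M = "multi_indices :: ('a \<Rightarrow> nat) set"
  define S where "S = infsum (\<lambda>\<alpha>. \<bar>c \<alpha>\<bar> * \<rho> ^ mdeg \<alpha>) ?M"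
  define T where "T = infsum (\<lambda>\<alpha>. \<bar>d \<alpha>\<bar> * \<rho> ^ mdeg \<alpha>) ?M"
  have S: "((\<lambda>\<alpha>. \<bar>c \<alpha>\<bar> * \<rho> ^ mdeg \<alpha>) has_sum S) ?M" and T: "((\<lambda>\<alpha>. \<bar>d \<alpha>\<bar> * \<rho> ^ mdeg \<alpha>) has_sum T) ?M"
    using c(1) d(1) by (auto simp: pcoef_def S_def T_def)
  define pl where "pl \<alpha> \<beta> = (\<lambda>b\<in>Basis. \<alpha> b + \<beta> b)" for \<alpha> \<beta> :: "'a \<Rightarrow> nat"
  have pl: "pl \<alpha> \<beta> \<in> ?M" "mdeg (pl \<alpha> \<beta>) = mdeg \<alpha> + mdeg \<beta>" "mmono v (pl \<alpha> \<beta>) = mmono v \<alpha> * mmono v \<beta>" for \<alpha> \<beta> v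
    by (auto simp: pl_def mdeg_def mmono_def sum.distrib power_add prod.distrib)
  have "pser a \<rho> (S * T) (\<lambda>x. f x * g x)"
  proof (rule pser_infsum[where X="?M \<times> ?M" and N="\<lambda>(\<alpha>, \<beta>). (\<bar>c \<alpha>\<bar> * \<rho> ^ mdeg \<alpha>) * (\<bar>d \<beta>\<bar> * \<rho> ^ mdeg \<beta>)"
        and f="\<lambda>(\<alpha>, \<beta>) x. (c \<alpha> * d \<beta>) * mmono (x - a) (pl \<alpha> \<beta>)"])
    fix i assume "i \<in> ?M \<times> ?M"
    then obtain \<alpha> \<beta> where i: "i = (\<alpha>, \<beta>)" by auto
    show "pser a \<rho> (case i of (\<alpha>, \<beta>) \<Rightarrow> (\<bar>c \<alpha>\<bar> * \<rho> ^ mdeg \<alpha>) * (\<bar>d \<beta>\<bar> * \<rho> ^ mdeg \<beta>))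
         (case i of (\<alpha>, \<beta>) \<Rightarrow> \<lambda>x. (c \<alpha> * d \<beta>) * mmono (x - a) (pl \<alpha> \<beta>))"
      using pser_monomial[OF \<rho> pl(1)[of \<alpha> \<beta>], of a "c \<alpha> * d \<beta>"]
      by (simp add: i pl abs_mult power_add mult_ac)
  next
    show "((\<lambda>(\<alpha>, \<beta>). \<bar>c \<alpha>\<bar> * \<rho> ^ mdeg \<alpha> * (\<bar>d \<beta>\<bar> * \<rho> ^ mdeg \<beta>)) has_sum S * T) (?M \<times> ?M)"
      by (rule has_sum_product[OF S T])
  next
    fix x assume "x \<in> pbox a \<rho>"
    then have "((\<lambda>(\<alpha>, \<beta>). (c \<alpha> * mmono (x - a) \<alpha>) * (d \<beta> * mmono (x - a) \<beta>)) has_sum f x * g x) (?M \<times> ?M)"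
      using c(1) d(1) by (intro has_sum_product) (auto simp: pcoef_def)
    then show "((\<lambda>i. (case i of (\<alpha>, \<beta>) \<Rightarrow> \<lambda>x. (c \<alpha> * d \<beta>) * mmono (x - a) (pl \<alpha> \<beta>)) x) has_sum f x * g x) (?M \<times> ?M)"
      by (simp add: case_prod_unfold pl mult_ac)
  qed (fact \<rho>)
  moreover have "S * T \<le> N * M"
    using c(2) d(2) has_sum_nonneg[OF S] has_sum_nonneg[OF T] \<rho> by (intro mult_mono) (auto simp: S_def T_def)
  ultimately show ?thesis by (rule pser_mono)
qed

lemma pser_power: "pser a \<rho> N f \<Longrightarrow> pser a \<rho> (N ^ n) (\<lambda>x. f x ^ n)"
  by (induction n) (auto intro!: pser_mult pser_const[of \<rho> a 1, simplified] simp: pser_pos)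

lemma pser_prod:
  "finite I \<Longrightarrow> (\<And>i. i \<in> I \<Longrightarrow> pser a \<rho> (N i) (f i)) \<Longrightarrow> \<rho> > 0 \<Longrightarrow>
    pser a \<rho> (\<Prod>i\<in>I. N i) (\<lambda>x. \<Prod>i\<in>I. f i x)"
  by (induction I rule: finite_induct) (auto intro!: pser_mult pser_const[of \<rho> a 1, simplified])

text \<open>The components of \<open>g - p\<close> have norm at most the radius of \<open>f\<close>.
  By submultiplicativity the monomial of exponent \<open>\<alpha>\<close> in them has norm at most
  \<open>\<rho> ^ mdeg \<alpha>\<close>, so substitution does not increase the norm.\<close>

lemma pser_compose:
  fixes g :: "'a::euclidean_space \<Rightarrow> 'b::euclidean_space"
  assumes f: "pser p \<rho> N f" and g: "\<And>e. e \<in> Basis \<Longrightarrow> pser a r \<rho> (\<lambda>x. (g x - p) \<bullet> e)"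
  shows "pser a r N (\<lambda>x. f (g x))"
proof -
  obtain c where c: "pcoef p \<rho> c f" "infsum (\<lambda>\<alpha>. \<bar>c \<alpha>\<bar> * \<rho> ^ mdeg \<alpha>) multi_indices \<le> N"
    using f by (auto simp: pser_def)
  have r: "r > 0" using g[THEN pser_pos] nonempty_Basis by blast
  have "pser a r (infsum (\<lambda>\<alpha>. \<bar>c \<alpha>\<bar> * \<rho> ^ mdeg \<alpha>) multi_indices) (\<lambda>x. f (g x))"
  proof (rule pser_infsum[where X=multi_indices and N="\<lambda>\<alpha>. \<bar>c \<alpha>\<bar> * \<rho> ^ mdeg \<alpha>"
        and f="\<lambda>\<alpha> x. c \<alpha> * mmono (g x - p) \<alpha>"])
    fix \<alpha> :: "'b \<Rightarrow> nat"
    have "pser a r (\<bar>c \<alpha>\<bar> * (\<Prod>e\<in>Basis. \<rho> ^ \<alpha> e)) (\<lambda>x. c \<alpha> * (\<Prod>e\<in>Basis. ((g x - p) \<bullet> e) ^ \<alpha> e))"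
      by (intro pser_mult pser_const pser_prod pser_power r g finite_Basis)
    then show "pser a r (\<bar>c \<alpha>\<bar> * \<rho> ^ mdeg \<alpha>) (\<lambda>x. c \<alpha> * mmono (g x - p) \<alpha>)"
      by (simp add: mmono_def mdeg_def power_sum)
  next
    show "((\<lambda>\<alpha>. \<bar>c \<alpha>\<bar> * \<rho> ^ mdeg \<alpha>) has_sum (\<Sum>\<^sub>\<infinity>\<alpha>\<in>multi_indices. \<bar>c \<alpha>\<bar> * \<rho> ^ mdeg \<alpha>)) multi_indices"
      using c(1) by (auto simp: pcoef_def)
  next
    fix x assume "x \<in> pbox a r"
    then have "g x \<in> pbox p \<rho>" using g[THEN pser_bound] by (auto simp: pbox_def)
    then show "((\<lambda>\<alpha>. c \<alpha> * mmono (g x - p) \<alpha>) has_sum f (g x)) multi_indices"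
      using c(1) by (auto simp: pcoef_def)
  qed (fact r)
  then show ?thesis using c(2) by (rule pser_mono)
qed

lemma real_analytic_at_iff_pser: "real_analytic_at f a \<longleftrightarrow> (\<exists>\<rho> N. pser a \<rho> N f)"
proof
  assume "real_analytic_at f a"
  then obtain c r where r: "r > 0"
    and c: "\<And>x. x \<in> ball a r \<Longrightarrow> ((\<lambda>\<alpha>. c \<alpha> * mmono (x - a) \<alpha>) has_sum f x) multi_indices"
    unfolding real_analytic_at_def mmono_def by blast
  obtain \<rho> where \<rho>: "\<rho> > 0" "pbox a \<rho> \<subseteq> ball a r"
    using pbox_subset_ball[OF r] by blast
  \<comment> \<open>The corner of the cube: all monomials are positive there, and unconditional
    convergence of a real series is absolute.\<close>
  define v where "v = (\<Sum>b\<in>Basis. \<rho> *\<^sub>R b :: 'a)"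
  have v: "v \<bullet> b = \<rho>" if "b \<in> Basis" for b
    using that by (simp add: v_def inner_sum_left inner_Basis if_distrib cong: if_cong)
  then have "a + v \<in> pbox a \<rho>" using \<rho>(1) by (auto simp: pbox_def)
  then have "((\<lambda>\<alpha>. c \<alpha> * mmono (a + v - a) \<alpha>) has_sum f (a + v)) multi_indices"
    using c \<rho>(2) by blast
  moreover have "mmono v \<alpha> = \<rho> ^ mdeg \<alpha>" for \<alpha>
    by (simp add: mmono_def mdeg_def v power_sum)
  ultimately have "(\<lambda>\<alpha>. c \<alpha> * \<rho> ^ mdeg \<alpha>) summable_on multi_indices"
    by (auto dest: has_sum_imp_summable)
  then have "(\<lambda>\<alpha>. \<bar>c \<alpha>\<bar> * \<rho> ^ mdeg \<alpha>) summable_on multi_indices"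
    using \<rho>(1) by (subst (asm) summable_on_iff_abs_summable_on_real) (simp add: abs_mult)
  then have "pcoef a \<rho> c f" using \<rho> c by (auto simp: pcoef_def)
  then show "\<exists>\<rho> N. pser a \<rho> N f" by (auto simp: pser_def)
next
  assume "\<exists>\<rho> N. pser a \<rho> N f"
  then obtain \<rho> c where c: "pcoef a \<rho> c f" by (auto simp: pser_def)
  then show "real_analytic_at f a"
    unfolding real_analytic_at_def pcoef_def using ball_subset_pbox[of a \<rho>]
    by (intro exI[of _ c] exI[of _ \<rho>]) (auto simp: mmono_def)
qed

lemma mdeg_eq_0: "\<alpha> \<in> multi_indices \<Longrightarrow> mdeg \<alpha> = 0 \<longleftrightarrow> \<alpha> = mzero"
  by (auto simp: mdeg_def mzero_def fun_eq_iff PiE_iff extensional_def)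

lemma mdeg_eq_1:
  assumes "\<alpha> \<in> multi_indices" "mdeg \<alpha> = 1"
  shows "\<exists>b\<in>Basis. \<alpha> = munit b"
proof -
  obtain b where "b \<in> Basis" "\<alpha> b = 1" "\<forall>b'\<in>Basis. b \<noteq> b' \<longrightarrow> \<alpha> b' = 0"
    using assms(2) by (auto simp: mdeg_def sum_eq_Suc0_iff)
  then have "\<alpha> = munit b"
    using assms(1) by (auto simp: munit_def fun_eq_iff PiE_iff extensional_def)
  then show ?thesis using \<open>b \<in> Basis\<close> by blast
qed

lemma mmono_0:
  assumes "\<alpha> \<in> multi_indices" "\<alpha> \<noteq> mzero"
  shows "mmono 0 \<alpha> = 0"
proof -
  have "\<exists>b\<in>Basis. \<alpha> b \<noteq> 0"
    using assms mdeg_eq_0[of \<alpha>] by (auto simp: mdeg_def)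
  then show ?thesis by (auto simp: mmono_def)
qed

lemma pcoef_center:
  assumes "pcoef a \<rho> c f"
  shows "f a = c mzero"
proof -
  have "((\<lambda>\<alpha>. c \<alpha> * mmono 0 \<alpha>) has_sum f a) multi_indices"
    using assms center_in_pbox[of \<rho> a] by (force simp: pcoef_def)
  moreover have "((\<lambda>\<alpha>. c \<alpha> * mmono 0 \<alpha>) has_sum c mzero) multi_indices"
    by (rule has_sum_finite_neutralI[of "{mzero}"]) (auto simp: mmono_0)
  ultimately show ?thesis by (rule has_sum_unique)
qed

text \<open>Without a constant term every monomial has degree at least 1, so shrinking the radius by
  a factor \<open>\<theta> \<le> 1\<close> shrinks the norm by at least this factor.\<close>

lemma pser_vanish:
  assumes "pser a \<rho> N f" "f a = 0" "\<epsilon> > 0"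
  obtains \<rho>' where "\<rho>' > 0" "\<And>r. 0 < r \<Longrightarrow> r \<le> \<rho>' \<Longrightarrow> pser a r \<epsilon> f"
proof -
  obtain c where c: "pcoef a \<rho> c f" "infsum (\<lambda>\<alpha>. \<bar>c \<alpha>\<bar> * \<rho> ^ mdeg \<alpha>) multi_indices \<le> N"
    using assms(1) by (auto simp: pser_def)
  have \<rho>: "\<rho> > 0" using assms(1) by (rule pser_pos)
  have N: "N \<ge> 0" using assms(1) by (rule pser_nonneg)
  define \<theta> where "\<theta> = min 1 (\<epsilon> / (N + 1))"
  have \<theta>: "0 < \<theta>" "\<theta> \<le> 1" using assms(3) N by (auto simp: \<theta>_def)
  have "\<theta> * N \<le> \<epsilon> / (N + 1) * (N + 1)"
    using N assms(3) by (intro mult_mono) (auto simp: \<theta>_def)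
  then have \<theta>N: "\<theta> * N \<le> \<epsilon>" using N by simp
  have c0: "c mzero = 0" using pcoef_center[OF c(1)] assms(2) by simp
  have c': "pcoef a (\<theta> * \<rho>) c f"
    using c(1) \<theta> \<rho> by (intro pcoef_shrink[OF c(1)]) (auto simp: mult_left_le_one_le)
  have "infsum (\<lambda>\<alpha>. \<bar>c \<alpha>\<bar> * (\<theta> * \<rho>) ^ mdeg \<alpha>) multi_indices \<le> infsum (\<lambda>\<alpha>. \<theta> * (\<bar>c \<alpha>\<bar> * \<rho> ^ mdeg \<alpha>)) multi_indices"
  proof (rule infsum_mono)
    show "(\<lambda>\<alpha>. \<bar>c \<alpha>\<bar> * (\<theta> * \<rho>) ^ mdeg \<alpha>) summable_on multi_indices" using c' by (auto simp: pcoef_def)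
    show "(\<lambda>\<alpha>. \<theta> * (\<bar>c \<alpha>\<bar> * \<rho> ^ mdeg \<alpha>)) summable_on multi_indices"
      using c(1) by (auto simp: pcoef_def intro!: summable_on_cmult_right)
    fix \<alpha> :: "'a \<Rightarrow> nat" assume \<alpha>: "\<alpha> \<in> multi_indices"
    show "\<bar>c \<alpha>\<bar> * (\<theta> * \<rho>) ^ mdeg \<alpha> \<le> \<theta> * (\<bar>c \<alpha>\<bar> * \<rho> ^ mdeg \<alpha>)"
    proof (cases "\<alpha> = mzero")
      case True then show ?thesis by (simp add: c0)
    next
      case False
      then have "\<theta> ^ mdeg \<alpha> \<le> \<theta> ^ 1"
        using \<theta> mdeg_eq_0[OF \<alpha>] by (intro power_decreasing) auto
      then have "(\<bar>c \<alpha>\<bar> * \<rho> ^ mdeg \<alpha>) * \<theta> ^ mdeg \<alpha> \<le> (\<bar>c \<alpha>\<bar> * \<rho> ^ mdeg \<alpha>) * \<theta>"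
        using \<rho> by (intro mult_left_mono) auto
      then show ?thesis by (simp add: power_mult_distrib mult_ac)
    qed
  qed
  also have "\<dots> = \<theta> * infsum (\<lambda>\<alpha>. \<bar>c \<alpha>\<bar> * \<rho> ^ mdeg \<alpha>) multi_indices"
    using c(1) by (intro infsum_cmult_right) (auto simp: pcoef_def)
  also have "\<dots> \<le> \<epsilon>"
    using mult_left_mono[OF c(2), of \<theta>] \<theta> \<theta>N by linarith
  finally have "pser a (\<theta> * \<rho>) \<epsilon> f" using c' by (auto simp: pser_def)
  then show ?thesis
    using that[of "\<theta> * \<rho>"] \<theta> \<rho> pser_shrink by fastforce
qed

text \<open>Each component of \<open>g - g a\<close> vanishes at \<open>a\<close>, so its norm drops
  below the radius of \<open>f\<close> on a small cube; the finitely many components share one such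
  cube.\<close>

lemma real_analytic_at_compose:
  fixes g :: "'a::euclidean_space \<Rightarrow> 'b::euclidean_space"
  assumes f: "real_analytic_at f (g a)"
    and g: "\<And>e. e \<in> Basis \<Longrightarrow> real_analytic_at (\<lambda>x. g x \<bullet> e) a"
  shows "real_analytic_at (\<lambda>x. f (g x)) a"
proof -
  obtain \<rho> N where f': "pser (g a) \<rho> N f" using f by (auto simp: real_analytic_at_iff_pser)
  have "\<exists>r>0. \<forall>s. 0 < s \<longrightarrow> s \<le> r \<longrightarrow> pser a s \<rho> (\<lambda>x. (g x - g a) \<bullet> e)" if e: "e \<in> Basis" for e
  proof -
    obtain r M where "pser a r M (\<lambda>x. g x \<bullet> e)" using g[OF e] by (auto simp: real_analytic_at_iff_pser)
    then have "pser a r (M + \<bar>- (g a \<bullet> e)\<bar>) (\<lambda>x. g x \<bullet> e + - (g a \<bullet> e))"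
      by (intro pser_add pser_const) (auto simp: pser_pos)
    then have "pser a r (M + \<bar>- (g a \<bullet> e)\<bar>) (\<lambda>x. (g x - g a) \<bullet> e)"
      by (simp add: inner_diff_left)
    from pser_vanish[OF this _ pser_pos[OF f']] show ?thesis by auto
  qed
  then obtain R where R: "\<And>e. e \<in> Basis \<Longrightarrow> R e > 0"
    "\<And>e s. e \<in> Basis \<Longrightarrow> 0 < s \<Longrightarrow> s \<le> R e \<Longrightarrow> pser a s \<rho> (\<lambda>x. (g x - g a) \<bullet> e)" by metis
  define r where "r = Min (R ` Basis)"
  have "r > 0" using R(1) by (simp add: r_def)
  moreover have "r \<le> R e" if "e \<in> Basis" for e using that by (simp add: r_def)
  ultimately have "pser a r N (\<lambda>x. f (g x))"
    by (intro pser_compose[OF f'] R(2)) auto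
  then show ?thesis by (auto simp: real_analytic_at_iff_pser)
qed

section \<open>Closure properties of analytic functions\<close>

lemma real_analytic_at_const: "real_analytic_at (\<lambda>_. k) a"
  using pser_const[of 1 a k] by (auto simp: real_analytic_at_iff_pser)

lemma
  assumes "real_analytic_at f a" "real_analytic_at g a"
  shows real_analytic_at_add: "real_analytic_at (\<lambda>x. f x + g x) a"
    and real_analytic_at_mult: "real_analytic_at (\<lambda>x. f x * g x) a"
proof -
  obtain \<rho> N \<rho>' N' where *: "pser a \<rho> N f" "pser a \<rho>' N' g"
    using assms by (auto simp: real_analytic_at_iff_pser)
  then have "pser a (min \<rho> \<rho>') N f" "pser a (min \<rho> \<rho>') N' g"
    using pser_pos[OF *(1)] pser_pos[OF *(2)]
    by (auto intro: pser_shrink[OF *(1)] pser_shrink[OF *(2)])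
  then show "real_analytic_at (\<lambda>x. f x + g x) a" "real_analytic_at (\<lambda>x. f x * g x) a"
    using pser_add pser_mult unfolding real_analytic_at_iff_pser by blast+
qed

lemma real_analytic_at_minus: "real_analytic_at f a \<Longrightarrow> real_analytic_at (\<lambda>x. - f x) a"
  using real_analytic_at_mult[OF real_analytic_at_const[of "-1"]] by simp

lemma real_analytic_at_diff:
  "real_analytic_at f a \<Longrightarrow> real_analytic_at g a \<Longrightarrow> real_analytic_at (\<lambda>x. f x - g x) a"
  using real_analytic_at_add[OF _ real_analytic_at_minus] by (simp add: algebra_simps)

lemma real_analytic_at_power: "real_analytic_at f a \<Longrightarrow> real_analytic_at (\<lambda>x. f x ^ n) a"
  by (induction n) (auto intro: real_analytic_at_mult real_analytic_at_const)

lemma real_analytic_at_sum: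
  "finite I \<Longrightarrow> (\<And>i. i \<in> I \<Longrightarrow> real_analytic_at (f i) a) \<Longrightarrow> real_analytic_at (\<lambda>x. \<Sum>i\<in>I. f i x) a"
  by (induction I rule: finite_induct) (auto intro: real_analytic_at_add real_analytic_at_const)

lemma real_analytic_at_inner: "real_analytic_at (\<lambda>x. x \<bullet> b) a"
proof -
  have "real_analytic_at (\<lambda>x. \<Sum>e\<in>Basis. ((x - a) \<bullet> e + a \<bullet> e) * (b \<bullet> e)) a"
    using pser_coord[of 1 _ a]
    by (intro real_analytic_at_sum real_analytic_at_mult real_analytic_at_add real_analytic_at_const)
       (auto simp: real_analytic_at_iff_pser)
  then show ?thesis by (simp add: inner_diff_left flip: euclidean_inner)
qed

lemma real_analytic_at_linear:
  fixes f :: "'a::euclidean_space \<Rightarrow> real"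
  assumes "linear f"
  shows "real_analytic_at f a"
proof -
  have "f = (\<lambda>x. \<Sum>b\<in>Basis. (x \<bullet> b) * f b)"
  proof
    fix x
    have "f x = f (\<Sum>b\<in>Basis. (x \<bullet> b) *\<^sub>R b)" by (simp add: euclidean_representation)
    also have "\<dots> = (\<Sum>b\<in>Basis. (x \<bullet> b) * f b)" by (simp add: linear_sum[OF assms] linear_scale[OF assms])
    finally show "f x = (\<Sum>b\<in>Basis. (x \<bullet> b) * f b)" .
  qed
  moreover have "real_analytic_at (\<lambda>x. \<Sum>b\<in>Basis. (x \<bullet> b) * f b) a"
    by (intro real_analytic_at_sum real_analytic_at_mult real_analytic_at_inner real_analytic_at_const finite_Basis)
  ultimately show ?thesis by simp
qed

lemma real_analytic_at_cong:
  assumes "real_analytic_at f a" "\<forall>\<^sub>F x in nhds a. f x = g x"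
  shows "real_analytic_at g a"
proof -
  obtain \<rho> N where f: "pser a \<rho> N f" using assms(1) by (auto simp: real_analytic_at_iff_pser)
  obtain r where r: "r > 0" "\<And>x. x \<in> ball a r \<Longrightarrow> f x = g x"
    using assms(2) by (auto simp: eventually_nhds_metric dist_commute)
  obtain s where s: "s > 0" "pbox a s \<subseteq> ball a r" using pbox_subset_ball[OF r(1)] by blast
  have "pser a (min s \<rho>) N f" using s pser_pos[OF f] by (intro pser_shrink[OF f]) auto
  then have "pser a (min s \<rho>) N g"
    by (rule pser_cong) (use r s pbox_mono[of "min s \<rho>" s a] in auto)
  then show ?thesis by (auto simp: real_analytic_at_iff_pser)
qed

text \<open>Recentring is composition with a translation: around \<open>p\<close>, the coordinate
  \<open>x - a\<close> is \<open>x - p\<close> plus a constant, and each part has norm at most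
  \<open>\<rho> / 2\<close>.\<close>

lemma real_analytic_at_nearby:
  assumes "real_analytic_at f a"
  shows "\<forall>\<^sub>F x in nhds a. real_analytic_at f x"
proof -
  obtain \<rho> N where f: "pser a \<rho> N f" using assms(1) by (auto simp: real_analytic_at_iff_pser)
  have \<rho>: "\<rho> > 0" by (rule pser_pos[OF f])
  have "real_analytic_at f p" if "p \<in> ball a (\<rho> / 2)" for p
  proof -
    have "pser p (\<rho> / 2) N (\<lambda>x. f x)"
    proof (rule pser_compose[OF f])
      fix e :: 'a assume e: "e \<in> Basis"
      have "norm (p - a) < \<rho> / 2" using that by (simp add: dist_norm norm_minus_commute)
      then have "\<bar>(p - a) \<bullet> e\<bar> \<le> \<rho> / 2" using Basis_le_norm[OF e, of "p - a"] by linarith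
      moreover have "pser p (\<rho> / 2) (\<rho> / 2 + \<bar>(p - a) \<bullet> e\<bar>) (\<lambda>x. (x - p) \<bullet> e + (p - a) \<bullet> e)"
        using e \<rho> by (intro pser_add pser_const pser_coord) auto
      ultimately have "pser p (\<rho> / 2) \<rho> (\<lambda>x. (x - p) \<bullet> e + (p - a) \<bullet> e)"
        by (auto intro: pser_mono)
      then show "pser p (\<rho> / 2) \<rho> (\<lambda>x. (x - a) \<bullet> e)"
        by (simp add: inner_diff_left)
    qed
    then show ?thesis by (auto simp: real_analytic_at_iff_pser)
  qed
  then show ?thesis
    using \<rho> by (auto simp: eventually_nhds_metric dist_commute intro!: exI[of _ "\<rho> / 2"])
qed

section \<open>Power series in one variable\<close>

lemma real_analytic_at_power_series:
  fixes f :: "real \<Rightarrow> real"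
  assumes "r > 0" and s: "\<And>x. \<bar>x - a\<bar> < r \<Longrightarrow> (\<lambda>n. b n * (x - a) ^ n) sums f x"
  shows "real_analytic_at f a"
proof -
  \<comment> \<open>Convergence at distance \<open>r / 2\<close> gives absolute convergence at the
    smaller distance \<open>r / 3\<close>.\<close>
  define \<rho> where "\<rho> = r / 3"
  have "summable (\<lambda>n. b n * (r / 2) ^ n)"
    using s[of "a + r / 2"] \<open>r > 0\<close> by (auto simp: sums_iff)
  from powser_insidea[OF this, of \<rho>] have b: "summable (\<lambda>n. norm (b n * \<rho> ^ n))"
    using \<open>r > 0\<close> by (simp add: \<rho>_def)
  have \<rho>: "\<rho> > 0" using \<open>r > 0\<close> by (simp add: \<rho>_def)
  have "pser a \<rho> (\<Sum>\<^sub>\<infinity>n. \<bar>b n\<bar> * \<rho> ^ n) f"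
  proof (rule pser_infsum[where X=UNIV and N="\<lambda>n. \<bar>b n\<bar> * \<rho> ^ n" and f="\<lambda>n x. b n * ((x - a) \<bullet> 1) ^ n"])
    show "pser a \<rho> (\<bar>b i\<bar> * \<rho> ^ i) (\<lambda>x. b i * ((x - a) \<bullet> 1) ^ i)" for i
      by (intro pser_mult pser_const pser_power pser_coord \<rho>) auto
    have "(\<lambda>n. \<bar>b n\<bar> * \<rho> ^ n) summable_on UNIV"
      using b \<rho> by (intro norm_summable_imp_summable_on) (simp add: abs_mult)
    then show "((\<lambda>n. \<bar>b n\<bar> * \<rho> ^ n) has_sum (\<Sum>\<^sub>\<infinity>n. \<bar>b n\<bar> * \<rho> ^ n)) UNIV" by simp
    fix x assume "x \<in> pbox a \<rho>"
    then have x: "\<bar>x - a\<bar> \<le> \<rho>" by (simp add: pbox_def)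
    have "summable (\<lambda>n. norm (b n * (x - a) ^ n))"
      by (rule summable_comparison_test'[OF b]) (use x \<rho> in \<open>auto simp: abs_mult power_abs intro!: mult_left_mono power_mono\<close>)
    moreover have "(\<lambda>n. b n * (x - a) ^ n) sums f x" using s[of x] x \<open>r > 0\<close> by (simp add: \<rho>_def)
    ultimately show "((\<lambda>n. b n * ((x - a) \<bullet> 1) ^ n) has_sum f x) UNIV"
      by (simp add: norm_summable_imp_has_sum)
  qed (fact \<rho>)
  then show ?thesis by (auto simp: real_analytic_at_iff_pser)
qed

lemma real_analytic_at_inverse_real:
  assumes "a \<noteq> (0::real)"
  shows "real_analytic_at inverse a"
proof (rule real_analytic_at_power_series[of "\<bar>a\<bar>" _ "\<lambda>n. inverse a * (- inverse a) ^ n"])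
  fix x assume x: "\<bar>x - a\<bar> < \<bar>a\<bar>"
  then have "norm (- inverse a * (x - a)) < 1" using assms by (simp add: abs_mult field_simps)
  from sums_mult[OF geometric_sums[OF this], of "inverse a"]
  have "(\<lambda>n. inverse a * (- inverse a) ^ n * (x - a) ^ n) sums (inverse a * (1 / (1 - - inverse a * (x - a))))"
    by (simp only: power_mult_distrib mult.assoc)
  moreover have "inverse a * (1 / (1 - - inverse a * (x - a))) = inverse x"
    using assms x by (simp add: field_simps)
  ultimately show "(\<lambda>n. inverse a * (- inverse a) ^ n * (x - a) ^ n) sums inverse x" by simp
qed (use assms in auto)

lemma real_analytic_at_root_real:
  assumes "a \<noteq> 0" "odd n"
  shows "real_analytic_at (root n) a"
proof (rule real_analytic_at_power_series[of "\<bar>a\<bar>" _ "\<lambda>k. root n a * ((1 / n) gchoose k) * inverse a ^ k"])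
  have n: "n > 0" using assms(2) by (rule odd_pos)
  fix x assume x: "\<bar>x - a\<bar> < \<bar>a\<bar>"
  then have 1: "norm ((x - a) * inverse a) < 1" using assms by (simp add: abs_mult field_simps)
  have 2: "1 + (x - a) * inverse a = x / a" using assms by (simp add: field_simps)
  \<comment> \<open>Since \<open>x\<close> has the sign of \<open>a\<close>, the binomial series
    applies to \<open>x / a\<close> for negative \<open>a\<close> as well; the odd root puts the
    sign into the factor \<open>root n a\<close>.\<close>
  have "x / a > 0" using x assms by (auto simp: zero_less_divide_iff)
  then have "(x / a) powr (1 / n) = root n (x / a)" using n by (simp add: root_powr_inverse)
  then have 3: "root n a * (1 + (x - a) * inverse a) powr (1 / n) = root n x"
    using assms n by (simp add: 2 real_root_divide)
  have "(\<lambda>k. root n a * (((1 / n) gchoose k) * ((x - a) * inverse a) ^ k)) sums root n x"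
    using sums_mult[OF gen_binomial_real[of "(x - a) * inverse a" "1 / n"], of "root n a"] 1 by (simp only: 3 real_norm_def)
  then show "(\<lambda>k. root n a * ((1 / n) gchoose k) * inverse a ^ k * (x - a) ^ k) sums root n x"
    by (simp only: power_mult_distrib mult_ac)
qed (use assms in auto)

lemma real_analytic_at_compose_real:
  fixes f :: "real \<Rightarrow> real"
  assumes "real_analytic_at f (g a)" "real_analytic_at g a"
  shows "real_analytic_at (\<lambda>x. f (g x)) a"
  using real_analytic_at_compose[of f g a] assms by simp

lemma real_analytic_at_divide:
  assumes "real_analytic_at f a" "real_analytic_at g a" "g a \<noteq> 0"
  shows "real_analytic_at (\<lambda>x. f x / g x) a"
  using real_analytic_at_mult[OF assms(1) real_analytic_at_compose_real[OF real_analytic_at_inverse_real assms(2)]]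
    assms(3) by (simp add: divide_inverse)

text \<open>The terms of degree at most 1 give the value and the linear part. Every other monomial
  is at most the square of \<open>norm w / \<rho>\<close> times its bound on the cube, so the
  remainder is quadratic.\<close>

lemma real_analytic_at_differentiable:
  assumes "real_analytic_at f a"
  obtains D where "(f has_derivative D) (at a)"
proof -
  obtain \<rho> c where c: "pcoef a \<rho> c f" using assms(1) by (auto simp: real_analytic_at_iff_pser pser_def)
  have \<rho>: "\<rho> > 0" using c by (simp add: pcoef_def)
  let ?M = "multi_indices :: ('a \<Rightarrow> nat) set"
  define K where "K = infsum (\<lambda>\<alpha>. \<bar>c \<alpha>\<bar> * \<rho> ^ mdeg \<alpha>) ?M"
  have K: "((\<lambda>\<alpha>. \<bar>c \<alpha>\<bar> * \<rho> ^ mdeg \<alpha>) has_sum K) ?M" using c by (simp add: pcoef_def K_def)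
  define D where "D w = (\<Sum>b\<in>Basis. c (munit b) * (w \<bullet> b))" for w
  define E where "E = insert mzero (munit ` Basis :: ('a \<Rightarrow> nat) set)"
  have inj: "inj_on munit (Basis :: 'a set)"
  proof (rule inj_onI)
    fix b b' :: 'a assume "b \<in> Basis" and eq: "munit b = munit b'"
    have "munit b' b = munit b b" by (simp only: eq)
    also have "\<dots> = 1" using \<open>b \<in> Basis\<close> by (simp add: munit_def)
    finally show "b = b'" using \<open>b \<in> Basis\<close> by (simp add: munit_def split: if_splits)
  qed
  have z: "mzero \<notin> (munit ` Basis :: ('a \<Rightarrow> nat) set)"
  proof
    assume "mzero \<in> (munit ` Basis :: ('a \<Rightarrow> nat) set)"
    then obtain b where "b \<in> Basis" "(mzero :: 'a \<Rightarrow> nat) = munit b" by auto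
    then show False using munit(2)[of b] mzero(2) by simp
  qed
  have E: "finite E" "E \<subseteq> ?M" by (simp_all add: E_def image_subset_iff)
  have bound: "\<bar>f (a + w) - f a - D w\<bar> \<le> (K / \<rho>\<^sup>2) * (norm w)\<^sup>2" if w: "norm w < \<rho>" for w
  proof -
    have wb: "\<bar>w \<bullet> b\<bar> \<le> norm w" if "b \<in> Basis" for b using that by (rule Basis_le_norm)
    have "a + w \<in> pbox a \<rho>" using w ball_subset_pbox[of a \<rho>] by (auto simp: dist_norm)
    then have 1: "((\<lambda>\<alpha>. c \<alpha> * mmono w \<alpha>) has_sum f (a + w)) ?M"
      using c by (force simp: pcoef_def)
    have "(\<Sum>\<alpha>\<in>E. c \<alpha> * mmono w \<alpha>) = c mzero + D w"
      unfolding E_def D_def by (subst sum.insert) (auto simp: z sum.reindex[OF inj])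
    then have 2: "((\<lambda>\<alpha>. if \<alpha> \<in> E then c \<alpha> * mmono w \<alpha> else 0) has_sum f a + D w) ?M"
      using E by (intro has_sum_finite_neutralI[of E]) (auto simp: pcoef_center[OF c])
    have 3: "((\<lambda>\<alpha>. c \<alpha> * mmono w \<alpha> + - (if \<alpha> \<in> E then c \<alpha> * mmono w \<alpha> else 0)) has_sum f (a + w) + - (f a + D w)) ?M"
      by (intro has_sum_add 1 has_sum_uminusI 2)
    have "norm (f (a + w) + - (f a + D w)) \<le> (norm w)\<^sup>2 / \<rho>\<^sup>2 * K"
    proof (rule norm_infsum_le[OF 3 has_sum_cmult_right[OF K]])
      fix \<alpha> :: "'a \<Rightarrow> nat" assume \<alpha>: "\<alpha> \<in> ?M"
      show "norm (c \<alpha> * mmono w \<alpha> + - (if \<alpha> \<in> E then c \<alpha> * mmono w \<alpha> else 0))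
          \<le> (norm w)\<^sup>2 / \<rho>\<^sup>2 * (\<bar>c \<alpha>\<bar> * \<rho> ^ mdeg \<alpha>)"
      proof (cases "\<alpha> \<in> E")
        case True then show ?thesis using \<rho> by simp
      next
        case False
        then have "mdeg \<alpha> \<noteq> 0" "mdeg \<alpha> \<noteq> 1"
          using mdeg_eq_0[OF \<alpha>] mdeg_eq_1[OF \<alpha>] by (auto simp: E_def)
        then obtain k where k: "mdeg \<alpha> = 2 + k" by (metis One_nat_def Suc_1 add_Suc not0_implies_Suc plus_1_eq_Suc)
        have "\<bar>mmono w \<alpha>\<bar> \<le> norm w ^ mdeg \<alpha>" by (rule mmono_bound[OF wb])
        also have "\<dots> = (norm w)\<^sup>2 * norm w ^ k" by (simp only: k power_add)
        also have "\<dots> \<le> (norm w)\<^sup>2 * \<rho> ^ k" using w by (intro mult_left_mono power_mono) auto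
        also have "\<dots> = (norm w)\<^sup>2 / \<rho>\<^sup>2 * \<rho> ^ mdeg \<alpha>" using \<rho> by (simp add: k power_add power2_eq_square)
        finally have "\<bar>c \<alpha>\<bar> * \<bar>mmono w \<alpha>\<bar> \<le> \<bar>c \<alpha>\<bar> * ((norm w)\<^sup>2 / \<rho>\<^sup>2 * \<rho> ^ mdeg \<alpha>)"
          by (rule mult_left_mono) auto
        then show ?thesis using False by (simp add: abs_mult mult_ac)
      qed
    qed
    then show ?thesis by (simp add: algebra_simps)
  qed
  have bl: "bounded_linear D"
    unfolding D_def by (intro bounded_linear_sum bounded_linear_const_mult bounded_linear_inner_left)
  have "((\<lambda>w. norm (f (a + w) - f a - D w) / norm w) \<longlongrightarrow> 0) (at 0)"
  proof (rule Lim_null_comparison)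
    show "((\<lambda>w. K / \<rho>\<^sup>2 * norm w) \<longlongrightarrow> 0) (at 0)"
      by (intro tendsto_mult_right_zero tendsto_norm_zero tendsto_ident_at)
    have "\<forall>\<^sub>F w in at (0::'a). norm w < \<rho>"
      using \<rho> by (auto simp: eventually_at intro!: exI[of _ \<rho>])
    then show "\<forall>\<^sub>F w in at 0. norm (norm (f (a + w) - f a - D w) / norm w) \<le> K / \<rho>\<^sup>2 * norm w"
    proof (rule eventually_mono)
      fix w :: 'a assume "norm w < \<rho>"
      from bound[OF this] show "norm (norm (f (a + w) - f a - D w) / norm w) \<le> K / \<rho>\<^sup>2 * norm w"
        by (cases "w = 0") (auto simp: divide_le_eq power2_eq_square mult_ac)
    qed
  qed
  then have "(f has_derivative D) (at a)" using bl by (simp add: has_derivative_at)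
  then show ?thesis using that by blast
qed

section \<open>Partial derivatives of analytic functions\<close>


text \<open>The coefficients of the formal derivative in direction \<open>b\<close>.\<close>

definition dcoef :: "'a \<Rightarrow> (('a \<Rightarrow> nat) \<Rightarrow> real) \<Rightarrow> ('a \<Rightarrow> nat) \<Rightarrow> real" where
  "dcoef b c \<alpha> = real (\<alpha> b + 1) * c (\<alpha>(b := \<alpha> b + 1))"

text \<open>The factor \<open>t\<^sup>2\<close> makes the termwise remainder quadratic, and the
  growth in \<open>n\<close> is only that of its square, which a slightly larger radius absorbs. For
  \<open>n = 0\<close> the truncated exponent \<open>n - 1\<close> is multiplied by 0.\<close>

lemma power_second_order_bound:
  fixes s t R :: real
  assumes "\<bar>s\<bar> \<le> R" "\<bar>s + t\<bar> \<le> R" "R > 0"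
  shows "\<bar>(s + t) ^ n - s ^ n - t * (real n * s ^ (n - 1))\<bar> \<le> t\<^sup>2 * ((real n)\<^sup>2 * R ^ n / R\<^sup>2)"
proof (induction n)
  case (Suc n)
  have e: "(s + t) ^ Suc n - s ^ Suc n - t * (real (Suc n) * s ^ n)
      = (s + t) * ((s + t) ^ n - s ^ n - t * (real n * s ^ (n - 1))) + t\<^sup>2 * (real n * s ^ (n - 1))"
  proof (cases n)
    case (Suc m) then show ?thesis by (simp add: algebra_simps power2_eq_square)
  qed simp
  have 1: "\<bar>(s + t) * ((s + t) ^ n - s ^ n - t * (real n * s ^ (n - 1)))\<bar> \<le> R * (t\<^sup>2 * ((real n)\<^sup>2 * R ^ n / R\<^sup>2))"
    unfolding abs_mult using Suc assms by (intro mult_mono) auto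
  have "\<bar>s\<bar> ^ (n - 1) \<le> R ^ (n - 1)" using assms by (intro power_mono) auto
  then have "real n * \<bar>s\<bar> ^ (n - 1) \<le> real n * R ^ (n - 1)" by (rule mult_left_mono) auto
  also have "\<dots> = real n * (R ^ Suc n / R\<^sup>2)" using assms(3) by (cases n) (auto simp: power2_eq_square)
  finally have "t\<^sup>2 * (real n * \<bar>s\<bar> ^ (n - 1)) \<le> t\<^sup>2 * (real n * (R ^ Suc n / R\<^sup>2))"
    by (rule mult_left_mono) simp
  then have 2: "\<bar>t\<^sup>2 * (real n * s ^ (n - 1))\<bar> \<le> t\<^sup>2 * (real n * (R ^ Suc n / R\<^sup>2))"
    by (simp only: abs_mult power_abs abs_of_nat power2_abs)
  have "\<bar>(s + t) ^ Suc n - s ^ Suc n - t * (real (Suc n) * s ^ n)\<bar>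
      \<le> R * (t\<^sup>2 * ((real n)\<^sup>2 * R ^ n / R\<^sup>2)) + t\<^sup>2 * (real n * (R ^ Suc n / R\<^sup>2))"
    unfolding e using 1 2 by linarith
  also have "\<dots> = t\<^sup>2 * (R ^ Suc n / R\<^sup>2) * ((real n)\<^sup>2 + real n)"
    using assms(3) by (simp add: field_simps)
  also have "\<dots> \<le> t\<^sup>2 * (R ^ Suc n / R\<^sup>2) * (real (Suc n))\<^sup>2"
  proof (rule mult_left_mono)
    show "(real n)\<^sup>2 + real n \<le> (real (Suc n))\<^sup>2" by (simp add: power2_eq_square algebra_simps)
    show "0 \<le> t\<^sup>2 * (R ^ Suc n / R\<^sup>2)" using assms(3) by simp
  qed
  finally show ?case by (simp add: mult_ac)
qed simp

text \<open>Splitting \<open>q\<close> into two factors \<open>sqrt q\<close> reduces the claim to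
  \<open>n * sqrt q ^ n\<close> tending to 0.\<close>

lemma square_times_power_bounded:
  fixes q :: real
  assumes "0 < q" "q < 1"
  obtains K where "\<And>n. (real n)\<^sup>2 * q ^ n \<le> K"
proof -
  have "(\<lambda>n. real n * sqrt q ^ n) \<longlonglongrightarrow> 0"
    using assms by (intro powser_times_n_limit_0) auto
  then have "Bseq (\<lambda>n. real n * sqrt q ^ n)" using convergentI convergent_imp_Bseq by blast
  then obtain B where B: "\<And>n. norm (real n * sqrt q ^ n) \<le> B" by (auto simp: Bseq_def)
  have "(real n)\<^sup>2 * q ^ n \<le> B\<^sup>2" for n
  proof -
    have "(sqrt q ^ n)\<^sup>2 = q ^ n"
      using assms by (metis less_imp_le mult.commute power_mult real_sqrt_pow2)
    then have "(real n)\<^sup>2 * q ^ n = \<bar>real n * sqrt q ^ n\<bar>\<^sup>2" by (simp add: power_mult_distrib)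
    also have "\<dots> \<le> B\<^sup>2" using B[of n] by (intro power_mono) auto
    finally show ?thesis .
  qed
  then show ?thesis using that by blast
qed

lemma DERIV_from_quadratic_bound:
  fixes f :: "real \<Rightarrow> real"
  assumes "\<delta> > 0" "\<And>t. \<bar>t\<bar> < \<delta> \<Longrightarrow> \<bar>f t - f 0 - t * D\<bar> \<le> t\<^sup>2 * C"
  shows "(f has_real_derivative D) (at 0)"
proof -
  have "((\<lambda>t. (f t - f 0) / t - D) \<longlongrightarrow> 0) (at 0)"
  proof (rule Lim_null_comparison)
    show "((\<lambda>t. \<bar>t\<bar> * C) \<longlongrightarrow> 0) (at 0)"
      by (intro tendsto_mult_left_zero tendsto_rabs_zero tendsto_ident_at)
    have "norm ((f t - f 0) / t - D) \<le> \<bar>t\<bar> * C" if "t \<noteq> 0" "\<bar>t\<bar> < \<delta>" for t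
    proof -
      have "(f t - f 0) / t - D = (f t - f 0 - t * D) / t" using that by (simp add: field_simps)
      then have "norm ((f t - f 0) / t - D) = \<bar>f t - f 0 - t * D\<bar> / \<bar>t\<bar>" by simp
      also have "\<dots> \<le> (t\<^sup>2 * C) / \<bar>t\<bar>" using assms(2)[OF that(2)] by (rule divide_right_mono) auto
      also have "t\<^sup>2 * C = \<bar>t\<bar> * (\<bar>t\<bar> * C)" by (simp add: power2_eq_square flip: mult.assoc)
      also have "\<dots> / \<bar>t\<bar> = \<bar>t\<bar> * C" using that by simp
      finally show ?thesis .
    qed
    then show "\<forall>\<^sub>F t in at 0. norm ((f t - f 0) / t - D) \<le> \<bar>t\<bar> * C"
      using assms(1) by (auto simp: eventually_at intro!: exI[of _ \<delta>])
  qed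
  then show ?thesis by (simp add: DERIV_def LIM_zero_iff)
qed

lemma mmono_split:
  assumes "b \<in> Basis"
  shows "mmono v \<alpha> = (v \<bullet> b) ^ \<alpha> b * (\<Prod>b'\<in>Basis - {b}. (v \<bullet> b') ^ \<alpha> b')"
  unfolding mmono_def using assms by (subst prod.remove[of _ b]) auto

lemma mdeg_split:
  assumes "b \<in> Basis"
  shows "mdeg \<alpha> = \<alpha> b + (\<Sum>b'\<in>Basis - {b}. \<alpha> b')"
  unfolding mdeg_def using assms by (subst sum.remove[of _ b]) auto

lemma bij_betw_raise:
  fixes b :: "'a::euclidean_space"
  assumes "b \<in> Basis"
  shows "bij_betw (\<lambda>\<alpha>. \<alpha>(b := \<alpha> b + 1)) multi_indices {\<alpha> \<in> multi_indices. \<alpha> b \<noteq> 0}"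
proof (rule bij_betw_byWitness[where f'="\<lambda>\<alpha>. \<alpha>(b := \<alpha> b - 1)"])
  show "(\<lambda>\<alpha>. \<alpha>(b := \<alpha> b + 1)) ` multi_indices \<subseteq> {\<alpha> \<in> multi_indices. \<alpha> b \<noteq> 0}"
    using assms by (auto simp: PiE_iff extensional_def)
  show "(\<lambda>\<alpha>. \<alpha>(b := \<alpha> b - 1)) ` {\<alpha> \<in> multi_indices. \<alpha> b \<noteq> 0} \<subseteq> multi_indices"
    using assms by (auto simp: PiE_iff extensional_def)
qed auto

text \<open>Termwise differentiation with a uniform quadratic remainder. The passage from
  \<open>\<rho>\<close> to \<open>\<rho>'\<close> pays for the factor
  \<open>(\<alpha> b)\<^sup>2\<close> in the remainder of a single monomial.\<close>

lemma pcoef_deriv: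
  fixes a b :: "'a::euclidean_space"
  assumes c: "pcoef a \<rho> c f" and b: "b \<in> Basis" and \<rho>': "0 < \<rho>'" "\<rho>' < \<rho>"
  shows "\<exists>f'. pcoef a \<rho>' (dcoef b c) f' \<and>
    (\<forall>x. (\<forall>b'\<in>Basis. \<bar>(x - a) \<bullet> b'\<bar> < \<rho>') \<longrightarrow> ((\<lambda>t. f (x + t *\<^sub>R b)) has_real_derivative f' x) (at 0))"
proof -
  let ?M = "multi_indices :: ('a \<Rightarrow> nat) set"
  let ?M1 = "{\<alpha> \<in> ?M. \<alpha> b \<noteq> 0}"
  obtain K where K: "\<And>n. (real n)\<^sup>2 * (\<rho>' / \<rho>) ^ n \<le> K"
    using square_times_power_bounded[of "\<rho>' / \<rho>"] \<rho>' by auto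
  have K0: "K \<ge> 0" using K[of 0] by simp
  have K': "(real n)\<^sup>2 * \<rho>' ^ n \<le> K * \<rho> ^ n" for n
    using K[of n] \<rho>' by (simp add: power_divide field_simps)
  have Kd: "(real (\<alpha> b))\<^sup>2 * \<rho>' ^ mdeg \<alpha> \<le> K * \<rho> ^ mdeg \<alpha>" for \<alpha>
  proof -
    have "(real (\<alpha> b))\<^sup>2 * \<rho>' ^ mdeg \<alpha> \<le> (real (mdeg \<alpha>))\<^sup>2 * \<rho>' ^ mdeg \<alpha>"
      using mdeg_split[OF b, of \<alpha>] \<rho>' by (intro mult_right_mono power_mono of_nat_mono) auto
    then show ?thesis using K'[of "mdeg \<alpha>"] by linarith
  qed
  define N where "N = infsum (\<lambda>\<alpha>. \<bar>c \<alpha>\<bar> * \<rho> ^ mdeg \<alpha>) ?M"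
  have N: "((\<lambda>\<alpha>. \<bar>c \<alpha>\<bar> * \<rho> ^ mdeg \<alpha>) has_sum N) ?M" using c by (simp add: pcoef_def N_def)
  define g where "g \<alpha> = real (\<alpha> b) * c \<alpha>" for \<alpha>
  define dn where "dn \<alpha> = \<alpha>(b := \<alpha> b - 1)" for \<alpha> :: "'a \<Rightarrow> nat"
  have md: "mdeg \<alpha> = Suc (mdeg (dn \<alpha>))" if "\<alpha> b \<noteq> 0" for \<alpha>
    using that by (simp add: mdeg_split[OF b] dn_def)
  \<comment> \<open>Raising the exponent of \<open>b\<close> by one turns sums over the
    differentiated coefficients into sums over indices with \<open>\<alpha> b \<noteq> 0\<close>.
    The remaining indices contribute 0, so such sums can be subtracted termwise from the series of
    \<open>f\<close>.\<close>
  have reidx: "((\<lambda>\<alpha>. h (dcoef b c \<alpha>) \<alpha>) has_sum S) ?M \<longleftrightarrow> ((\<lambda>\<alpha>. h (g \<alpha>) (dn \<alpha>)) has_sum S) ?M1"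
    for h and S :: real
    unfolding has_sum_reindex_bij_betw[OF bij_betw_raise[OF b], symmetric, of "\<lambda>\<alpha>. h (g \<alpha>) (dn \<alpha>)"]
    by (simp add: g_def dn_def dcoef_def)
  have ext1: "((\<lambda>\<alpha>. g \<alpha> * u \<alpha>) has_sum S) ?M1 \<longleftrightarrow> ((\<lambda>\<alpha>. g \<alpha> * u \<alpha>) has_sum S) ?M" for u S
    by (rule has_sum_cong_neutral) (auto simp: g_def)
  have "(\<lambda>\<alpha>. \<bar>g \<alpha>\<bar> * \<rho>' ^ mdeg (dn \<alpha>)) summable_on ?M1"
  proof (rule summable_on_comparison_test)
    show "(\<lambda>\<alpha>. K / \<rho>' * (\<bar>c \<alpha>\<bar> * \<rho> ^ mdeg \<alpha>)) summable_on ?M1"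
      by (rule summable_on_subset[OF summable_on_cmult_right[OF has_sum_imp_summable[OF N]]]) auto
    fix \<alpha> assume \<alpha>: "\<alpha> \<in> ?M1"
    have "real (\<alpha> b) * \<rho>' ^ mdeg \<alpha> \<le> (real (\<alpha> b))\<^sup>2 * \<rho>' ^ mdeg \<alpha>"
      using \<alpha> \<rho>' by (intro mult_right_mono) (auto simp: power2_eq_square)
    then have "real (\<alpha> b) * \<rho>' ^ mdeg \<alpha> \<le> K * \<rho> ^ mdeg \<alpha>" using Kd[of \<alpha>] by linarith
    then have "\<bar>c \<alpha>\<bar> * (real (\<alpha> b) * \<rho>' ^ mdeg \<alpha>) \<le> \<bar>c \<alpha>\<bar> * (K * \<rho> ^ mdeg \<alpha>)" by (rule mult_left_mono) auto
    then show "\<bar>g \<alpha>\<bar> * \<rho>' ^ mdeg (dn \<alpha>) \<le> K / \<rho>' * (\<bar>c \<alpha>\<bar> * \<rho> ^ mdeg \<alpha>)"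
      using \<alpha> \<rho>' by (simp add: md g_def abs_mult field_simps)
  qed (use \<rho>' in auto)
  then have "((\<lambda>\<alpha>. \<bar>g \<alpha>\<bar> * \<rho>' ^ mdeg (dn \<alpha>)) has_sum infsum (\<lambda>\<alpha>. \<bar>g \<alpha>\<bar> * \<rho>' ^ mdeg (dn \<alpha>)) ?M1) ?M1" by simp
  then have sum': "(\<lambda>\<alpha>. \<bar>dcoef b c \<alpha>\<bar> * \<rho>' ^ mdeg \<alpha>) summable_on ?M"
    unfolding reidx[of "\<lambda>k \<alpha>. \<bar>k\<bar> * \<rho>' ^ mdeg \<alpha>", symmetric] by (rule has_sum_imp_summable)
  define f' where "f' x = infsum (\<lambda>\<alpha>. dcoef b c \<alpha> * mmono (x - a) \<alpha>) ?M" for x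
  have f': "((\<lambda>\<alpha>. dcoef b c \<alpha> * mmono (x - a) \<alpha>) has_sum f' x) ?M" if "x \<in> pbox a \<rho>'" for x
  proof -
    have "(\<lambda>\<alpha>. norm (dcoef b c \<alpha> * mmono (x - a) \<alpha>)) summable_on ?M"
      by (rule Infinite_Sum.abs_summable_on_comparison_test'[OF sum'])
         (use that mmono_bound[of "x - a" \<rho>'] in \<open>auto simp: abs_mult pbox_def intro!: mult_left_mono\<close>)
    then show ?thesis unfolding f'_def by (rule has_sum_infsum[OF abs_summable_summable])
  qed
  then have pc: "pcoef a \<rho>' (dcoef b c) f'" using sum' \<rho>' by (auto simp: pcoef_def)
  have "((\<lambda>t. f (x + t *\<^sub>R b)) has_real_derivative f' x) (at 0)"
    if x: "\<forall>b'\<in>Basis. \<bar>(x - a) \<bullet> b'\<bar> < \<rho>'" for x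
  proof (rule DERIV_from_quadratic_bound)
    define v where "v = x - a"
    show "\<rho>' - \<bar>v \<bullet> b\<bar> > 0" using x b by (simp add: v_def)
    fix t assume t: "\<bar>t\<bar> < \<rho>' - \<bar>v \<bullet> b\<bar>"
    have vt: "\<bar>v \<bullet> b\<bar> \<le> \<rho>'" "\<bar>v \<bullet> b + t\<bar> \<le> \<rho>'" using t by linarith+
    have xt: "x + t *\<^sub>R b \<in> pbox a \<rho>'"
      unfolding pbox_def
    proof (intro CollectI ballI)
      fix b' :: 'a assume b': "b' \<in> Basis"
      show "\<bar>(x + t *\<^sub>R b - a) \<bullet> b'\<bar> \<le> \<rho>'"
        using vt x b' b by (cases "b' = b") (auto simp: v_def inner_simps inner_Basis intro: less_imp_le)
    qed
    have xb: "x \<in> pbox a \<rho>'" using x by (auto simp: pbox_def intro: less_imp_le)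
    have sub: "pbox a \<rho>' \<subseteq> pbox a \<rho>" using \<rho>' by (intro pbox_mono) auto
    have 1: "((\<lambda>\<alpha>. c \<alpha> * mmono (v + t *\<^sub>R b) \<alpha>) has_sum f (x + t *\<^sub>R b)) ?M"
      using c xt sub unfolding pcoef_def v_def by (auto simp: algebra_simps)
    have 2: "((\<lambda>\<alpha>. c \<alpha> * mmono v \<alpha>) has_sum f x) ?M"
      using c xb sub unfolding pcoef_def v_def by auto
    have "((\<lambda>\<alpha>. g \<alpha> * mmono v (dn \<alpha>)) has_sum f' x) ?M1"
      using iffD1[OF reidx[of "\<lambda>k \<alpha>. k * mmono v \<alpha>"]] f'[OF xb] by (simp only: v_def)
    then have 3: "((\<lambda>\<alpha>. g \<alpha> * mmono v (dn \<alpha>)) has_sum f' x) ?M" by (simp only: ext1)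
    have 4: "((\<lambda>\<alpha>. (c \<alpha> * mmono (v + t *\<^sub>R b) \<alpha> + - (c \<alpha> * mmono v \<alpha>)) + - (t * (g \<alpha> * mmono v (dn \<alpha>))))
        has_sum (f (x + t *\<^sub>R b) + - f x) + - (t * f' x)) ?M"
      by (intro has_sum_add has_sum_uminusI has_sum_cmult_right 1 2 3)
    have "norm ((f (x + t *\<^sub>R b) + - f x) + - (t * f' x)) \<le> (t\<^sup>2 * K / \<rho>'\<^sup>2) * N"
    proof (rule norm_infsum_le[OF 4 has_sum_cmult_right[OF N]])
      fix \<alpha> assume \<alpha>: "\<alpha> \<in> ?M"
      define P where "P = (\<Prod>b'\<in>Basis - {b}. (v \<bullet> b') ^ \<alpha> b')"
      define n where "n = \<alpha> b"
      have "\<bar>P\<bar> = (\<Prod>b'\<in>Basis - {b}. \<bar>v \<bullet> b'\<bar> ^ \<alpha> b')" by (simp add: P_def abs_prod power_abs)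
      also have "\<dots> \<le> (\<Prod>b'\<in>Basis - {b}. \<rho>' ^ \<alpha> b')"
      proof (rule prod_mono)
        fix b' assume "b' \<in> Basis - {b}"
        then have "\<bar>v \<bullet> b'\<bar> \<le> \<rho>'" using x by (auto simp: v_def intro: less_imp_le)
        then show "0 \<le> \<bar>v \<bullet> b'\<bar> ^ \<alpha> b' \<and> \<bar>v \<bullet> b'\<bar> ^ \<alpha> b' \<le> \<rho>' ^ \<alpha> b'" by (simp add: power_mono)
      qed
      finally have P: "\<bar>P\<bar> \<le> \<rho>' ^ (\<Sum>b'\<in>Basis - {b}. \<alpha> b')" by (simp add: power_sum)
      have m1: "mmono (v + t *\<^sub>R b) \<alpha> = (v \<bullet> b + t) ^ n * P"
      proof -
        have "(\<Prod>b'\<in>Basis - {b}. ((v + t *\<^sub>R b) \<bullet> b') ^ \<alpha> b') = P"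
          unfolding P_def using b by (intro prod.cong) (auto simp: inner_simps inner_Basis)
        then show ?thesis using b by (simp add: mmono_split[OF b] n_def inner_simps)
      qed
      have m2: "mmono v \<alpha> = (v \<bullet> b) ^ n * P" by (simp add: mmono_split[OF b] n_def P_def)
      have m3: "mmono v (dn \<alpha>) = (v \<bullet> b) ^ (n - 1) * P"
        by (simp add: mmono_split[OF b] n_def P_def dn_def)
      have "(c \<alpha> * mmono (v + t *\<^sub>R b) \<alpha> + - (c \<alpha> * mmono v \<alpha>)) + - (t * (g \<alpha> * mmono v (dn \<alpha>)))
          = c \<alpha> * (((v \<bullet> b + t) ^ n - (v \<bullet> b) ^ n - t * (real n * (v \<bullet> b) ^ (n - 1))) * P)"
        by (simp add: m1 m2 m3 g_def n_def algebra_simps)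
      also have "norm \<dots> = \<bar>c \<alpha>\<bar> * (\<bar>(v \<bullet> b + t) ^ n - (v \<bullet> b) ^ n - t * (real n * (v \<bullet> b) ^ (n - 1))\<bar> * \<bar>P\<bar>)"
        by (simp add: abs_mult)
      also have "\<dots> \<le> \<bar>c \<alpha>\<bar> * ((t\<^sup>2 * ((real n)\<^sup>2 * \<rho>' ^ n / \<rho>'\<^sup>2)) * \<rho>' ^ (\<Sum>b'\<in>Basis - {b}. \<alpha> b'))"
        using power_second_order_bound[OF vt \<rho>'(1), of n] P \<rho>' by (intro mult_left_mono mult_mono) auto
      also have "\<dots> = \<bar>c \<alpha>\<bar> * (t\<^sup>2 / \<rho>'\<^sup>2 * ((real (\<alpha> b))\<^sup>2 * \<rho>' ^ mdeg \<alpha>))"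
        by (simp add: mdeg_split[OF b] n_def power_add)
      also have "\<dots> \<le> \<bar>c \<alpha>\<bar> * (t\<^sup>2 / \<rho>'\<^sup>2 * (K * \<rho> ^ mdeg \<alpha>))"
        using Kd[of \<alpha>] by (intro mult_left_mono) auto
      finally show "norm ((c \<alpha> * mmono (v + t *\<^sub>R b) \<alpha> + - (c \<alpha> * mmono v \<alpha>)) + - (t * (g \<alpha> * mmono v (dn \<alpha>))))
          \<le> (t\<^sup>2 * K / \<rho>'\<^sup>2) * (\<bar>c \<alpha>\<bar> * \<rho> ^ mdeg \<alpha>)" by (simp add: mult_ac)
    qed
    then show "\<bar>f (x + t *\<^sub>R b) - f (x + 0 *\<^sub>R b) - t * f' x\<bar> \<le> t\<^sup>2 * (K / \<rho>'\<^sup>2 * N)"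
      by (simp add: algebra_simps)
  qed
  then show ?thesis using pc by blast
qed

text \<open>Total differentiability, since the chain rule for pullbacks along maps of the plane
  fails for mere partial derivatives.\<close>

definition has_grad :: "(real \<times> real \<Rightarrow> real) \<Rightarrow> real \<Rightarrow> real \<Rightarrow> real \<times> real \<Rightarrow> bool" where
  "has_grad f fx fy z \<longleftrightarrow> (f has_derivative (\<lambda>v. fx * fst v + fy * snd v)) (at z)"

lemma has_gradD:
  assumes "has_grad f fx fy z"
  shows "partial_x f z = fx" "partial_y f z = fy"
proof -
  obtain x y where z: "z = (x, y)" by (cases z)
  have f: "(f has_derivative (\<lambda>v. fx * fst v + fy * snd v)) (at (x, y))"
    using assms by (simp add: has_grad_def z)
  have "((\<lambda>t. f (t, y)) has_derivative (\<lambda>h. fx * fst (h, 0::real) + fy * snd (h, 0::real))) (at x)"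
    by (rule has_derivative_compose[where g=f and f="\<lambda>t. (t, y)", OF _ f])
       (auto intro!: derivative_eq_intros)
  then have "((\<lambda>t. f (t, y)) has_real_derivative fx) (at x)"
    by (simp add: has_field_derivative_def mult.commute[of fx] mult_commute_abs)
  then show "partial_x f z = fx" by (simp add: partial_x_def z DERIV_imp_deriv)
  have "((\<lambda>t. f (x, t)) has_derivative (\<lambda>h. fx * fst (0::real, h) + fy * snd (0::real, h))) (at y)"
    by (rule has_derivative_compose[where g=f and f="\<lambda>t. (x, t)", OF _ f])
       (auto intro!: derivative_eq_intros)
  then have "((\<lambda>t. f (x, t)) has_real_derivative fy) (at y)"
    by (simp add: has_field_derivative_def mult_commute_abs)
  then show "partial_y f z = fy" by (simp add: partial_y_def z DERIV_imp_deriv)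
qed

lemma has_grad_unique:
  assumes "has_grad f fx fy z" "has_grad f gx gy z"
  shows "fx = gx" "fy = gy"
  using has_gradD[OF assms(1)] has_gradD[OF assms(2)] by auto

lemma has_grad_partial:
  assumes "real_analytic_at f z"
  shows "has_grad f (partial_x f z) (partial_y f z) z"
proof -
  obtain D where D: "(f has_derivative D) (at z)" using real_analytic_at_differentiable[OF assms] by blast
  then have lin: "linear D" using has_derivative_linear by blast
  have "D = (\<lambda>v. D (1, 0) * fst v + D (0, 1) * snd v)"
  proof
    fix v :: "real \<times> real"
    have "D v = D (fst v *\<^sub>R (1, 0) + snd v *\<^sub>R (0, 1))" by simp
    also have "\<dots> = fst v *\<^sub>R D (1, 0) + snd v *\<^sub>R D (0, 1)"
      by (simp only: linear_add[OF lin] linear_scale[OF lin])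
    finally show "D v = D (1, 0) * fst v + D (0, 1) * snd v" by simp
  qed
  with D have g: "has_grad f (D (1, 0)) (D (0, 1)) z" by (simp add: has_grad_def)
  then show ?thesis using has_gradD[OF g] by simp
qed

lemma has_grad_cong:
  assumes "has_grad f fx fy z" "\<forall>\<^sub>F w in nhds z. f w = g w"
  shows "has_grad g fx fy z"
proof -
  obtain S where S: "open S" "z \<in> S" "\<And>w. w \<in> S \<Longrightarrow> f w = g w"
    using assms(2) by (auto simp: eventually_nhds)
  show ?thesis using has_derivative_transform_within_open[OF _ S] assms(1) by (simp add: has_grad_def)
qed

lemma has_grad_cong_open:
  assumes "has_grad f fx fy z" "open S" "z \<in> S" "\<And>w. w \<in> S \<Longrightarrow> f w = g w"
  shows "has_grad g fx fy z"
  by (rule has_grad_cong[OF assms(1)]) (unfold eventually_nhds, use assms in blast)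

text \<open>This is how an identity between functions is differentiated: it holds on an open set,
  both sides have computable gradients, and these are equal.\<close>

lemma has_grad_agree:
  assumes "has_grad f fx fy z" "has_grad g gx gy z" "open S" "z \<in> S" "\<And>w. w \<in> S \<Longrightarrow> f w = g w"
  shows "fx = gx" "fy = gy"
  using has_grad_unique[OF has_grad_cong_open[OF assms(1,3,4,5)] assms(2)] by auto

lemma has_grad_eq: "has_grad f fx fy z \<Longrightarrow> fx = gx \<Longrightarrow> fy = gy \<Longrightarrow> has_grad f gx gy z"
  by simp

section \<open>Rules for gradients\<close>

lemma has_grad_const: "has_grad (\<lambda>_. k) 0 0 z"
  by (simp add: has_grad_def)

lemma has_grad_fst: "has_grad fst 1 0 z" and has_grad_snd: "has_grad snd 0 1 z"
  by (auto simp: has_grad_def intro!: derivative_eq_intros)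

lemma has_grad_add:
  "has_grad f fx fy z \<Longrightarrow> has_grad g gx gy z \<Longrightarrow> has_grad (\<lambda>w. f w + g w) (fx + gx) (fy + gy) z"
  unfolding has_grad_def by (drule (1) has_derivative_add) (simp add: algebra_simps)

lemma has_grad_mult:
  "has_grad f fx fy z \<Longrightarrow> has_grad g gx gy z \<Longrightarrow>
    has_grad (\<lambda>w. f w * g w) (fx * g z + f z * gx) (fy * g z + f z * gy) z"
  unfolding has_grad_def by (drule (1) has_derivative_mult) (simp add: algebra_simps)

lemma has_grad_minus: "has_grad f fx fy z \<Longrightarrow> has_grad (\<lambda>w. - f w) (- fx) (- fy) z"
  using has_grad_mult[OF has_grad_const[of "-1"]] by fastforce

lemma has_grad_diff:
  "has_grad f fx fy z \<Longrightarrow> has_grad g gx gy z \<Longrightarrow> has_grad (\<lambda>w. f w - g w) (fx - gx) (fy - gy) z"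
  using has_grad_add[OF _ has_grad_minus] by fastforce

lemma has_grad_compose_real:
  "has_grad f fx fy z \<Longrightarrow> (k has_real_derivative k') (at (f z)) \<Longrightarrow> has_grad (\<lambda>w. k (f w)) (k' * fx) (k' * fy) z"
  unfolding has_grad_def has_field_derivative_def
  by (drule (1) has_derivative_compose) (simp add: algebra_simps)

lemma has_grad_compose:
  assumes g: "has_grad g gx gy (f1 z, f2 z)" and f: "has_grad f1 a1 b1 z" "has_grad f2 a2 b2 z"
  shows "has_grad (\<lambda>w. g (f1 w, f2 w)) (gx * a1 + gy * a2) (gx * b1 + gy * b2) z"
proof -
  have "((\<lambda>w. g (f1 w, f2 w)) has_derivative
      (\<lambda>v. gx * fst (a1 * fst v + b1 * snd v, a2 * fst v + b2 * snd v)
         + gy * snd (a1 * fst v + b1 * snd v, a2 * fst v + b2 * snd v))) (at z)"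
    by (rule has_derivative_compose[where g=g and f="\<lambda>w. (f1 w, f2 w)"])
       (use assms in \<open>auto simp: has_grad_def intro!: has_derivative_Pair\<close>)
  then show ?thesis by (simp add: has_grad_def algebra_simps)
qed

lemma has_grad_continuous: "has_grad f fx fy z \<Longrightarrow> isCont f z"
  unfolding has_grad_def by (rule has_derivative_continuous)

lemma Basis_real_pair: "(Basis :: (real \<times> real) set) = {(1, 0), (0, 1)}"
  by (auto simp: Basis_prod_def)

lemma pcoef_partial:
  assumes c: "pcoef z \<rho> c f"
  shows "\<exists>r. pcoef z r (dcoef (1, 0) c) (partial_x f)" "\<exists>r. pcoef z r (dcoef (0, 1) c) (partial_y f)"
proof -
  have \<rho>: "0 < \<rho> / 2" "\<rho> / 2 < \<rho>" using c by (auto simp: pcoef_def)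
  \<comment> \<open>The derivative formula holds on the open cube of half side
    \<open>\<rho> / 2\<close>, while \<open>pcoef\<close> needs it on a closed cube;
    \<open>\<rho> / 4\<close> leaves room.\<close>
  have box: "\<forall>b\<in>Basis. \<bar>(w - z) \<bullet> b\<bar> < \<rho> / 2" if "w \<in> pbox z (\<rho> / 4)" for w
    using that \<rho> by (force simp: pbox_def)
  obtain f1 where f1: "pcoef z (\<rho> / 2) (dcoef (1, 0) c) f1"
    "\<And>w. \<forall>b\<in>Basis. \<bar>(w - z) \<bullet> b\<bar> < \<rho> / 2 \<Longrightarrow> ((\<lambda>t. f (w + t *\<^sub>R (1, 0))) has_real_derivative f1 w) (at 0)"
    using pcoef_deriv[OF c _ \<rho>, of "(1, 0)"] by (auto simp: Basis_real_pair)
  have "partial_x f w = f1 w" if "w \<in> pbox z (\<rho> / 4)" for w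
  proof -
    obtain x y where w: "w = (x, y)" by (cases w)
    have "((\<lambda>t. f (x + t, y)) has_real_derivative f1 w) (at 0)"
      using f1(2)[OF box[OF that]] by (simp add: w)
    then have "((\<lambda>t. f (t, y)) has_real_derivative f1 w) (at x)"
      using DERIV_shift[of "\<lambda>t. f (t, y)" "f1 w" 0 x] by (simp add: add.commute)
    then show ?thesis by (simp add: partial_x_def w DERIV_imp_deriv)
  qed
  then have "pcoef z (\<rho> / 4) (dcoef (1, 0) c) (partial_x f)"
    using pcoef_shrink[OF f1(1), of "\<rho> / 4"] \<rho> by (simp add: pcoef_def)
  then show "\<exists>r. pcoef z r (dcoef (1, 0) c) (partial_x f)" by blast
  obtain f2 where f2: "pcoef z (\<rho> / 2) (dcoef (0, 1) c) f2"
    "\<And>w. \<forall>b\<in>Basis. \<bar>(w - z) \<bullet> b\<bar> < \<rho> / 2 \<Longrightarrow> ((\<lambda>t. f (w + t *\<^sub>R (0, 1))) has_real_derivative f2 w) (at 0)"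
    using pcoef_deriv[OF c _ \<rho>, of "(0, 1)"] by (auto simp: Basis_real_pair)
  have "partial_y f w = f2 w" if "w \<in> pbox z (\<rho> / 4)" for w
  proof -
    obtain x y where w: "w = (x, y)" by (cases w)
    have "((\<lambda>t. f (x, y + t)) has_real_derivative f2 w) (at 0)"
      using f2(2)[OF box[OF that]] by (simp add: w)
    then have "((\<lambda>t. f (x, t)) has_real_derivative f2 w) (at y)"
      using DERIV_shift[of "\<lambda>t. f (x, t)" "f2 w" 0 y] by (simp add: add.commute)
    then show ?thesis by (simp add: partial_y_def w DERIV_imp_deriv)
  qed
  then have "pcoef z (\<rho> / 4) (dcoef (0, 1) c) (partial_y f)"
    using pcoef_shrink[OF f2(1), of "\<rho> / 4"] \<rho> by (simp add: pcoef_def)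
  then show "\<exists>r. pcoef z r (dcoef (0, 1) c) (partial_y f)" by blast
qed

lemma real_analytic_at_iff_pcoef: "real_analytic_at f a \<longleftrightarrow> (\<exists>\<rho> c. pcoef a \<rho> c f)"
  by (auto simp: real_analytic_at_iff_pser pser_def)

lemma real_analytic_at_partial:
  assumes "real_analytic_at f z"
  shows "real_analytic_at (partial_x f) z" "real_analytic_at (partial_y f) z"
  using assms pcoef_partial unfolding real_analytic_at_iff_pcoef by blast+

text \<open>Both sides are constant coefficients of twice differentiated series, and the two
  coefficient shifts commute.\<close>

lemma partial_y_partial_x:
  assumes "real_analytic_at f z"
  shows "partial_y (partial_x f) z = partial_x (partial_y f) z"
proof -
  obtain \<rho> c where c: "pcoef z \<rho> c f" using assms by (auto simp: real_analytic_at_iff_pcoef)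
  obtain r where "pcoef z r (dcoef (0, 1) (dcoef (1, 0) c)) (partial_y (partial_x f))"
    using pcoef_partial c by meson
  then have 1: "partial_y (partial_x f) z = dcoef (0, 1) (dcoef (1, 0) c) mzero" by (rule pcoef_center)
  obtain r where "pcoef z r (dcoef (1, 0) (dcoef (0, 1) c)) (partial_x (partial_y f))"
    using pcoef_partial c by meson
  then have 2: "partial_x (partial_y f) z = dcoef (1, 0) (dcoef (0, 1) c) mzero" by (rule pcoef_center)
  show ?thesis unfolding 1 2 by (simp add: dcoef_def fun_upd_twist)
qed

lemma partial_rec:
  "partial 0 0 F = F" "partial (Suc j) k F = partial_x (partial j k F)" "partial 0 (Suc k) F = partial_y (partial 0 k F)"
  by (simp_all add: partial_def)

lemma real_analytic_at_partial_jk: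
  assumes "real_analytic_at F z"
  shows "real_analytic_at (partial j k F) z"
proof (induction j)
  case 0
  show ?case by (induction k) (auto simp: partial_rec assms intro: real_analytic_at_partial)
qed (auto simp: partial_rec intro: real_analytic_at_partial)

text \<open>In \<open>partial j k\<close> the derivatives in \<open>y\<close> are applied first, so
  a further one has to be moved inwards past \<open>j\<close> derivatives in
  \<open>x\<close>.\<close>

lemma has_grad_partial_jk:
  assumes "open U" "\<And>w. w \<in> U \<Longrightarrow> real_analytic_at F w" "z \<in> U"
  shows "has_grad (partial j k F) (partial (Suc j) k F z) (partial j (Suc k) F z) z"
proof -
  have y: "partial_y (partial j k F) w = partial j (Suc k) F w" if "w \<in> U" for w
    using that
  proof (induction j arbitrary: w)
    case (Suc j)
    have "partial_y (partial (Suc j) k F) w = partial_x (partial_y (partial j k F)) w"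
      unfolding partial_rec by (rule partial_y_partial_x) (use Suc assms real_analytic_at_partial_jk in auto)
    also have "\<dots> = partial_x (partial j (Suc k) F) w"
    proof -
      have "has_grad (partial j (Suc k) F) (partial_x (partial j (Suc k) F) w) (partial_y (partial j (Suc k) F) w) w"
        using Suc assms real_analytic_at_partial_jk by (intro has_grad_partial) auto
      then have "has_grad (partial_y (partial j k F)) (partial_x (partial j (Suc k) F) w) (partial_y (partial j (Suc k) F) w) w"
        by (rule has_grad_cong_open[OF _ assms(1) Suc.prems]) (use Suc.IH in auto)
      then show ?thesis by (simp add: has_gradD)
    qed
    finally show ?case by (simp add: partial_rec)
  qed (simp add: partial_rec)
  have "has_grad (partial j k F) (partial_x (partial j k F) z) (partial_y (partial j k F) z) z"
    using assms real_analytic_at_partial_jk by (intro has_grad_partial) auto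
  then show ?thesis using y[OF assms(3)] by (simp add: partial_rec)
qed

section \<open>Rulings of developable surfaces\<close>


text \<open>Separated from \<open>parabolic_surface\<close> because an envelope has these properties
  before anything is known about its \<open>S\<close>.\<close>

definition developable :: "(real \<times> real) set \<Rightarrow> (real \<times> real \<Rightarrow> real) \<Rightarrow> bool" where
  "developable U F \<longleftrightarrow> open U \<and> real_analytic_on F U \<and>
     (\<forall>z\<in>U. partial 2 0 F z \<noteq> 0 \<and> partial 2 0 F z * partial 0 2 F z - (partial 1 1 F z)\<^sup>2 = 0)"

definition slope :: "(real \<times> real \<Rightarrow> real) \<Rightarrow> real \<times> real \<Rightarrow> real" where
  "slope F z = partial 1 1 F z / partial 2 0 F z"

definition slope_xx :: "(real \<times> real \<Rightarrow> real) \<Rightarrow> real \<times> real \<Rightarrow> real" where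
  "slope_xx F = partial_x (S_fun F)"

lemma parabolic_surface_iff: "parabolic_surface U F \<longleftrightarrow> developable U F \<and> (\<forall>z\<in>U. S_fun F z \<noteq> 0)"
  by (auto simp: parabolic_surface_def developable_def)

text \<open>The fourth equation says that the rulings are straight: the slope \<open>h\<close> is constant along the field
  \<open>\<partial>\<^sub>y - h \<partial>\<^sub>x\<close>. The later ones follow from it by differentiation.\<close>

lemma structure_equations:
  assumes dev: "developable U F" and z: "z \<in> U"
  shows "has_grad F (partial 1 0 F z) (partial 0 1 F z) z"
    and "has_grad (partial 1 0 F) (partial 2 0 F z) (slope F z * partial 2 0 F z) z"
    and "has_grad (partial 0 1 F) (slope F z * partial 2 0 F z) ((slope F z)\<^sup>2 * partial 2 0 F z) z"
    and "has_grad (slope F) (S_fun F z) (slope F z * S_fun F z) z"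
    and "has_grad (partial 2 0 F) (partial 3 0 F z) (S_fun F z * partial 2 0 F z + slope F z * partial 3 0 F z) z"
    and "has_grad (S_fun F) (slope_xx F z) ((S_fun F z)\<^sup>2 + slope F z * slope_xx F z) z"
    and "has_grad (partial 3 0 F) (partial 4 0 F z)
           (slope_xx F z * partial 2 0 F z + 2 * S_fun F z * partial 3 0 F z + slope F z * partial 4 0 F z) z"
    and "partial 1 1 F z = slope F z * partial 2 0 F z"
    and "partial 2 1 F z = S_fun F z * partial 2 0 F z + slope F z * partial 3 0 F z"
    and "partial 3 1 F z = slope_xx F z * partial 2 0 F z + 2 * S_fun F z * partial 3 0 F z + slope F z * partial 4 0 F z"
proof -
  have U: "open U" and an: "\<And>w. w \<in> U \<Longrightarrow> real_analytic_at F w"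
    and a0: "\<And>w. w \<in> U \<Longrightarrow> partial 2 0 F w \<noteq> 0"
    and par: "\<And>w. w \<in> U \<Longrightarrow> partial 2 0 F w * partial 0 2 F w = (partial 1 1 F w)\<^sup>2"
    using dev by (auto simp: developable_def real_analytic_on_def)
  have g: "has_grad (partial j k F) (partial (Suc j) k F w) (partial j (Suc k) F w) w" if "w \<in> U" for w j k
    by (rule has_grad_partial_jk[OF U an that])
  have g10: "has_grad (partial 1 0 F) (partial 2 0 F w) (partial 1 1 F w) w" if "w \<in> U" for w
    using g[OF that, of 1 0] by (simp add: numeral_2_eq_2)
  have g01: "has_grad (partial 0 1 F) (partial 1 1 F w) (partial 0 2 F w) w" if "w \<in> U" for w
    using g[OF that, of 0 1] by (simp add: numeral_2_eq_2)
  have g20: "has_grad (partial 2 0 F) (partial 3 0 F w) (partial 2 1 F w) w" if "w \<in> U" for w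
    using g[OF that, of 2 0] by (simp add: numeral_2_eq_2 numeral_3_eq_3)
  have g30: "has_grad (partial 3 0 F) (partial 4 0 F w) (partial 3 1 F w) w" if "w \<in> U" for w
    using g[OF that, of 3 0] by (simp add: numeral_eq_Suc)
  have g11: "has_grad (partial 1 1 F) (partial 2 1 F w) (partial 1 2 F w) w" if "w \<in> U" for w
    using g[OF that, of 1 1] by (simp add: numeral_2_eq_2)
  have g02: "has_grad (partial 0 2 F) (partial 1 2 F w) (partial 0 3 F w) w" if "w \<in> U" for w
    using g[OF that, of 0 2] by (simp add: numeral_2_eq_2 numeral_3_eq_3)
  have g21: "has_grad (partial 2 1 F) (partial 3 1 F w) (partial 2 2 F w) w" if "w \<in> U" for w
    using g[OF that, of 2 1] by (simp add: numeral_2_eq_2 numeral_3_eq_3)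
  note One_nat_def [simp del]
  have u11: "partial 1 1 F w = slope F w * partial 2 0 F w" if "w \<in> U" for w
    using a0[OF that] by (simp add: slope_def)
  have u02: "partial 0 2 F w = (slope F w)\<^sup>2 * partial 2 0 F w" if "w \<in> U" for w
    using a0[OF that] par[OF that] by (simp add: slope_def field_simps power2_eq_square)
  have an_slope: "real_analytic_at (slope F) w" if "w \<in> U" for w
    unfolding slope_def[abs_def] using an a0 that
    by (intro real_analytic_at_divide real_analytic_at_partial_jk) auto
  have sx: "partial_x (slope F) w = S_fun F w" if "w \<in> U" for w
  proof -
    have "partial 2 1 F w = partial_x (slope F) w * partial 2 0 F w + slope F w * partial 3 0 F w"
      by (rule has_grad_agree(1)[OF g11[OF that] has_grad_mult[OF has_grad_partial[OF an_slope[OF that]] g20[OF that]] U that u11])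
    then show ?thesis
      using a0[OF that] by (simp add: S_fun_def slope_def field_simps power2_eq_square)
  qed
  have gs0: "has_grad (slope F) (S_fun F w) (partial_y (slope F) w) w" if "w \<in> U" for w
    using has_grad_partial[OF an_slope[OF that]] sx[OF that] by simp
  have u21: "partial 2 1 F w = S_fun F w * partial 2 0 F w + slope F w * partial 3 0 F w" if "w \<in> U" for w
    by (rule has_grad_agree(1)[OF g11[OF that] has_grad_mult[OF gs0[OF that] g20[OF that]] U that u11])
  \<comment> \<open>The mixed derivative \<open>u_xyy\<close> is computed twice, from
    \<open>u_yy = h^2 u_xx\<close> in direction \<open>x\<close> and from
    \<open>u_xy = h u_xx\<close> in direction \<open>y\<close>; comparison leaves
    \<open>h_y = h h_x\<close>.\<close>
  have sy: "partial_y (slope F) w = slope F w * S_fun F w" if "w \<in> U" for w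
  proof -
    have "partial 0 2 F v = (slope F v * slope F v) * partial 2 0 F v" if "v \<in> U" for v
      using u02[OF that] by (simp add: power2_eq_square)
    then have "partial 1 2 F w = (S_fun F w * slope F w + slope F w * S_fun F w) * partial 2 0 F w
        + slope F w * slope F w * partial 3 0 F w"
      by (rule has_grad_agree(1)[OF g02[OF that] has_grad_mult[OF has_grad_mult[OF gs0[OF that] gs0[OF that]] g20[OF that]] U that])
    moreover have "partial 1 2 F w = partial_y (slope F) w * partial 2 0 F w + slope F w * partial 2 1 F w"
      by (rule has_grad_agree(2)[OF g11[OF that] has_grad_mult[OF gs0[OF that] g20[OF that]] U that u11])
    ultimately have "(partial_y (slope F) w - slope F w * S_fun F w) * partial 2 0 F w = 0"
      unfolding u21[OF that] by (simp add: algebra_simps)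
    then show ?thesis using a0[OF that] by simp
  qed
  have gs: "has_grad (slope F) (S_fun F w) (slope F w * S_fun F w) w" if "w \<in> U" for w
    using gs0[OF that] sy[OF that] by simp
  have an_S: "real_analytic_at (S_fun F) w" if "w \<in> U" for w
    by (rule real_analytic_at_cong[OF real_analytic_at_partial(1)[OF an_slope[OF that]]])
       (unfold eventually_nhds, use U that sx in blast)
  have gS: "has_grad (S_fun F) (slope_xx F w) ((S_fun F w)\<^sup>2 + slope F w * slope_xx F w) w" if "w \<in> U" for w
  proof -
    have g1: "has_grad (S_fun F) (slope_xx F w) (partial_y (S_fun F) w) w"
      unfolding slope_xx_def by (rule has_grad_partial[OF an_S[OF that]])
    \<comment> \<open>As \<open>S = h_x\<close>, symmetry of second derivatives turns
      \<open>S_y\<close> into the \<open>x\<close>-derivative of \<open>h_y = h S\<close>.\<close>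
    have "partial_y (S_fun F) w = partial_y (partial_x (slope F)) w"
      by (rule has_gradD(2)[symmetric], rule has_grad_cong_open[OF g1 U that]) (simp add: sx)
    also have "\<dots> = partial_x (partial_y (slope F)) w" by (rule partial_y_partial_x[OF an_slope[OF that]])
    also have "\<dots> = (S_fun F w)\<^sup>2 + slope F w * slope_xx F w"
    proof (rule has_gradD(1), rule has_grad_cong_open[OF _ U that])
      show "has_grad (\<lambda>w. slope F w * S_fun F w) ((S_fun F w)\<^sup>2 + slope F w * slope_xx F w)
          (slope F w * S_fun F w * S_fun F w + slope F w * partial_y (S_fun F) w) w"
        using has_grad_mult[OF gs[OF that] g1] by (simp add: power2_eq_square)
    qed (simp add: sy)
    finally show ?thesis using g1 by simp
  qed
  have u31: "partial 3 1 F w = slope_xx F w * partial 2 0 F w + 2 * S_fun F w * partial 3 0 F w + slope F w * partial 4 0 F w"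
    if "w \<in> U" for w
    using has_grad_agree(1)[OF g21[OF that] has_grad_add[OF has_grad_mult[OF gS[OF that] g20[OF that]]
        has_grad_mult[OF gs[OF that] g30[OF that]]] U that u21]
    by (simp add: algebra_simps)
  show "has_grad F (partial 1 0 F z) (partial 0 1 F z) z"
    using g[OF z, of 0 0] by (simp add: partial_rec(1) One_nat_def)
  show "has_grad (partial 1 0 F) (partial 2 0 F z) (slope F z * partial 2 0 F z) z"
    using g10[OF z] u11[OF z] by simp
  show "has_grad (partial 0 1 F) (slope F z * partial 2 0 F z) ((slope F z)\<^sup>2 * partial 2 0 F z) z"
    using g01[OF z] u11[OF z] u02[OF z] by simp
  show "has_grad (slope F) (S_fun F z) (slope F z * S_fun F z) z" by (rule gs[OF z])
  show "has_grad (partial 2 0 F) (partial 3 0 F z) (S_fun F z * partial 2 0 F z + slope F z * partial 3 0 F z) z"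
    using g20[OF z] u21[OF z] by simp
  show "has_grad (S_fun F) (slope_xx F z) ((S_fun F z)\<^sup>2 + slope F z * slope_xx F z) z" by (rule gS[OF z])
  show "has_grad (partial 3 0 F) (partial 4 0 F z)
           (slope_xx F z * partial 2 0 F z + 2 * S_fun F z * partial 3 0 F z + slope F z * partial 4 0 F z) z"
    using g30[OF z] u31[OF z] by simp
  show "partial 1 1 F z = slope F z * partial 2 0 F z" by (rule u11[OF z])
  show "partial 2 1 F z = S_fun F z * partial 2 0 F z + slope F z * partial 3 0 F z" by (rule u21[OF z])
  show "partial 3 1 F z = slope_xx F z * partial 2 0 F z + 2 * S_fun F z * partial 3 0 F z + slope F z * partial 4 0 F z"
    by (rule u31[OF z])
qed

section \<open>The action of affine maps on fourth order jets\<close>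


text \<open>The matrix is given by its entries so that the transformation laws become polynomial
  identities between reals, provable by \<open>algebra\<close> from \<open>det\<close>. Closeness to
  the identity is replaced by the requirement that the image lies in a graph.\<close>

locale developable_map =
  fixes U V :: "(real \<times> real) set" and F G :: "real \<times> real \<Rightarrow> real"
    and m11 m12 m13 m21 m22 m23 m31 m32 m33 b1 b2 b3 :: real
  assumes dev_F: "developable U F" and dev_G: "developable V G"
    and det: "m11 * (m22 * m33 - m23 * m32) - m12 * (m21 * m33 - m23 * m31) + m13 * (m21 * m32 - m22 * m31) = 1"
    and maps: "\<And>w. w \<in> U \<Longrightarrow>
      (m11 * fst w + m12 * snd w + m13 * F w + b1, m21 * fst w + m22 * snd w + m23 * F w + b2) \<in> V \<and>
      G (m11 * fst w + m12 * snd w + m13 * F w + b1, m21 * fst w + m22 * snd w + m23 * F w + b2)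
        = m31 * fst w + m32 * snd w + m33 * F w + b3"
begin

definition "X w = m11 * fst w + m12 * snd w + m13 * F w + b1"
definition "Y w = m21 * fst w + m22 * snd w + m23 * F w + b2"
definition "Z w = m31 * fst w + m32 * snd w + m33 * F w + b3"
definition "Xx w = m11 + m13 * partial 1 0 F w"
definition "Xy w = m12 + m13 * partial 0 1 F w"
definition "Yx w = m21 + m23 * partial 1 0 F w"
definition "Yy w = m22 + m23 * partial 0 1 F w"
definition "Zx w = m31 + m33 * partial 1 0 F w"
definition "Zy w = m32 + m33 * partial 0 1 F w"
definition "Jac w = Xx w * Yy w - Xy w * Yx w"
definition "Num w = slope F w * Xx w - Xy w"
definition "Den w = Yy w - slope F w * Yx w"
definition "Jx w = partial 2 0 F w * (m13 * Den w + m23 * Num w)"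
text \<open>The numerator of the transformed \<open>u_xxx\<close>: it arises by differentiating the
  law for \<open>u_xx\<close> in \<open>x\<close> and clearing denominators.\<close>

definition "K w = Jac w * (Den w * partial 3 0 F w - 3 * S_fun F w * Yx w * partial 2 0 F w)
  - 3 * Den w * partial 2 0 F w * Jx w"

text \<open>\<open>Jac\<close> is the Jacobian of \<open>(X, Y)\<close>, \<open>Den\<close> and \<open>- Num\<close> are the derivatives of \<open>Y\<close> and \<open>X\<close> along the
  ruling field \<open>\<partial>\<^sub>y - h \<partial>\<^sub>x\<close>, \<open>Jx\<close> is the \<open>x\<close>-derivative of \<open>Jac\<close>.\<close>

lemma XY_in: "w \<in> U \<Longrightarrow> (X w, Y w) \<in> V" and G_XY: "w \<in> U \<Longrightarrow> G (X w, Y w) = Z w"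
  using maps[of w] by (simp_all add: X_def Y_def Z_def)

lemma open_U: "open U" using dev_F by (simp add: developable_def)

lemmas F_eqs = structure_equations[OF dev_F]
lemmas G_eqs = structure_equations[OF dev_G XY_in]

lemma grad_X: "w \<in> U \<Longrightarrow> has_grad X (Xx w) (Xy w) w"
  and grad_Y: "w \<in> U \<Longrightarrow> has_grad Y (Yx w) (Yy w) w"
  and grad_Z: "w \<in> U \<Longrightarrow> has_grad Z (Zx w) (Zy w) w"
proof -
  assume w: "w \<in> U"
  have "has_grad (\<lambda>w. m1 * fst w + m2 * snd w + m3 * F w + k) (m1 + m3 * partial 1 0 F w) (m2 + m3 * partial 0 1 F w) w"
    for m1 m2 m3 k
    by (rule has_grad_eq, (rule has_grad_add has_grad_mult has_grad_const has_grad_fst has_grad_snd F_eqs(1)[OF w])+) auto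
  from this[of m11 m12 m13 b1] this[of m21 m22 m23 b2] this[of m31 m32 m33 b3]
  show "has_grad X (Xx w) (Xy w) w" "has_grad Y (Yx w) (Yy w) w" "has_grad Z (Zx w) (Zy w) w"
    by (simp_all add: X_def[abs_def] Y_def[abs_def] Z_def[abs_def] Xx_def Xy_def Yx_def Yy_def Zx_def Zy_def)
qed

lemma grad_pullback:
  assumes "has_grad f fx fy (X w, Y w)" "w \<in> U"
  shows "has_grad (\<lambda>w. f (X w, Y w)) (fx * Xx w + fy * Yx w) (fx * Xy w + fy * Yy w) w"
  using has_grad_compose[OF assms(1) grad_X grad_Y] assms(2) by blast

context
  fixes w assumes w: "w \<in> U"
begin

lemma first_order:
  shows "partial 1 0 G (X w, Y w) * Jac w = Zx w * Yy w - Zy w * Yx w"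
    and "partial 0 1 G (X w, Y w) * Jac w = Xx w * Zy w - Xy w * Zx w"
    and "Jac w \<noteq> 0"
proof -
  note agree = has_grad_agree[OF grad_pullback[OF G_eqs(1)[OF w] w] grad_Z[OF w] open_U w G_XY]
  have e: "partial 1 0 G (X w, Y w) * Xx w + partial 0 1 G (X w, Y w) * Yx w = Zx w"
    "partial 1 0 G (X w, Y w) * Xy w + partial 0 1 G (X w, Y w) * Yy w = Zy w"
    using agree by blast+
  show 1: "partial 1 0 G (X w, Y w) * Jac w = Zx w * Yy w - Zy w * Yx w"
    and 2: "partial 0 1 G (X w, Y w) * Jac w = Xx w * Zy w - Xy w * Zx w"
    unfolding e[symmetric] Jac_def by algebra+
  \<comment> \<open>The left-hand side is the determinant after adding \<open>u_x\<close> and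
    \<open>u_y\<close> times the third column to the first two, expanded along the third. If
    \<open>Jac\<close> vanished, Cramer's rule would make the other two minors vanish too.\<close>
  have "m33 * Jac w - m13 * (Zx w * Yy w - Zy w * Yx w) - m23 * (Xx w * Zy w - Xy w * Zx w) = 1"
    unfolding det[symmetric] Jac_def Xx_def Xy_def Yx_def Yy_def Zx_def Zy_def by algebra
  then show "Jac w \<noteq> 0" unfolding 1[symmetric] 2[symmetric] by auto
qed

text \<open>These quantities are affine in \<open>u_x\<close> or \<open>u_y\<close>, hence constant
  along the rulings: each gradient is a multiple of \<open>(1, h)\<close>. The second components are
  written so as to make this visible.\<close>

lemma grad_1:
  shows grad_Xx: "has_grad Xx (m13 * partial 2 0 F w) (slope F w * (m13 * partial 2 0 F w)) w"
    and grad_Xy: "has_grad Xy (m13 * (slope F w * partial 2 0 F w)) (slope F w * (m13 * (slope F w * partial 2 0 F w))) w"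
    and grad_Yx: "has_grad Yx (m23 * partial 2 0 F w) (slope F w * (m23 * partial 2 0 F w)) w"
    and grad_Yy: "has_grad Yy (m23 * (slope F w * partial 2 0 F w)) (slope F w * (m23 * (slope F w * partial 2 0 F w))) w"
    and grad_Zx: "has_grad Zx (m33 * partial 2 0 F w) (slope F w * (m33 * partial 2 0 F w)) w"
    and grad_Zy: "has_grad Zy (m33 * (slope F w * partial 2 0 F w)) (slope F w * (m33 * (slope F w * partial 2 0 F w))) w"
proof -
  have "has_grad (\<lambda>w. k + n * f w) (n * fx) (n * fy) w" if "has_grad f fx fy w" for k n f fx fy
    using has_grad_add[OF has_grad_const has_grad_mult[OF has_grad_const that]] by simp
  note aux = this[OF F_eqs(2)[OF w]] this[OF F_eqs(3)[OF w]]
  show "has_grad Xx (m13 * partial 2 0 F w) (slope F w * (m13 * partial 2 0 F w)) w"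
    "has_grad Xy (m13 * (slope F w * partial 2 0 F w)) (slope F w * (m13 * (slope F w * partial 2 0 F w))) w"
    "has_grad Yx (m23 * partial 2 0 F w) (slope F w * (m23 * partial 2 0 F w)) w"
    "has_grad Yy (m23 * (slope F w * partial 2 0 F w)) (slope F w * (m23 * (slope F w * partial 2 0 F w))) w"
    "has_grad Zx (m33 * partial 2 0 F w) (slope F w * (m33 * partial 2 0 F w)) w"
    "has_grad Zy (m33 * (slope F w * partial 2 0 F w)) (slope F w * (m33 * (slope F w * partial 2 0 F w))) w"
    unfolding Xx_def[abs_def] Xy_def[abs_def] Yx_def[abs_def] Yy_def[abs_def] Zx_def[abs_def] Zy_def[abs_def]
    by (rule has_grad_eq[OF aux(1)] has_grad_eq[OF aux(2)]; simp add: power2_eq_square)+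
qed

lemma grad_Jac: "has_grad Jac (Jx w) (slope F w * Jx w) w"
  unfolding Jac_def[abs_def]
  by (rule has_grad_eq, (rule has_grad_diff has_grad_mult grad_1)+; simp add: Jx_def Num_def Den_def algebra_simps)

lemma grad_Den: "has_grad Den (- S_fun F w * Yx w) (slope F w * (- S_fun F w * Yx w)) w"
  unfolding Den_def[abs_def]
  by (rule has_grad_eq, (rule has_grad_diff has_grad_mult grad_1 F_eqs(4)[OF w])+; simp add: algebra_simps)

lemma grad_Num: "has_grad Num (S_fun F w * Xx w) (slope F w * (S_fun F w * Xx w)) w"
  unfolding Num_def[abs_def]
  by (rule has_grad_eq, (rule has_grad_diff has_grad_mult grad_1 F_eqs(4)[OF w])+; simp add: algebra_simps)

lemma Jac_eq: "Jac w = Xx w * Den w + Yx w * Num w"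
  by (simp add: Jac_def Den_def Num_def algebra_simps)

end

text \<open>Obtained by differentiating Cramer's formula for the new \<open>u_x\<close> in both
  directions. The first equation expresses that the ruling direction is mapped to the ruling
  direction.\<close>

lemma second_order:
  assumes w: "w \<in> U"
  shows "slope G (X w, Y w) * Den w = Num w"
    and "Den w \<noteq> 0"
    and "partial 2 0 G (X w, Y w) * Jac w ^ 3 = (Den w)\<^sup>2 * partial 2 0 F w"
    and "(Xx w + slope G (X w, Y w) * Yx w) * Den w = Jac w"
proof -
  define P where "P = partial 1 0 G (X w, Y w)"
  define A where "A = partial 2 0 G (X w, Y w)"
  define H where "H = slope G (X w, Y w)"
  define a where "a = partial 2 0 F w"
  define h where "h = slope F w"
  define Mx where "Mx = a * (m33 * Yy w - m23 * Zy w + h * (m23 * Zx w - m33 * Yx w))"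
  have J: "Jac w \<noteq> 0" and PJ: "P * Jac w = Zx w * Yy w - Zy w * Yx w"
    using first_order[OF w] by (auto simp: P_def)
  have "A \<noteq> 0" using dev_G XY_in[OF w] by (auto simp: developable_def A_def)
  have "has_grad (\<lambda>w. Zx w * Yy w - Zy w * Yx w) Mx (h * Mx) w"
    by (rule has_grad_eq, (rule has_grad_diff has_grad_mult grad_1[OF w])+; simp add: Mx_def a_def h_def algebra_simps)
  note agree = has_grad_agree[OF has_grad_mult[OF grad_pullback[OF G_eqs(2)[OF w] w] grad_Jac[OF w]]
      this open_U w first_order(1), folded A_def H_def P_def h_def]
  have e: "(A * Xx w + H * A * Yx w) * Jac w + P * Jx w = Mx"
    "(A * Xy w + H * A * Yy w) * Jac w + P * (h * Jx w) = h * Mx"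
    using agree by blast+
  \<comment> \<open>The second equation of \<open>e\<close> minus \<open>h\<close> times the first:
    the gradients of \<open>Jac\<close> and of the minor are multiples of \<open>(1, h)\<close>, so
    they cancel.\<close>
  have "A * Jac w * (H * Den w - Num w) = 0"
  proof -
    have "A * Jac w * (H * Den w - Num w) = ((A * Xy w + H * A * Yy w) * Jac w + P * (h * Jx w))
        - h * ((A * Xx w + H * A * Yx w) * Jac w + P * Jx w)"
      unfolding Den_def Num_def h_def[symmetric] by (simp add: algebra_simps)
    then show ?thesis unfolding e by simp
  qed
  then have HD: "H * Den w = Num w" using \<open>A \<noteq> 0\<close> J by simp
  show "slope G (X w, Y w) * Den w = Num w" using HD by (simp add: H_def)
  \<comment> \<open>With \<open>Den\<close> also \<open>Num\<close> would vanish, and then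
    \<open>Jac\<close> by \<open>Jac_eq\<close>: no affine map injective on the tangent plane kills
    the ruling.\<close>
  show D: "Den w \<noteq> 0"
  proof
    assume "Den w = 0"
    then show False using HD J Jac_eq[OF w] by simp
  qed
  show XJ: "(Xx w + slope G (X w, Y w) * Yx w) * Den w = Jac w"
    using HD Jac_eq[OF w] by (simp add: H_def algebra_simps)
  \<comment> \<open>The numerator of the derivative of the quotient of the minor by
    \<open>Jac\<close>; the full determinant splits off as a factor.\<close>
  have id: "Mx * Jac w - (Zx w * Yy w - Zy w * Yx w) * Jx w = Den w * a"
  proof -
    have "Mx * Jac w - (Zx w * Yy w - Zy w * Yx w) * Jx w
      = Den w * a * (m11 * (m22 * m33 - m23 * m32) - m12 * (m21 * m33 - m23 * m31) + m13 * (m21 * m32 - m22 * m31))"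
      unfolding Mx_def Jac_def Jx_def Den_def Num_def Xx_def Xy_def Yx_def Yy_def Zx_def Zy_def a_def h_def by algebra
    then show ?thesis by (simp add: det)
  qed
  have "A * Jac w ^ 3 = A * (Jac w)\<^sup>2 * ((Xx w + H * Yx w) * Den w)"
    using XJ by (simp add: H_def power2_eq_square power3_eq_cube)
  also have "\<dots> = Den w * (((A * Xx w + H * A * Yx w) * Jac w + P * Jx w) * Jac w - (P * Jac w) * Jx w)"
    by (simp add: algebra_simps power2_eq_square)
  also have "\<dots> = (Den w)\<^sup>2 * a" unfolding e(1) PJ using id by (simp add: power2_eq_square)
  finally show "partial 2 0 G (X w, Y w) * Jac w ^ 3 = (Den w)\<^sup>2 * partial 2 0 F w"
    by (simp add: A_def a_def)
qed

text \<open>Differentiating \<open>H * Den = Num\<close> in \<open>x\<close> produces a common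
  factor \<open>Xx + H * Yx\<close>, which is nonzero because its product with \<open>Den\<close> is
  \<open>Jac\<close>.\<close>

lemma S_fun_transform:
  assumes w: "w \<in> U"
  shows "S_fun G (X w, Y w) * Den w = S_fun F w"
proof -
  define H where "H = slope G (X w, Y w)"
  define S where "S = S_fun G (X w, Y w)"
  have "S * ((Xx w + H * Yx w) * Den w) = S_fun F w * (Xx w + H * Yx w)"
    using has_grad_agree(1)[OF has_grad_mult[OF grad_pullback[OF G_eqs(4)[OF w] w] grad_Den[OF w]]
        grad_Num[OF w] open_U w second_order(1)]
    by (simp add: S_def H_def algebra_simps)
  moreover have "Xx w + H * Yx w \<noteq> 0"
    using second_order(4)[OF w] first_order(3)[OF w] by (auto simp: H_def)
  ultimately show ?thesis by (simp add: S_def)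
qed

text \<open>Differentiating \<open>S * Den = s\<close> leaves a correction that is a multiple of
  \<open>S * Den - s\<close>, hence 0. So this law has no lower order terms, in contrast to those
  for \<open>u_xxx\<close> and \<open>u_xxxx\<close>.\<close>

lemma slope_xx_transform:
  assumes w: "w \<in> U"
  shows "slope_xx G (X w, Y w) * Jac w = slope_xx F w"
proof -
  define H where "H = slope G (X w, Y w)"
  define S where "S = S_fun G (X w, Y w)"
  define B where "B = slope_xx G (X w, Y w)"
  have "B * ((Xx w + H * Yx w) * Den w) + S * Yx w * (S * Den w - S_fun F w) = slope_xx F w"
    using has_grad_agree(1)[OF has_grad_mult[OF grad_pullback[OF G_eqs(6)[OF w] w] grad_Den[OF w]]
        F_eqs(6)[OF w] open_U w S_fun_transform]
    by (simp add: B_def S_def H_def algebra_simps power2_eq_square)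
  then show ?thesis
    using second_order(4)[OF w] S_fun_transform[OF w] by (simp add: S_def H_def B_def)
qed

lemma third_order:
  assumes w: "w \<in> U"
  shows "partial 3 0 G (X w, Y w) * Jac w ^ 5 = (Den w)\<^sup>2 * K w"
proof -
  define H where "H = slope G (X w, Y w)"
  define S where "S = S_fun G (X w, Y w)"
  define A where "A = partial 2 0 G (X w, Y w)"
  define C where "C = partial 3 0 G (X w, Y w)"
  define s where "s = S_fun F w"
  define a where "a = partial 2 0 F w"
  define c where "c = partial 3 0 F w"
  have AJ: "A * Jac w ^ 3 = (Den w)\<^sup>2 * a" and XJ: "(Xx w + H * Yx w) * Den w = Jac w"
    and SD: "S * Den w = s"
    using second_order[OF w] S_fun_transform[OF w] by (auto simp: A_def a_def H_def S_def s_def)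
  have "partial 2 0 G (X v, Y v) * (Jac v * Jac v * Jac v) = Den v * Den v * partial 2 0 F v" if "v \<in> U" for v
    using second_order(3)[OF that] by (simp add: power2_eq_square power3_eq_cube mult.assoc)
  note agree = has_grad_agree(1)[OF has_grad_mult[OF grad_pullback[OF G_eqs(5)[OF w] w]
        has_grad_mult[OF has_grad_mult[OF grad_Jac[OF w] grad_Jac[OF w]] grad_Jac[OF w]]]
      has_grad_mult[OF has_grad_mult[OF grad_Den[OF w] grad_Den[OF w]] F_eqs(5)[OF w]] open_U w this]
  have "(C * Xx w + (S * A + H * C) * Yx w) * Jac w ^ 3 + 3 * A * (Jac w)\<^sup>2 * Jx w
      = - 2 * Den w * s * Yx w * a + (Den w)\<^sup>2 * c"
    using agree[folded A_def C_def S_def H_def]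
    by (simp add: algebra_simps power2_eq_square power3_eq_cube s_def a_def c_def)
  then have "C * Jac w ^ 5 = (Den w)\<^sup>2 * (Jac w * (Den w * c - 3 * s * Yx w * a) - 3 * Den w * a * Jx w)"
    using AJ XJ SD by algebra
  then show ?thesis by (simp add: K_def C_def s_def a_def c_def)
qed

text \<open>The derivative of the third order law, multiplied by \<open>Den\<close> to eliminate the
  new slope. It is left unsolved for the new \<open>u_xxxx\<close>, since it is evaluated only for
  maps with simple \<open>Jac\<close>, \<open>Den\<close> and \<open>Jx\<close>.\<close>

lemma fourth_order:
  assumes w: "w \<in> U"
  defines "s \<equiv> S_fun F w" and "a \<equiv> partial 2 0 F w" and "c \<equiv> partial 3 0 F w" and "b \<equiv> slope_xx F w"
  shows "(partial 4 0 G (X w, Y w) * Jac w + Den w * Yx w * (slope_xx G (X w, Y w) * partial 2 0 G (X w, Y w)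
            + 2 * S_fun G (X w, Y w) * partial 3 0 G (X w, Y w))) * Jac w ^ 5
          + 5 * Den w * partial 3 0 G (X w, Y w) * Jac w ^ 4 * Jx w
        = - 2 * (Den w)\<^sup>2 * s * Yx w * K w
          + Den w ^ 3 * (Jx w * (Den w * c - 3 * s * Yx w * a)
            + Jac w * (Den w * partial 4 0 F w - 4 * s * c * Yx w - 3 * b * a * Yx w - 3 * s * m23 * a\<^sup>2)
            + 3 * s * Yx w * a * Jx w - 6 * Den w * c * Jx w
            - 3 * Den w * a\<^sup>2 * s * (m23 * Xx w - m13 * Yx w))"
proof -
  define H where "H = slope G (X w, Y w)"
  define S where "S = S_fun G (X w, Y w)"
  define A where "A = partial 2 0 G (X w, Y w)"
  define B where "B = slope_xx G (X w, Y w)"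
  define C where "C = partial 3 0 G (X w, Y w)"
  define D where "D = partial 4 0 G (X w, Y w)"
  define d where "d = partial 4 0 F w"
  have XJ: "(Xx w + H * Yx w) * Den w = Jac w" using second_order[OF w] by (auto simp: H_def)
  obtain kx0 ky0 where Jx': "has_grad Jx kx0 ky0 w" and kx0: "kx0 = c * (m13 * Den w + m23 * Num w) + a * s * (m23 * Xx w - m13 * Yx w)"
  proof
    show "has_grad Jx (c * (m13 * Den w + m23 * Num w) + a * s * (m23 * Xx w - m13 * Yx w))
      ((s * a + slope F w * c) * (m13 * Den w + m23 * Num w) +
        a * (m13 * (slope F w * (- s * Yx w)) + m23 * (slope F w * (s * Xx w)))) w"
      unfolding Jx_def[abs_def] s_def a_def c_def
      by (rule has_grad_eq, (rule has_grad_add has_grad_mult has_grad_const grad_Den[OF w] grad_Num[OF w] F_eqs(5)[OF w])+;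
          simp add: algebra_simps)
  qed simp
  let ?Kx = "Jx w * (Den w * c - 3 * s * Yx w * a)
            + Jac w * (Den w * d - 4 * s * c * Yx w - 3 * b * a * Yx w - 3 * s * m23 * a\<^sup>2)
            + 3 * s * Yx w * a * Jx w - 3 * Den w * c * Jx w - 3 * Den w * a * kx0"
  \<comment> \<open>Only derivatives in \<open>x\<close> are compared, so the other component is
    whatever the rules produce.\<close>
  have "\<exists>ky. has_grad K ?Kx ky w"
    unfolding K_def[abs_def]
    by (rule exI, rule has_grad_eq,
        (rule has_grad_diff has_grad_mult has_grad_const Jx' grad_Jac[OF w] grad_Den[OF w] grad_Yx[OF w]
          F_eqs(5)[OF w] F_eqs(6)[OF w] F_eqs(7)[OF w])+,
        simp add: s_def a_def c_def b_def d_def algebra_simps power2_eq_square, rule refl)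
  then obtain ky where gK: "has_grad K ?Kx ky w" by blast
  have "partial 3 0 G (X v, Y v) * (Jac v * (Jac v * (Jac v * (Jac v * Jac v)))) = Den v * Den v * K v" if "v \<in> U" for v
    using third_order[OF that] by (simp add: power2_eq_square eval_nat_numeral mult.assoc)
  note agree = has_grad_agree(1)[OF has_grad_mult[OF grad_pullback[OF G_eqs(7)[OF w] w]
        has_grad_mult[OF grad_Jac[OF w] has_grad_mult[OF grad_Jac[OF w] has_grad_mult[OF grad_Jac[OF w]
          has_grad_mult[OF grad_Jac[OF w] grad_Jac[OF w]]]]]]
      has_grad_mult[OF has_grad_mult[OF grad_Den[OF w] grad_Den[OF w]] gK] open_U w this]
  have "(D * Xx w + (B * A + 2 * S * C + H * D) * Yx w) * Jac w ^ 5 + 5 * C * Jac w ^ 4 * Jx w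
      = - 2 * Den w * s * Yx w * K w + (Den w)\<^sup>2 * ?Kx"
    using agree[folded A_def B_def C_def D_def S_def H_def]
    by (simp add: algebra_simps eval_nat_numeral s_def)
  moreover have "a * (m13 * Den w + m23 * Num w) = Jx w" by (simp add: Jx_def a_def)
  ultimately show ?thesis
    using XJ unfolding H_def[symmetric] S_def[symmetric] A_def[symmetric] B_def[symmetric] C_def[symmetric]
      D_def[symmetric] d_def[symmetric] kx0 by algebra
qed

end

section \<open>Invariance of W\<close>


text \<open>The jet is expressed through the slope \<open>h\<close> and its derivatives \<open>s = h\<^sub>x\<close>, \<open>b = h\<^sub>x\<^sub>x\<close> by differentiating
  \<open>u\<^sub>x\<^sub>y = h u\<^sub>x\<^sub>x\<close> with respect to \<open>x\<close>.\<close>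

definition jet_of :: "real \<Rightarrow> real \<Rightarrow> real \<Rightarrow> real \<Rightarrow> real \<Rightarrow> real \<Rightarrow> real \<Rightarrow> real \<Rightarrow> real \<Rightarrow> real \<Rightarrow> real \<Rightarrow> jet4" where
  "jet_of x y u p q h a s b c d = (x, y, u, p, a, c, d, q, h * a, s * a + h * c, b * a + 2 * s * c + h * d)"

lemma jet_eq_jet_of:
  assumes "developable U F" "z \<in> U"
  shows "jet F z = jet_of (fst z) (snd z) (F z) (partial 1 0 F z) (partial 0 1 F z) (slope F z)
    (partial 2 0 F z) (S_fun F z) (slope_xx F z) (partial 3 0 F z) (partial 4 0 F z)"
  unfolding jet_def jet_of_def structure_equations(8,9,10)[OF assms] ..

lemma jet_of_in_jet_region [simp]:
  "jet_of x y u p q h a s b c d \<in> jet_region \<longleftrightarrow> a \<noteq> 0 \<and> s \<noteq> 0"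
  by (auto simp: jet_of_def jet_region_def algebra_simps)

lemma jet_region_cases:
  assumes "j \<in> jet_region"
  obtains x y u p q h a s b c d where "j = jet_of x y u p q h a s b c d" "a \<noteq> 0" "s \<noteq> 0"
proof -
  obtain x y u p a c d q k l m where j: "j = (x, y, u, p, a, c, d, q, k, l, m)"
    by (metis surj_pair)
  have a: "a \<noteq> 0" "a * l - k * c \<noteq> 0" using assms by (auto simp: j jet_region_def)
  define h where "h = k / a"
  define s where "s = (l - h * c) / a"
  define b where "b = (m - 2 * s * c - h * d) / a"
  have "k = h * a" using a by (simp add: h_def)
  moreover have "l = s * a + h * c" using a by (simp add: s_def)
  moreover have "m = b * a + 2 * s * c + h * d" using a by (simp add: b_def)
  ultimately have "j = jet_of x y u p q h a s b c d" by (simp add: j jet_of_def)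
  moreover from this have "s \<noteq> 0" using assms by simp
  ultimately show ?thesis using that a by blast
qed

lemma W_jet_of:
  assumes "a \<noteq> 0" "s \<noteq> 0"
  shows "W (jet_of x y u p q h a s b c d) = b / (root 3 a * (root 3 s)\<^sup>2)"
proof -
  \<comment> \<open>With the cube roots as variables the formula becomes rational: the radicand in
    \<open>W\<close> is \<open>a\<^sup>2 * s\<close>, the cube of
    \<open>r\<^sup>2 * t\<close>.\<close>
  define r t where "r = root 3 a" and "t = root 3 s"
  have r: "a = r ^ 3" and t: "s = t ^ 3" by (simp_all add: r_def t_def odd_real_root_pow)
  have "a * (s * a + h * c) - h * a * c = (r\<^sup>2 * t) ^ 3"
    by (simp add: r t algebra_simps eval_nat_numeral)
  then have 1: "root 3 (a * (s * a + h * c) - h * a * c) = r\<^sup>2 * t" by (simp add: odd_real_root_power_cancel)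
  have 2: "a\<^sup>2 * (b * a + 2 * s * c + h * d) - a * (h * a) * d + 2 * (h * a) * c\<^sup>2 - 2 * a * c * (s * a + h * c) = a ^ 3 * b"
    by (simp add: algebra_simps eval_nat_numeral)
  have "W (jet_of x y u p q h a s b c d) = a ^ 3 * b / (a\<^sup>2 * (r\<^sup>2 * t)\<^sup>2)"
    by (simp add: W_def jet_of_def 1 2)
  also have "\<dots> = b / (r * t\<^sup>2)"
    using assms unfolding r t by (simp add: field_simps eval_nat_numeral)
  finally show ?thesis by (simp add: r_def t_def)
qed

section \<open>Affine maps between graphs\<close>

lemma affine_act_graph_point:
  "affine_act g (graph_point F w) = vector
    [fst g $ 1 $ 1 * fst w + fst g $ 1 $ 2 * snd w + fst g $ 1 $ 3 * F w + snd g $ 1,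
     fst g $ 2 $ 1 * fst w + fst g $ 2 $ 2 * snd w + fst g $ 2 $ 3 * F w + snd g $ 2,
     fst g $ 3 $ 1 * fst w + fst g $ 3 $ 2 * snd w + fst g $ 3 $ 3 * F w + snd g $ 3]"
  by (simp add: vec_eq_iff forall_3 affine_act_def graph_point_def matrix_vector_mult_def sum_3)

lemma vector_3_eq_graph_point: "vector [x, y, u] = graph_point G v \<longleftrightarrow> v = (x, y) \<and> G (x, y) = u"
  by (cases v) (auto simp: graph_point_def vec_eq_iff forall_3)

lemma developable_map_affine_act:
  assumes "g \<in> SA3" "developable U F" "developable V G"
    "affine_act g ` graph_point F ` U \<subseteq> graph_point G ` V"
  shows "developable_map U V F G (fst g $ 1 $ 1) (fst g $ 1 $ 2) (fst g $ 1 $ 3)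
    (fst g $ 2 $ 1) (fst g $ 2 $ 2) (fst g $ 2 $ 3) (fst g $ 3 $ 1) (fst g $ 3 $ 2) (fst g $ 3 $ 3)
    (snd g $ 1) (snd g $ 2) (snd g $ 3)"
proof
  show "fst g $ 1 $ 1 * (fst g $ 2 $ 2 * fst g $ 3 $ 3 - fst g $ 2 $ 3 * fst g $ 3 $ 2)
      - fst g $ 1 $ 2 * (fst g $ 2 $ 1 * fst g $ 3 $ 3 - fst g $ 2 $ 3 * fst g $ 3 $ 1)
      + fst g $ 1 $ 3 * (fst g $ 2 $ 1 * fst g $ 3 $ 2 - fst g $ 2 $ 2 * fst g $ 3 $ 1) = 1"
    using assms(1) by (auto simp: SA3_def det_3 algebra_simps)
  fix w assume "w \<in> U"
  then obtain v where "v \<in> V" "affine_act g (graph_point F w) = graph_point G v"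
    using assms(4) by blast
  then show "(fst g $ 1 $ 1 * fst w + fst g $ 1 $ 2 * snd w + fst g $ 1 $ 3 * F w + snd g $ 1,
      fst g $ 2 $ 1 * fst w + fst g $ 2 $ 2 * snd w + fst g $ 2 $ 3 * F w + snd g $ 2) \<in> V \<and>
    G (fst g $ 1 $ 1 * fst w + fst g $ 1 $ 2 * snd w + fst g $ 1 $ 3 * F w + snd g $ 1,
      fst g $ 2 $ 1 * fst w + fst g $ 2 $ 2 * snd w + fst g $ 2 $ 3 * F w + snd g $ 2)
    = fst g $ 3 $ 1 * fst w + fst g $ 3 $ 2 * snd w + fst g $ 3 $ 3 * F w + snd g $ 3"
    by (auto simp: affine_act_graph_point vector_3_eq_graph_point)
qed (use assms in auto)

text \<open>The real cube root is multiplicative for all signs, so \<open>D\<close> and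
  \<open>J\<close> may be negative. The powers of \<open>D\<close> from \<open>root 3 A\<close> and
  from the squared \<open>root 3 S\<close> cancel, and the factor \<open>1 / J\<close> of
  \<open>root 3 A\<close> meets that of \<open>B\<close>.\<close>

lemma (in developable_map) W_invariant:
  assumes w: "w \<in> U" and s: "S_fun F w \<noteq> 0"
  shows "W (jet G (X w, Y w)) = W (jet F w)"
proof -
  define J D where "J = Jac w" and "D = Den w"
  define A S B where "A = partial 2 0 G (X w, Y w)" and "S = S_fun G (X w, Y w)" and "B = slope_xx G (X w, Y w)"
  define a s b where "a = partial 2 0 F w" and "s = S_fun F w" and "b = slope_xx F w"
  have D: "D \<noteq> 0" and J: "J \<noteq> 0" using first_order(3)[OF w] second_order(2)[OF w] by (auto simp: J_def D_def)
  have A: "A = D\<^sup>2 * a / J ^ 3" using second_order(3)[OF w] J by (simp add: A_def a_def J_def D_def field_simps)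
  have S: "S = s / D" using S_fun_transform[OF w] D by (simp add: S_def s_def D_def field_simps)
  have B: "B = b / J" using slope_xx_transform[OF w] J by (simp add: B_def b_def J_def field_simps)
  have a0: "a \<noteq> 0" using dev_F w by (auto simp: developable_def a_def)
  have s0: "s \<noteq> 0" using s by (simp add: s_def)
  have rA: "root 3 A = (root 3 D)\<^sup>2 * root 3 a / J"
    by (simp add: A real_root_divide real_root_mult real_root_power odd_real_root_pow)
  have rS: "root 3 S = root 3 s / root 3 D" by (simp add: S real_root_divide)
  have "B / (root 3 A * (root 3 S)\<^sup>2) = b / (root 3 a * (root 3 s)\<^sup>2)"
    unfolding B rA rS using D J by (simp add: power_divide)
  then show ?thesis
    using a0 s0 A S D J unfolding jet_eq_jet_of[OF dev_G XY_in[OF w]] jet_eq_jet_of[OF dev_F w]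
    by (simp add: W_jet_of flip: A_def S_def B_def a_def s_def b_def)
qed

lemma open_jet_region: "open jet_region"
proof -
  have "jet_region = {z. fst (snd (snd (snd (snd z)))) \<noteq> 0} \<inter>
     {z. fst (snd (snd (snd (snd z)))) * fst (snd (snd (snd (snd (snd (snd (snd (snd (snd z)))))))))
       - fst (snd (snd (snd (snd (snd (snd (snd (snd z)))))))) * fst (snd (snd (snd (snd (snd z))))) \<noteq> 0}"
    by (auto simp: jet_region_def)
  moreover have "open \<dots>"
    by (intro open_Int open_Collect_neq continuous_intros)
  ultimately show ?thesis by simp
qed

lemma real_analytic_on_W: "real_analytic_on W jet_region"
  unfolding real_analytic_on_def
proof
  fix j assume j: "j \<in> jet_region"
  define a where "a z = fst (snd (snd (snd (snd z))))" for z :: jet4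
  define c where "c z = fst (snd (snd (snd (snd (snd z)))))" for z :: jet4
  define d where "d z = fst (snd (snd (snd (snd (snd (snd z))))))" for z :: jet4
  define k where "k z = fst (snd (snd (snd (snd (snd (snd (snd (snd z))))))))" for z :: jet4
  define l where "l z = fst (snd (snd (snd (snd (snd (snd (snd (snd (snd z)))))))))" for z :: jet4
  define m where "m z = snd (snd (snd (snd (snd (snd (snd (snd (snd (snd z)))))))))" for z :: jet4
  have lin: "real_analytic_at a z" "real_analytic_at c z" "real_analytic_at d z"
    "real_analytic_at k z" "real_analytic_at l z" "real_analytic_at m z" for z
    unfolding a_def c_def d_def k_def l_def m_def
    by (rule real_analytic_at_linear, rule linearI, simp_all)+
  have nz: "a j \<noteq> 0" "a j * l j - k j * c j \<noteq> 0"
    using j by (simp_all add: jet_region_def a_def k_def l_def c_def case_prod_beta)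
  have "real_analytic_at (\<lambda>z. root 3 (a z * l z - k z * c z)) j"
    by (rule real_analytic_at_compose_real[OF real_analytic_at_root_real])
       (use nz in \<open>auto intro!: real_analytic_at_diff real_analytic_at_mult lin\<close>)
  with nz have "real_analytic_at (\<lambda>z. ((a z)\<^sup>2 * m z - a z * k z * d z + 2 * k z * (c z)\<^sup>2 - 2 * a z * c z * l z)
      / ((a z)\<^sup>2 * (root 3 (a z * l z - k z * c z))\<^sup>2)) j"
    by (intro real_analytic_at_divide real_analytic_at_add real_analytic_at_diff real_analytic_at_mult
        real_analytic_at_power real_analytic_at_const lin) auto
  moreover have "W = (\<lambda>z. ((a z)\<^sup>2 * m z - a z * k z * d z + 2 * k z * (c z)\<^sup>2 - 2 * a z * c z * l z)
      / ((a z)\<^sup>2 * (root 3 (a z * l z - k z * c z))\<^sup>2))"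
    by (rule ext) (simp add: W_def a_def c_def d_def k_def l_def m_def case_prod_beta)
  ultimately show "real_analytic_at W j" by simp
qed

lemma differential_invariant_W: "differential_invariant jet_region W"
  unfolding differential_invariant_def
\<comment> \<open>The value 1 for \<open>\<epsilon>\<close> is arbitrary: the invariance holds for
  the whole group.\<close>
proof (intro conjI ballI exI[of _ 1] allI impI)
  fix j g U F V G p q
  assume g: "g \<in> SA3" and F: "parabolic_surface U F" and G: "parabolic_surface V G"
    and img: "affine_act g ` graph_point F ` U = graph_point G ` V"
    and p: "p \<in> U" and pq: "affine_act g (graph_point F p) = graph_point G q"
  interpret developable_map U V F G "fst g $ 1 $ 1" "fst g $ 1 $ 2" "fst g $ 1 $ 3"
    "fst g $ 2 $ 1" "fst g $ 2 $ 2" "fst g $ 2 $ 3" "fst g $ 3 $ 1" "fst g $ 3 $ 2" "fst g $ 3 $ 3"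
    "snd g $ 1" "snd g $ 2" "snd g $ 3"
    using F G g img by (intro developable_map_affine_act) (auto simp: parabolic_surface_iff)
  have "q = (X p, Y p)"
    using pq by (simp add: affine_act_graph_point vector_3_eq_graph_point X_def Y_def)
  then show "W (jet G q) = W (jet F p)"
    using W_invariant[OF p] F p by (auto simp: parabolic_surface_iff)
qed (use open_jet_region real_analytic_on_W in auto)

section \<open>Envelopes of one-parameter families of planes\<close>


text \<open>Horner's scheme, by induction on the coefficients. The constants depend on the
  polynomial alone, so the radius can be chosen after them.\<close>

lemma pser_poly_lipschitz:
  fixes A :: "real poly"
  obtains M L where "M \<ge> 0" "L \<ge> 0"
    "\<And>a \<rho> f. pser (a::'a::euclidean_space) \<rho> 1 f \<Longrightarrow> pser a \<rho> M (\<lambda>x. poly A (f x))"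
    "\<And>a \<rho> f g \<delta>. pser (a::'a) \<rho> 1 f \<Longrightarrow> pser a \<rho> 1 g \<Longrightarrow> pser a \<rho> \<delta> (\<lambda>x. f x - g x) \<Longrightarrow>
      pser a \<rho> (L * \<delta>) (\<lambda>x. poly A (f x) - poly A (g x))"
proof (induction A arbitrary: thesis)
  case 0
  show ?case
    by (rule 0[of 0 0]) (auto intro: pser_const[of _ _ 0, simplified] pser_pos)
next
  case (pCons k A)
  obtain M L where M: "M \<ge> 0" "L \<ge> 0"
    "\<And>a \<rho> f. pser (a::'a) \<rho> 1 f \<Longrightarrow> pser a \<rho> M (\<lambda>x. poly A (f x))"
    "\<And>a \<rho> f g \<delta>. pser (a::'a) \<rho> 1 f \<Longrightarrow> pser a \<rho> 1 g \<Longrightarrow> pser a \<rho> \<delta> (\<lambda>x. f x - g x) \<Longrightarrow>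
      pser a \<rho> (L * \<delta>) (\<lambda>x. poly A (f x) - poly A (g x))"
    using pCons.IH by blast
  show ?case
  proof (rule pCons.prems[of "\<bar>k\<bar> + M" "M + L"])
    fix a :: 'a and \<rho> f assume f: "pser a \<rho> 1 f"
    have "pser a \<rho> (\<bar>k\<bar> + 1 * M) (\<lambda>x. k + f x * poly A (f x))"
      using f M(3) by (intro pser_add pser_mult pser_const) (auto simp: pser_pos)
    then show "pser a \<rho> (\<bar>k\<bar> + M) (\<lambda>x. poly (pCons k A) (f x))" by simp
    fix g \<delta> assume g: "pser a \<rho> 1 g" and d: "pser a \<rho> \<delta> (\<lambda>x. f x - g x)"
    have "pser a \<rho> (\<delta> * M + 1 * (L * \<delta>)) (\<lambda>x. (f x - g x) * poly A (f x) + g x * (poly A (f x) - poly A (g x)))"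
      using f g d M(3,4) by (intro pser_add pser_mult) auto
    then show "pser a \<rho> ((M + L) * \<delta>) (\<lambda>x. poly (pCons k A) (f x) - poly (pCons k A) (g x))"
      by (simp add: algebra_simps)
  qed (use M in auto)
qed

text \<open>The right-hand side contracts the series of norm at most \<open>r\<close>: its last term
  is quadratic in \<open>t\<close>, hence controlled by a small \<open>r\<close>, and the other two
  carry a coordinate of norm \<open>\<rho>\<close>, which may be taken small compared with
  \<open>r\<close>.\<close>

lemma analytic_fixed_point:
  fixes A B C :: "real poly" and x0 y0 :: real
  obtains \<rho> r T where "\<rho> > 0" "r > 0" "pser (x0, y0) \<rho> (2 * r) T"
    "\<And>x y. (x, y) \<in> pbox (x0, y0) \<rho> \<Longrightarrow> \<bar>T (x, y)\<bar> \<le> r"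
    "\<And>x y t. (x, y) \<in> pbox (x0, y0) \<rho> \<Longrightarrow> \<bar>t\<bar> \<le> r \<Longrightarrow>
      t = (x - x0) * poly A t + (y - y0) * poly B t + t\<^sup>2 * poly C t \<longleftrightarrow> t = T (x, y)"
proof -
  let ?z = "(x0, y0)"
  obtain MA LA where A: "MA \<ge> 0" "LA \<ge> 0"
    "\<And>z \<rho> f. pser (z::real \<times> real) \<rho> 1 f \<Longrightarrow> pser (z::real \<times> real) \<rho> MA (\<lambda>x. poly A (f x))"
    "\<And>z \<rho> f g \<delta>. pser (z::real \<times> real) \<rho> 1 f \<Longrightarrow> pser (z::real \<times> real) \<rho> 1 g \<Longrightarrow> pser (z::real \<times> real) \<rho> \<delta> (\<lambda>x. f x - g x) \<Longrightarrow>
      pser (z::real \<times> real) \<rho> (LA * \<delta>) (\<lambda>x. poly A (f x) - poly A (g x))"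
    by (rule pser_poly_lipschitz[of A, where 'a="real \<times> real"]) (rule that; assumption)
  obtain MB LB where B: "MB \<ge> 0" "LB \<ge> 0"
    "\<And>z \<rho> f. pser (z::real \<times> real) \<rho> 1 f \<Longrightarrow> pser (z::real \<times> real) \<rho> MB (\<lambda>x. poly B (f x))"
    "\<And>z \<rho> f g \<delta>. pser (z::real \<times> real) \<rho> 1 f \<Longrightarrow> pser (z::real \<times> real) \<rho> 1 g \<Longrightarrow> pser (z::real \<times> real) \<rho> \<delta> (\<lambda>x. f x - g x) \<Longrightarrow>
      pser (z::real \<times> real) \<rho> (LB * \<delta>) (\<lambda>x. poly B (f x) - poly B (g x))"
    by (rule pser_poly_lipschitz[of B, where 'a="real \<times> real"]) (rule that; assumption)
  obtain MC LC where C: "MC \<ge> 0" "LC \<ge> 0"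
    "\<And>z \<rho> f. pser (z::real \<times> real) \<rho> 1 f \<Longrightarrow> pser (z::real \<times> real) \<rho> MC (\<lambda>x. poly C (f x))"
    "\<And>z \<rho> f g \<delta>. pser (z::real \<times> real) \<rho> 1 f \<Longrightarrow> pser (z::real \<times> real) \<rho> 1 g \<Longrightarrow> pser (z::real \<times> real) \<rho> \<delta> (\<lambda>x. f x - g x) \<Longrightarrow>
      pser (z::real \<times> real) \<rho> (LC * \<delta>) (\<lambda>x. poly C (f x) - poly C (g x))"
    by (rule pser_poly_lipschitz[of C, where 'a="real \<times> real"]) (rule that; assumption)
  \<comment> \<open>Chosen so that series of norm at most \<open>r\<close> are mapped to such series
    and distances are halved; adding 1 keeps the denominators positive.\<close>
  define r where "r = 1 / (8 * (MC + LC + 1))"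
  define \<rho> where "\<rho> = r / (4 * (MA + MB + LA + LB + 1))"
  have r: "r > 0" "r \<le> 1" "r * (MC + LC) \<le> 1 / 8"
    using C(1,2) by (auto simp: r_def field_simps)
  have \<rho>: "\<rho> > 0" "\<rho> * (MA + MB + LA + LB) \<le> r / 4"
    using A(1,2) B(1,2) r(1) by (auto simp: \<rho>_def field_simps)
  have \<rho>_sum: "\<rho> * MA + \<rho> * MB + \<rho> * LA + \<rho> * LB \<le> r / 4" using \<rho>(2) by (simp only: distrib_left)
  have r_sum: "r * MC + r * LC \<le> 1 / 8" using r(3) by (simp only: distrib_left)
  have nn: "0 \<le> \<rho> * MA" "0 \<le> \<rho> * MB" "0 \<le> \<rho> * LA" "0 \<le> \<rho> * LB" "0 \<le> r * MC" "0 \<le> r * LC"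
    using \<rho>(1) r(1) A B C by simp_all
  define \<Psi> where "\<Psi> f z = (fst z - x0) * poly A (f z) + (snd z - y0) * poly B (f z) + f z * f z * poly C (f z)"
    for f and z :: "real \<times> real"
  have coord: "pser ?z \<rho> \<rho> (\<lambda>z. fst z - x0)" "pser ?z \<rho> \<rho> (\<lambda>z. snd z - y0)"
    using pser_coord[OF \<rho>(1), of "(1, 0)" ?z] pser_coord[OF \<rho>(1), of "(0, 1)" ?z]
    by (simp_all add: Basis_real_pair inner_prod_def)
  have \<Psi>_bound: "pser ?z \<rho> r (\<Psi> f)" if f: "pser ?z \<rho> r f" for f
  proof -
    have f1: "pser ?z \<rho> 1 f" using f r by (auto intro: pser_mono)
    have *: "pser ?z \<rho> (\<rho> * MA + \<rho> * MB + r * r * MC) (\<Psi> f)"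
      unfolding \<Psi>_def by (intro pser_add pser_mult coord A(3) B(3) C(3) f f1)
    have "\<rho> * MA + \<rho> * MB \<le> r / 4"
      using \<rho>_sum nn by linarith
    moreover have "r * (r * MC) \<le> r * (1 / 8)"
      using r r_sum nn by (intro mult_left_mono) linarith+
    ultimately have "\<rho> * MA + \<rho> * MB + r * r * MC \<le> r" using r(1) unfolding mult.assoc[of r r MC] by linarith
    with * show ?thesis by (rule pser_mono)
  qed
  have \<Psi>_lip: "pser ?z \<rho> (\<delta> / 2) (\<lambda>z. \<Psi> f z - \<Psi> g z)"
    if f: "pser ?z \<rho> r f" and g: "pser ?z \<rho> r g" and d: "pser ?z \<rho> \<delta> (\<lambda>z. f z - g z)" for f g \<delta>
  proof -
    have f1: "pser ?z \<rho> 1 f" and g1: "pser ?z \<rho> 1 g" using f g r by (auto intro: pser_mono)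
    have \<delta>: "\<delta> \<ge> 0" using d by (rule pser_nonneg)
    have "pser ?z \<rho> (\<rho> * (LA * \<delta>) + \<rho> * (LB * \<delta>) + (\<delta> * (r + r) * MC + r * r * (LC * \<delta>)))
      (\<lambda>z. (fst z - x0) * (poly A (f z) - poly A (g z)) + (snd z - y0) * (poly B (f z) - poly B (g z))
        + ((f z - g z) * (f z + g z) * poly C (f z) + g z * g z * (poly C (f z) - poly C (g z))))"
      by (intro pser_add pser_mult coord A(4) B(4) C(3,4) f f1 g g1 d)
    then have 1: "pser ?z \<rho> (\<rho> * (LA * \<delta>) + \<rho> * (LB * \<delta>) + (\<delta> * (r + r) * MC + r * r * (LC * \<delta>))) (\<lambda>z. \<Psi> f z - \<Psi> g z)"
      by (rule pser_cong) (simp add: \<Psi>_def algebra_simps)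
    have a: "\<rho> * LA + \<rho> * LB \<le> 1 / 4"
      using \<rho>_sum r(2) nn by linarith
    have "r * (r * LC) \<le> 1 * (r * LC)" using r C by (intro mult_right_mono) auto
    then have b: "(r + r) * MC + r * (r * LC) \<le> 1 / 4"
      using r_sum nn unfolding distrib_right by linarith
    have "\<rho> * (LA * \<delta>) + \<rho> * (LB * \<delta>) + (\<delta> * (r + r) * MC + r * r * (LC * \<delta>))
        = (\<rho> * LA + \<rho> * LB + ((r + r) * MC + r * (r * LC))) * \<delta>" by (simp add: algebra_simps)
    also have "\<dots> \<le> 1 / 2 * \<delta>" using a b \<delta> by (intro mult_right_mono) auto
    finally show ?thesis using 1 by (auto intro: pser_mono)
  qed
  define S where "S n = (\<Psi> ^^ n) (\<lambda>_. 0)" for n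
  have S: "pser ?z \<rho> r (S n)" for n
  proof (induction n)
    case 0 show ?case using pser_const[OF \<rho>(1), of ?z 0] r by (auto simp: S_def intro: pser_mono)
  qed (auto simp: S_def intro: \<Psi>_bound)
  have S_Suc: "S (Suc n) = \<Psi> (S n)" for n by (simp add: S_def)
  have D: "pser ?z \<rho> (r * (1 / 2) ^ n) (\<lambda>z. S (Suc n) z - S n z)" for n
  proof (induction n)
    case 0 show ?case using S[of 1] by (simp add: S_def)
  next
    case (Suc n)
    from \<Psi>_lip[OF S S Suc] show ?case by (simp add: S_Suc)
  qed
  \<comment> \<open>The limit of the iteration as a telescoping series: successive differences have
    norm at most \<open>r, r/2, r/4, ...\<close>, so \<open>pser_infsum\<close> yields analyticity
    with norm at most \<open>2 * r\<close>.\<close>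
  define T where "T z = (\<Sum>n. S (Suc n) z - S n z)" for z
  have gs: "(\<lambda>n. r * (1 / 2) ^ n) sums (2 * r)"
    using sums_mult[OF geometric_sums[of "1 / 2 :: real"], of r] by (simp add: mult.commute)
  have T_sum: "((\<lambda>n. S (Suc n) z - S n z) has_sum T z) UNIV" and T_lim: "(\<lambda>n. S n z) \<longlonglongrightarrow> T z"
    if z: "z \<in> pbox ?z \<rho>" for z
  proof -
    have "summable (\<lambda>n. norm (S (Suc n) z - S n z))"
      by (rule summable_comparison_test'[OF sums_summable[OF gs]]) (use pser_bound[OF D z] in auto)
    from norm_summable_imp_has_sum[OF this summable_sums[OF summable_norm_cancel[OF this]]]
    show "((\<lambda>n. S (Suc n) z - S n z) has_sum T z) UNIV" unfolding T_def .
    then have "(\<lambda>n. S (Suc n) z - S n z) sums T z" by (rule has_sum_imp_sums)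
    then have "(\<lambda>n. S n z - S 0 z) \<longlonglongrightarrow> T z"
      using sum_lessThan_telescope[of "\<lambda>n. S n z"] by (simp add: sums_def)
    then show "(\<lambda>n. S n z) \<longlonglongrightarrow> T z" by (simp add: S_def)
  qed
  have T: "pser ?z \<rho> (2 * r) T"
  proof (rule pser_infsum[where X=UNIV and N="\<lambda>n. r * (1 / 2) ^ n" and f="\<lambda>n z. S (Suc n) z - S n z"])
    show "((\<lambda>n. r * (1 / 2) ^ n) has_sum 2 * r) UNIV"
      using gs r(1) by (intro norm_summable_imp_has_sum) (auto simp: sums_iff)
  qed (use D T_sum \<rho> in auto)
  \<comment> \<open>The values inherit the sharper bound \<open>r\<close> of the iterates, needed to
    apply the contraction estimate to them.\<close>
  have T_le: "\<bar>T z\<bar> \<le> r" if z: "z \<in> pbox ?z \<rho>" for z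
    using tendsto_rabs[OF T_lim[OF z]] by (rule LIMSEQ_le_const2) (use pser_bound[OF S z] in auto)
  have T_eq: "\<Psi> T z = T z" if z: "z \<in> pbox ?z \<rho>" for z
  proof -
    have "(\<lambda>n. \<Psi> (S n) z) \<longlonglongrightarrow> \<Psi> T z"
      unfolding \<Psi>_def by (intro tendsto_intros T_lim z)
    moreover have "(\<lambda>n. \<Psi> (S n) z) \<longlonglongrightarrow> T z"
      using LIMSEQ_Suc[OF T_lim[OF z]] by (simp add: S_Suc)
    ultimately show ?thesis by (rule LIMSEQ_unique)
  qed
  show ?thesis
  proof (rule that[OF \<rho>(1) r(1) T])
    show "\<bar>T (x, y)\<bar> \<le> r" if "(x, y) \<in> pbox ?z \<rho>" for x y using T_le that by blast
    fix x y t assume z: "(x, y) \<in> pbox ?z \<rho>" and t: "\<bar>t\<bar> \<le> r"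
    let ?T = "T (x, y)"
    have eqT: "?T = (x - x0) * poly A ?T + (y - y0) * poly B ?T + ?T\<^sup>2 * poly C ?T"
      using T_eq[OF z] by (simp add: \<Psi>_def power2_eq_square)
    have "t = ?T" if eq: "t = (x - x0) * poly A t + (y - y0) * poly B t + t\<^sup>2 * poly C t"
    proof -
      \<comment> \<open>Uniqueness at one point follows from the contraction of series, applied to
        the two numbers as constant series and evaluated at that point.\<close>
      have "pser ?z \<rho> r (\<lambda>_. t)" "pser ?z \<rho> r (\<lambda>_. ?T)" "pser ?z \<rho> \<bar>t - ?T\<bar> (\<lambda>_. t - ?T)"
        using pser_const[OF \<rho>(1)] t T_le[OF z] by (auto intro: pser_mono)
      from pser_bound[OF \<Psi>_lip[OF this] z] have "\<bar>t - ?T\<bar> \<le> \<bar>t - ?T\<bar> / 2"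
        using eq eqT by (simp add: \<Psi>_def power2_eq_square)
      then show ?thesis by simp
    qed
    then show "t = (x - x0) * poly A t + (y - y0) * poly B t + t\<^sup>2 * poly C t \<longleftrightarrow> t = T (x, y)"
      using eqT by auto
  qed
qed

section \<open>Implicit functions and envelopes\<close>

lemma real_analytic_at_poly: "real_analytic_at f z \<Longrightarrow> real_analytic_at (\<lambda>w. poly P (f w)) z"
  by (induction P) (auto intro: real_analytic_at_add real_analytic_at_mult real_analytic_at_const)

lemma has_grad_poly:
  "has_grad f fx fy z \<Longrightarrow>
    has_grad (\<lambda>w. poly P (f w)) (poly (pderiv P) (f z) * fx) (poly (pderiv P) (f z) * fy) z"
  by (erule has_grad_compose_real[OF _ poly_DERIV])

lemma real_analytic_at_isCont: "real_analytic_at f a \<Longrightarrow> isCont f a"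
  by (metis real_analytic_at_differentiable has_derivative_continuous)

text \<open>Freezing \<open>x\<close> and \<open>y\<close> at the base point leaves a polynomial
  with simple root 0, that is \<open>m * t\<close> plus a multiple of \<open>t\<^sup>2\<close>;
  dividing by \<open>- m\<close> gives the fixed point equation. Uniqueness among all small
  \<open>t\<close> is part of the conclusion because it later identifies points with their
  images.\<close>

lemma analytic_implicit_root:
  fixes P0 P1 P2 :: "real poly" and x0 y0 :: real
  assumes root: "poly P0 0 + poly P1 0 * x0 + poly P2 0 * y0 = 0"
    and simple: "poly (pderiv P0) 0 + poly (pderiv P1) 0 * x0 + poly (pderiv P2) 0 * y0 \<noteq> 0"
  obtains \<epsilon> \<delta> T where "\<epsilon> > 0" "\<delta> > 0" "T (x0, y0) = 0"
    "\<And>z. z \<in> ball (x0, y0) \<epsilon> \<Longrightarrow> real_analytic_at T z"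
    "\<And>z. z \<in> ball (x0, y0) \<epsilon> \<Longrightarrow> poly P0 (T z) + poly P1 (T z) * fst z + poly P2 (T z) * snd z = 0"
    "\<And>z t. z \<in> ball (x0, y0) \<epsilon> \<Longrightarrow> \<bar>t\<bar> < \<delta> \<Longrightarrow>
      poly P0 t + poly P1 t * fst z + poly P2 t * snd z = 0 \<Longrightarrow> t = T z"
proof -
  define Q where "Q = P0 + smult x0 P1 + smult y0 P2"
  define m where "m = poly (pderiv P0) 0 + poly (pderiv P1) 0 * x0 + poly (pderiv P2) 0 * y0"
  \<comment> \<open>Stripping two coefficients divides by \<open>t\<^sup>2\<close>; they are the
    value and the derivative at 0.\<close>
  obtain k R where "Q = pCons k R" by (cases Q)
  moreover obtain m' R' where "R = pCons m' R'" by (cases R)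
  ultimately have Q: "Q = pCons k (pCons m' R')" by simp
  have "poly Q 0 = 0" using root by (simp add: Q_def algebra_simps)
  moreover have "poly (pderiv Q) 0 = m" by (simp add: Q_def m_def pderiv_add pderiv_smult algebra_simps)
  ultimately have km: "k = 0" "m' = m" by (simp_all add: Q pderiv_pCons)
  have m: "m \<noteq> 0" using simple by (simp add: m_def)
  have \<Phi>: "poly P0 t + poly P1 t * x + poly P2 t * y = m * t + t\<^sup>2 * poly R' t + (x - x0) * poly P1 t + (y - y0) * poly P2 t" for t x y
  proof -
    have "poly P0 t + poly P1 t * x + poly P2 t * y = poly Q t + (x - x0) * poly P1 t + (y - y0) * poly P2 t"
      by (simp add: Q_def algebra_simps)
    then show ?thesis by (simp add: Q km power2_eq_square algebra_simps)
  qed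
  define s where "s = - (1 / m)"
  have eq: "t = (x - x0) * poly (smult s P1) t + (y - y0) * poly (smult s P2) t + t\<^sup>2 * poly (smult s R') t
      \<longleftrightarrow> poly P0 t + poly P1 t * x + poly P2 t * y = 0" for t x y
  proof -
    have "t - ((x - x0) * poly (smult s P1) t + (y - y0) * poly (smult s P2) t + t\<^sup>2 * poly (smult s R') t)
        = (poly P0 t + poly P1 t * x + poly P2 t * y) / m"
      unfolding \<Phi> using m by (simp add: s_def field_simps)
    then show ?thesis using m by auto
  qed
  obtain \<rho> r T where T: "\<rho> > 0" "r > 0" "pser (x0, y0) \<rho> (2 * r) T"
    "\<And>x y. (x, y) \<in> pbox (x0, y0) \<rho> \<Longrightarrow> \<bar>T (x, y)\<bar> \<le> r"
    "\<And>x y t. (x, y) \<in> pbox (x0, y0) \<rho> \<Longrightarrow> \<bar>t\<bar> \<le> r \<Longrightarrow>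
      t = (x - x0) * poly (smult s P1) t + (y - y0) * poly (smult s P2) t + t\<^sup>2 * poly (smult s R') t \<longleftrightarrow> t = T (x, y)"
    by (rule analytic_fixed_point[of x0 y0 "smult s P1" "smult s P2" "smult s R'"]) (rule that; assumption)
  have "real_analytic_at T (x0, y0)" using T(3) by (auto simp: real_analytic_at_iff_pser)
  then obtain \<epsilon> where \<epsilon>: "\<epsilon> > 0" "\<And>z. z \<in> ball (x0, y0) \<epsilon> \<Longrightarrow> real_analytic_at T z"
    using real_analytic_at_nearby[of T "(x0, y0)"] by (auto simp: eventually_nhds_metric dist_commute)
  have sub: "z \<in> pbox (x0, y0) \<rho>" if "z \<in> ball (x0, y0) (min \<epsilon> \<rho>)" for z
    using that ball_subset_pbox[of "(x0, y0)" \<rho>] by auto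
  show ?thesis
  proof (rule that[of "min \<epsilon> \<rho>" r T])
    have "(0::real) = T (x0, y0)"
      using T(5)[of x0 y0 0] center_in_pbox[of \<rho> "(x0, y0)"] T(1,2) by simp
    then show "T (x0, y0) = 0" by simp
    fix z assume z: "z \<in> ball (x0, y0) (min \<epsilon> \<rho>)"
    then show "real_analytic_at T z" using \<epsilon>(2) by simp
    have zb: "(fst z, snd z) \<in> pbox (x0, y0) \<rho>" using sub[OF z] by simp
    show "poly P0 (T z) + poly P1 (T z) * fst z + poly P2 (T z) * snd z = 0"
      using T(5)[OF zb T(4)[OF zb]] unfolding eq by simp
    fix t assume t: "\<bar>t\<bar> < r" "poly P0 t + poly P1 t * fst z + poly P2 t * snd z = 0"
    then show "t = T z" using T(5)[OF zb, of t] unfolding eq by simp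
  qed (use T \<epsilon> in auto)
qed

text \<open>The point \<open>(x, y, u)\<close> lies on the characteristic line with parameter
  \<open>t\<close> of the family of planes \<open>n \<cdot> P = m\<close>. These lines sweep out the
  envelope.\<close>

definition on_envelope :: "real poly \<Rightarrow> real poly \<Rightarrow> real poly \<Rightarrow> real poly \<Rightarrow> real \<Rightarrow> real \<Rightarrow> real \<Rightarrow> real \<Rightarrow> bool" where
  "on_envelope n1 n2 n3 m t x y u \<longleftrightarrow>
     poly n1 t * x + poly n2 t * y + poly n3 t * u = poly m t \<and>
     poly (pderiv n1) t * x + poly (pderiv n2) t * y + poly (pderiv n3) t * u = poly (pderiv m) t"

text \<open>Eliminating \<open>u\<close> from the equations of the plane and of its derivative leaves an equation linear in
  \<open>x\<close> and \<open>y\<close>. The last factor is its \<open>t\<close>-derivative at \<open>t = 0\<close>; the second one makes \<open>u\<^sub>x\<^sub>x\<close> nonzero.\<close>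

definition regularity :: "real poly \<Rightarrow> real poly \<Rightarrow> real poly \<Rightarrow> real poly \<Rightarrow> real \<Rightarrow> real \<Rightarrow> real" where
  "regularity n1 n2 n3 m x y = poly n3 0 * poly (n3 * pderiv n1 - pderiv n3 * n1) 0 *
     (poly (pderiv (pderiv n3 * m - n3 * pderiv m)) 0
       + poly (pderiv (n3 * pderiv n1 - pderiv n3 * n1)) 0 * x
       + poly (pderiv (n3 * pderiv n2 - pderiv n3 * n2)) 0 * y)"

lemma on_envelope_iff:
  assumes "poly n3 t \<noteq> 0"
  shows "on_envelope n1 n2 n3 m t x y u \<longleftrightarrow>
    u = (poly m t - poly n1 t * x - poly n2 t * y) / poly n3 t \<and>
    poly (pderiv n3 * m - n3 * pderiv m) t + poly (n3 * pderiv n1 - pderiv n3 * n1) t * x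
      + poly (n3 * pderiv n2 - pderiv n3 * n2) t * y = 0"
proof -
  define u' where "u' = (poly m t - poly n1 t * x - poly n2 t * y) / poly n3 t"
  have u': "poly n3 t * u' = poly m t - poly n1 t * x - poly n2 t * y" using assms by (simp add: u'_def)
  have 1: "poly n1 t * x + poly n2 t * y + poly n3 t * u = poly m t \<longleftrightarrow> u = u'"
    using assms by (auto simp: u'_def field_simps)
  have "poly n3 t * (poly (pderiv n1) t * x + poly (pderiv n2) t * y + poly (pderiv n3) t * u' - poly (pderiv m) t)
      = poly (pderiv n3) t * (poly n3 t * u')
        + poly n3 t * (poly (pderiv n1) t * x + poly (pderiv n2) t * y - poly (pderiv m) t)"
    by (simp add: algebra_simps)
  also have "\<dots> = poly (pderiv n3 * m - n3 * pderiv m) t + poly (n3 * pderiv n1 - pderiv n3 * n1) t * x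
      + poly (n3 * pderiv n2 - pderiv n3 * n2) t * y"
    unfolding u' by (simp add: algebra_simps)
  finally have 2: "poly (pderiv n1) t * x + poly (pderiv n2) t * y + poly (pderiv n3) t * u' = poly (pderiv m) t
    \<longleftrightarrow> poly (pderiv n3 * m - n3 * pderiv m) t + poly (n3 * pderiv n1 - pderiv n3 * n1) t * x
      + poly (n3 * pderiv n2 - pderiv n3 * n2) t * y = 0"
    using assms by (metis eq_iff_diff_eq_0 mult_eq_0_iff)
  show ?thesis unfolding on_envelope_def 1 u'_def[symmetric] using 2 by auto
qed

text \<open>The envelope is tangent to its planes, so \<open>u_x\<close> and \<open>u_y\<close> are
  functions of the single parameter \<open>T\<close>. Their gradients are both multiples of that of
  \<open>T\<close>, and the Hessian determinant vanishes.\<close>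

lemma envelope_surface:
  fixes n1 n2 n3 m :: "real poly" and x0 y0 u0 :: real
  assumes on: "on_envelope n1 n2 n3 m 0 x0 y0 u0"
    and reg: "regularity n1 n2 n3 m x0 y0 \<noteq> 0"
  obtains \<epsilon> \<delta> G T where "\<epsilon> > 0" "\<delta> > 0" "developable (ball (x0, y0) \<epsilon>) G" "T (x0, y0) = 0"
    "continuous_on (ball (x0, y0) \<epsilon>) T"
    "\<And>z. z \<in> ball (x0, y0) \<epsilon> \<Longrightarrow> on_envelope n1 n2 n3 m (T z) (fst z) (snd z) (G z)"
    "\<And>z t u. z \<in> ball (x0, y0) \<epsilon> \<Longrightarrow> \<bar>t\<bar> < \<delta> \<Longrightarrow> on_envelope n1 n2 n3 m t (fst z) (snd z) u \<Longrightarrow> t = T z \<and> u = G z"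
    "\<And>z. z \<in> ball (x0, y0) \<epsilon> \<Longrightarrow> partial 1 0 G z = - poly n1 (T z) / poly n3 (T z)"
    "\<And>z. z \<in> ball (x0, y0) \<epsilon> \<Longrightarrow> partial 0 1 G z = - poly n2 (T z) / poly n3 (T z)"
proof -
  let ?z0 = "(x0, y0)"
  define Q0 where "Q0 = pderiv n3 * m - n3 * pderiv m"
  define Q1 where "Q1 = n3 * pderiv n1 - pderiv n3 * n1"
  define Q2 where "Q2 = n3 * pderiv n2 - pderiv n3 * n2"
  have n3: "poly n3 0 \<noteq> 0" and Q1: "poly Q1 0 \<noteq> 0"
    and simple: "poly (pderiv Q0) 0 + poly (pderiv Q1) 0 * x0 + poly (pderiv Q2) 0 * y0 \<noteq> 0"
    using reg unfolding regularity_def Q0_def Q1_def Q2_def by auto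
  note env = on_envelope_iff[of n3 _ n1 n2 m, folded Q0_def Q1_def Q2_def]
  obtain \<epsilon>1 \<delta>1 T where T: "\<epsilon>1 > 0" "\<delta>1 > 0" "T ?z0 = 0"
    "\<And>z. z \<in> ball ?z0 \<epsilon>1 \<Longrightarrow> real_analytic_at T z"
    "\<And>z. z \<in> ball ?z0 \<epsilon>1 \<Longrightarrow> poly Q0 (T z) + poly Q1 (T z) * fst z + poly Q2 (T z) * snd z = 0"
    "\<And>z t. z \<in> ball ?z0 \<epsilon>1 \<Longrightarrow> \<bar>t\<bar> < \<delta>1 \<Longrightarrow> poly Q0 t + poly Q1 t * fst z + poly Q2 t * snd z = 0 \<Longrightarrow> t = T z"
    by (rule analytic_implicit_root[of Q0 Q1 x0 Q2 y0])
       (use on n3 simple in \<open>simp_all add: env\<close>)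
  have "isCont (poly n3) 0" by simp
  then obtain \<delta>2 where \<delta>2: "\<delta>2 > 0" "\<And>t. \<bar>t\<bar> < \<delta>2 \<Longrightarrow> poly n3 t \<noteq> 0"
    using continuous_at_avoid[of 0 "poly n3" 0] n3 by (auto simp: dist_real_def)
  define \<delta> where "\<delta> = min \<delta>1 \<delta>2"
  have \<delta>: "\<delta> > 0" using T \<delta>2 by (simp add: \<delta>_def)
  have "isCont T ?z0" using T(1,4) by (intro real_analytic_at_isCont) auto
  then obtain \<epsilon>2 where \<epsilon>2: "\<epsilon>2 > 0" "\<And>z. dist z ?z0 < \<epsilon>2 \<Longrightarrow> \<bar>T z\<bar> < \<delta>"
    using \<delta> T(3) unfolding continuous_at_eps_delta by (force simp: dist_real_def)
  define B where "B = ball ?z0 (min \<epsilon>1 \<epsilon>2)"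
  have B: "open B" "?z0 \<in> B" using T(1) \<epsilon>2(1) by (simp_all add: B_def)
  have B1: "z \<in> ball ?z0 \<epsilon>1" if "z \<in> B" for z using that by (simp add: B_def)
  have n3T: "poly n3 (T z) \<noteq> 0" if "z \<in> B" for z
    using \<epsilon>2(2)[of z] \<delta>2(2)[of "T z"] that by (auto simp: B_def \<delta>_def dist_commute)
  define G where "G z = (poly m (T z) - poly n1 (T z) * fst z - poly n2 (T z) * snd z) / poly n3 (T z)" for z
  have onG: "on_envelope n1 n2 n3 m (T z) (fst z) (snd z) (G z)" if "z \<in> B" for z
    using T(5)[OF B1[OF that]] by (simp add: env[OF n3T[OF that]] G_def)
  have fst_an: "real_analytic_at fst z" and snd_an: "real_analytic_at snd z" for z :: "real \<times> real"
    by (auto intro!: real_analytic_at_linear linearI)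
  have G_an: "real_analytic_at G z" if "z \<in> B" for z
    unfolding G_def[abs_def]
    by (intro real_analytic_at_divide real_analytic_at_diff real_analytic_at_mult real_analytic_at_poly
          T(4) B1 fst_an snd_an n3T that)
  have gT: "has_grad T (partial_x T z) (partial_y T z) z" if "z \<in> B" for z
    by (rule has_grad_partial[OF T(4)[OF B1[OF that]]])
  have G1: "partial 1 0 G z = - poly n1 (T z) / poly n3 (T z)" "partial 0 1 G z = - poly n2 (T z) / poly n3 (T z)"
    if z: "z \<in> B" for z
  proof -
    let ?Tx = "partial_x T z" and ?Ty = "partial_y T z"
    have 1: "has_grad (\<lambda>w. G w * poly n3 (T w))
        (partial_x G z * poly n3 (T z) + G z * (poly (pderiv n3) (T z) * ?Tx))
        (partial_y G z * poly n3 (T z) + G z * (poly (pderiv n3) (T z) * ?Ty)) z"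
      by (intro has_grad_mult has_grad_partial G_an has_grad_poly gT z)
    have 2: "has_grad (\<lambda>w. poly m (T w) - poly n1 (T w) * fst w - poly n2 (T w) * snd w)
        (poly (pderiv m) (T z) * ?Tx - (poly (pderiv n1) (T z) * ?Tx * fst z + poly n1 (T z) * 1)
          - (poly (pderiv n2) (T z) * ?Tx * snd z + poly n2 (T z) * 0))
        (poly (pderiv m) (T z) * ?Ty - (poly (pderiv n1) (T z) * ?Ty * fst z + poly n1 (T z) * 0)
          - (poly (pderiv n2) (T z) * ?Ty * snd z + poly n2 (T z) * 1)) z"
      by (intro has_grad_diff has_grad_mult has_grad_poly gT z has_grad_fst has_grad_snd)
    have 3: "G w * poly n3 (T w) = poly m (T w) - poly n1 (T w) * fst w - poly n2 (T w) * snd w" if "w \<in> B" for w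
      using n3T[OF that] by (simp add: G_def)
    \<comment> \<open>The second envelope equation removes all terms containing derivatives of
      \<open>T\<close>.\<close>
    have m': "poly (pderiv m) (T z) = poly (pderiv n1) (T z) * fst z + poly (pderiv n2) (T z) * snd z
        + poly (pderiv n3) (T z) * G z"
      using onG[OF z] by (simp add: on_envelope_def)
    have "partial_x G z * poly n3 (T z) = - poly n1 (T z)" "partial_y G z * poly n3 (T z) = - poly n2 (T z)"
      using has_grad_agree[OF 1 2 B(1) z 3] unfolding m' by (simp_all add: algebra_simps)
    then have "partial_x G z = - poly n1 (T z) / poly n3 (T z)" "partial_y G z = - poly n2 (T z) / poly n3 (T z)"
      using n3T[OF z] by (simp_all add: field_simps)
    then show "partial 1 0 G z = - poly n1 (T z) / poly n3 (T z)" "partial 0 1 G z = - poly n2 (T z) / poly n3 (T z)"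
      by (simp_all add: partial_rec(1) partial_rec(2)[of 0, simplified] partial_rec(3)[of 0, simplified])
  qed
  define D where "D p t = (poly p t * poly (pderiv n3) t - poly (pderiv p) t * poly n3 t) / (poly n3 t)\<^sup>2" for p t
  have gq: "has_grad (\<lambda>w. - poly p (T w) / poly n3 (T w)) (D p (T z) * partial_x T z) (D p (T z) * partial_y T z) z"
    if z: "z \<in> B" for z p
  proof -
    have "((\<lambda>t. - poly p t / poly n3 t) has_real_derivative
        (- poly (pderiv p) (T z) * poly n3 (T z) - - poly p (T z) * poly (pderiv n3) (T z))
          / (poly n3 (T z) * poly n3 (T z))) (at (T z))"
      by (intro DERIV_divide DERIV_minus poly_DERIV n3T z)
    then have "((\<lambda>t. - poly p t / poly n3 t) has_real_derivative D p (T z)) (at (T z))"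
      by (simp add: D_def power2_eq_square)
    then show ?thesis by (rule has_grad_compose_real[OF gT[OF z]])
  qed
  have gG1: "has_grad (partial 1 0 G) (D n1 (T z) * partial_x T z) (D n1 (T z) * partial_y T z) z"
    and gG2: "has_grad (partial 0 1 G) (D n2 (T z) * partial_x T z) (D n2 (T z) * partial_y T z) z" if z: "z \<in> B" for z
    by (rule has_grad_cong_open[OF gq[OF z] B(1) z]; simp only: G1)+
  have gG1': "has_grad (partial 1 0 G) (partial 2 0 G z) (partial 1 1 G z) z"
    and gG2': "has_grad (partial 0 1 G) (partial 1 1 G z) (partial 0 2 G z) z" if z: "z \<in> B" for z
    using has_grad_partial_jk[OF B(1) G_an z, of 1 0] has_grad_partial_jk[OF B(1) G_an z, of 0 1]
    by (simp_all add: numeral_2_eq_2)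
  have par: "partial 2 0 G z * partial 0 2 G z - (partial 1 1 G z)\<^sup>2 = 0" if z: "z \<in> B" for z
  proof -
    note e = has_grad_unique[OF gG1[OF z] gG1'[OF z]] has_grad_unique[OF gG2[OF z] gG2'[OF z]]
    have "partial 2 0 G z * partial 0 2 G z = (D n1 (T z) * partial_y T z) * (D n2 (T z) * partial_x T z)"
      by (simp flip: e)
    then show ?thesis unfolding e by (simp add: power2_eq_square)
  qed
  have "has_grad (\<lambda>w. poly Q0 (T w) + poly Q1 (T w) * fst w + poly Q2 (T w) * snd w)
      (poly (pderiv Q0) (T ?z0) * partial_x T ?z0
        + (poly (pderiv Q1) (T ?z0) * partial_x T ?z0 * fst ?z0 + poly Q1 (T ?z0) * 1)
        + (poly (pderiv Q2) (T ?z0) * partial_x T ?z0 * snd ?z0 + poly Q2 (T ?z0) * 0))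
      (poly (pderiv Q0) (T ?z0) * partial_y T ?z0
        + (poly (pderiv Q1) (T ?z0) * partial_y T ?z0 * fst ?z0 + poly Q1 (T ?z0) * 0)
        + (poly (pderiv Q2) (T ?z0) * partial_y T ?z0 * snd ?z0 + poly Q2 (T ?z0) * 1)) ?z0"
    by (intro has_grad_add has_grad_mult has_grad_poly gT B has_grad_fst has_grad_snd)
  moreover have "has_grad (\<lambda>w. poly Q0 (T w) + poly Q1 (T w) * fst w + poly Q2 (T w) * snd w) 0 0 ?z0"
    by (rule has_grad_cong_open[OF has_grad_const[of 0] B]) (use T(5) B1 in auto)
  ultimately have "poly (pderiv Q0) 0 * partial_x T ?z0 + (poly (pderiv Q1) 0 * partial_x T ?z0 * x0 + poly Q1 0)
      + poly (pderiv Q2) 0 * partial_x T ?z0 * y0 = 0"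
    using has_grad_unique(1) T(3) by fastforce
  \<comment> \<open>At the base point \<open>u_xx\<close> is \<open>D n1 0\<close> times
    \<open>T_x\<close>, and both factors are nonzero because \<open>Q1\<close> does not vanish at 0;
    continuity extends this to a ball.\<close>
  then have "partial_x T ?z0 \<noteq> 0" using Q1 by auto
  moreover have "D n1 0 \<noteq> 0" using Q1 n3 by (simp add: D_def Q1_def algebra_simps)
  ultimately have "partial 2 0 G ?z0 \<noteq> 0"
    using has_grad_unique(1)[OF gG1[OF B(2)] gG1'[OF B(2)]] T(3) by auto
  moreover have "isCont (partial 2 0 G) ?z0"
    by (rule real_analytic_at_isCont[OF real_analytic_at_partial_jk[OF G_an[OF B(2)]]])
  ultimately obtain \<epsilon>3 where \<epsilon>3: "\<epsilon>3 > 0" "\<And>z. dist z ?z0 < \<epsilon>3 \<Longrightarrow> partial 2 0 G z \<noteq> 0"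
    by (metis continuous_at_avoid dist_commute)
  define \<epsilon> where "\<epsilon> = min \<epsilon>3 (min \<epsilon>1 \<epsilon>2)"
  have inB: "z \<in> B" if "z \<in> ball ?z0 \<epsilon>" for z using that by (simp add: B_def \<epsilon>_def)
  show ?thesis
  proof (rule that[of \<epsilon> \<delta> G T])
    show "\<epsilon> > 0" using \<epsilon>3 \<epsilon>2 T by (simp add: \<epsilon>_def)
    show "developable (ball ?z0 \<epsilon>) G"
      using inB G_an par \<epsilon>3(2) by (auto simp: developable_def real_analytic_on_def \<epsilon>_def dist_commute)
    show "continuous_on (ball ?z0 \<epsilon>) T"
      using inB B1 T(4) by (intro continuous_at_imp_continuous_on ballI real_analytic_at_isCont) auto
    fix z assume z: "z \<in> ball ?z0 \<epsilon>"
    show "on_envelope n1 n2 n3 m (T z) (fst z) (snd z) (G z)" by (rule onG[OF inB[OF z]])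
    show "partial 1 0 G z = - poly n1 (T z) / poly n3 (T z)" "partial 0 1 G z = - poly n2 (T z) / poly n3 (T z)"
      by (rule G1[OF inB[OF z]])+
    fix t u assume t: "\<bar>t\<bar> < \<delta>" and e: "on_envelope n1 n2 n3 m t (fst z) (snd z) u"
    have "poly n3 t \<noteq> 0" using t \<delta>2(2) by (simp add: \<delta>_def)
    then have u: "u = (poly m t - poly n1 t * fst z - poly n2 t * snd z) / poly n3 t"
      and "poly Q0 t + poly Q1 t * fst z + poly Q2 t * snd z = 0"
      using e by (simp_all add: env)
    then have "t = T z" using T(6)[OF B1[OF inB[OF z]], of t] t by (simp add: \<delta>_def)
    then show "t = T z \<and> u = G z" using u by (simp add: G_def)
  qed (use \<delta> T(3) in auto)
qed

section \<open>Surfaces with prescribed fourth order jet\<close>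


lemma partial_x_poly:
  assumes "\<And>x. \<bar>x - x0\<bar> < r \<Longrightarrow> g (x, y0) = poly P (x - x0)" "\<bar>x - x0\<bar> < r"
  shows "partial_x g (x, y0) = poly (pderiv P) (x - x0)"
proof -
  have "((\<lambda>t. poly P (t - x0)) has_real_derivative poly (pderiv P) (x - x0) * 1) (at x)"
    by (rule DERIV_chain2[of "poly P" _ "\<lambda>t. t - x0"]) (auto intro!: derivative_eq_intros poly_DERIV)
  then have "((\<lambda>t. poly P (t - x0)) has_real_derivative poly (pderiv P) (x - x0)) (at x)" by simp
  moreover have "open {t. \<bar>t - x0\<bar> < r}" by (intro open_Collect_less continuous_intros)
  ultimately have "((\<lambda>t. g (t, y0)) has_real_derivative poly (pderiv P) (x - x0)) (at x)"
    by (rule has_field_derivative_transform_within_open) (use assms in auto)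
  then show ?thesis by (simp add: partial_x_def DERIV_imp_deriv)
qed

locale prescribed_jet =
  fixes x0 y0 u0 p q h a s b c d :: real
  assumes a: "a \<noteq> 0" and s: "s \<noteq> 0"
begin

text \<open>The planes are \<open>u - u0 = n1 (x - x0) + n2 (y - y0) - l\<close> with \<open>n1\<close> the Taylor polynomial of \<open>u\<^sub>x\<close> on the line
  \<open>y = y0\<close>, \<open>n2' = n1' (h + s t + b t\<^sup>2 / 2)\<close> and \<open>l' = t n1'\<close>. Hence the projected ruling with
  parameter \<open>t\<close> passes through \<open>(x0 + t, y0)\<close> with the prescribed slope.\<close>

definition "n1 = [:p, a, c / 2, d / 6:]"
definition "n2 = [:q, a * h, (a * s + c * h) / 2, (a * b / 2 + c * s + d * h / 2) / 3,
  (c * b / 2 + d * s / 2) / 4, d * b / 20:]"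
definition "n3 = [:-1 :: real:]"
definition "m = smult x0 n1 + smult y0 n2 + [:- u0, 0, a / 2, c / 3, d / 8:]"

lemma pderiv_n1: "pderiv n1 = [:a, c, d / 2:]"
  by (simp add: n1_def pderiv_pCons)

lemma pderiv_n2: "pderiv n2 = [:a, c, d / 2:] * [:h, s, b / 2:]"
  by (simp add: n2_def pderiv_pCons field_simps)

lemma pderiv_m: "pderiv m = smult x0 (pderiv n1) + smult y0 (pderiv n2) + [:0, 1:] * pderiv n1"
  by (simp add: m_def pderiv_add pderiv_smult pderiv_n1) (simp add: pderiv_pCons)

lemma pderiv_n3: "pderiv n3 = 0"
  by (simp add: n3_def pderiv_pCons)

lemma on_envelope_base: "on_envelope n1 n2 n3 m 0 x0 y0 u0"
  by (simp add: on_envelope_def pderiv_m pderiv_n3) (simp add: n1_def n2_def n3_def m_def)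

lemma regularity_base: "regularity n1 n2 n3 m x0 y0 \<noteq> 0"
  using a by (simp add: regularity_def n3_def pderiv_n3 pderiv_m pderiv_n1 pderiv_n2 pderiv_pCons
      pderiv_add pderiv_smult pderiv_mult pderiv_minus algebra_simps)

text \<open>On the line \<open>y = y0\<close> the derived equation reduces to
  \<open>n1' * (x - x0 - t) = 0\<close>, so \<open>t = x - x0\<close> solves it.\<close>

lemma on_envelope_line:
  obtains u where "on_envelope n1 n2 n3 m (x - x0) x y0 u"
proof
  show "on_envelope n1 n2 n3 m (x - x0) x y0 (poly n1 (x - x0) * x + poly n2 (x - x0) * y0 - poly m (x - x0))"
    unfolding on_envelope_def pderiv_m pderiv_n3 by (simp add: n3_def algebra_simps)
qed

text \<open>By uniqueness the parameter on the line \<open>y = y0\<close> is \<open>x - x0\<close>,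
  so there \<open>u_x = n1\<close> and \<open>u_y = n2\<close> are polynomials in
  \<open>x - x0\<close>. The remaining jet coordinates are \<open>x\<close>-derivatives of these two
  and can be read off on this line.\<close>

lemma jet_envelope:
  assumes "\<epsilon> > 0" "\<delta> > 0" and dev: "developable (ball (x0, y0) \<epsilon>) F"
    and uniq: "\<And>z t u. z \<in> ball (x0, y0) \<epsilon> \<Longrightarrow> \<bar>t\<bar> < \<delta> \<Longrightarrow> on_envelope n1 n2 n3 m t (fst z) (snd z) u \<Longrightarrow> t = T z \<and> u = F z"
    and F10: "\<And>z. z \<in> ball (x0, y0) \<epsilon> \<Longrightarrow> partial 1 0 F z = - poly n1 (T z) / poly n3 (T z)"
    and F01: "\<And>z. z \<in> ball (x0, y0) \<epsilon> \<Longrightarrow> partial 0 1 F z = - poly n2 (T z) / poly n3 (T z)"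
  shows "jet F (x0, y0) = jet_of x0 y0 u0 p q h a s b c d"
proof -
  define r where "r = min \<epsilon> \<delta>"
  have r: "r > 0" using assms(1,2) by (simp add: r_def)
  have line: "(x, y0) \<in> ball (x0, y0) \<epsilon>" "T (x, y0) = x - x0" if "\<bar>x - x0\<bar> < r" for x
  proof -
    show z: "(x, y0) \<in> ball (x0, y0) \<epsilon>" using that by (simp add: r_def dist_Pair_Pair dist_real_def abs_minus_commute)
    obtain u where "on_envelope n1 n2 n3 m (x - x0) x y0 u" by (rule on_envelope_line)
    then show "T (x, y0) = x - x0" using uniq[OF z, of "x - x0" u] that by (simp add: r_def)
  qed
  have 1: "partial 1 0 F (x, y0) = poly n1 (x - x0)" if "\<bar>x - x0\<bar> < r" for x
    using F10[OF line(1)[OF that]] line(2)[OF that] by (simp add: n3_def)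
  have 2: "partial 2 0 F (x, y0) = poly (pderiv n1) (x - x0)" if "\<bar>x - x0\<bar> < r" for x
    using partial_x_poly[OF 1 that] by (simp add: eval_nat_numeral partial_rec(2))
  have 3: "partial 3 0 F (x, y0) = poly (pderiv (pderiv n1)) (x - x0)" if "\<bar>x - x0\<bar> < r" for x
    using partial_x_poly[OF 2 that] by (simp add: eval_nat_numeral partial_rec(2))
  have 4: "partial 4 0 F (x, y0) = poly (pderiv (pderiv (pderiv n1))) (x - x0)" if "\<bar>x - x0\<bar> < r" for x
    using partial_x_poly[OF 3 that] by (simp add: eval_nat_numeral partial_rec(2))
  have k0: "partial 0 1 F (x, y0) = poly n2 (x - x0)" if "\<bar>x - x0\<bar> < r" for x
    using F01[OF line(1)[OF that]] line(2)[OF that] by (simp add: n3_def)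
  have k1: "partial 1 1 F (x, y0) = poly (pderiv n2) (x - x0)" if "\<bar>x - x0\<bar> < r" for x
    using partial_x_poly[OF k0 that] by (simp add: eval_nat_numeral partial_rec(2))
  have k2: "partial 2 1 F (x, y0) = poly (pderiv (pderiv n2)) (x - x0)" if "\<bar>x - x0\<bar> < r" for x
    using partial_x_poly[OF k1 that] by (simp add: eval_nat_numeral partial_rec(2))
  have k3: "partial 3 1 F (x, y0) = poly (pderiv (pderiv (pderiv n2))) (x - x0)" if "\<bar>x - x0\<bar> < r" for x
    using partial_x_poly[OF k2 that] by (simp add: eval_nat_numeral partial_rec(2))
  have "F (x0, y0) = u0"
    using uniq[of "(x0, y0)" 0 u0] on_envelope_base assms(1,2) by simp
  then show ?thesis
    using r by (simp add: jet_def jet_of_def 1 2 3 4 k0 k1 k2 k3 pderiv_n1 pderiv_n2 pderiv_pCons pderiv_mult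
        del: One_nat_def)
      (simp add: n1_def n2_def algebra_simps)
qed

end

text \<open>The affine map \<open>P \<mapsto> A P + b\<close> acts on planes \<open>n \<cdot> P = m\<close> by \<open>n \<mapsto> A\<^bsup>-T\<^esup> n\<close>,
  \<open>m \<mapsto> m + n \<cdot> b\<close>; for determinant 1 the entries of \<open>A\<^bsup>-1\<^esup>\<close> are the cofactors below, so that everything
  depends continuously on the map.\<close>

definition dual1 :: "(real^3^3) \<times> (real^3) \<Rightarrow> real poly \<Rightarrow> real poly \<Rightarrow> real poly \<Rightarrow> real poly" where
  "dual1 g n1 n2 n3 =
     smult (fst g $ 2 $ 2 * fst g $ 3 $ 3 - fst g $ 2 $ 3 * fst g $ 3 $ 2) n1
   + smult (fst g $ 2 $ 3 * fst g $ 3 $ 1 - fst g $ 2 $ 1 * fst g $ 3 $ 3) n2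
   + smult (fst g $ 2 $ 1 * fst g $ 3 $ 2 - fst g $ 2 $ 2 * fst g $ 3 $ 1) n3"

definition dual2 :: "(real^3^3) \<times> (real^3) \<Rightarrow> real poly \<Rightarrow> real poly \<Rightarrow> real poly \<Rightarrow> real poly" where
  "dual2 g n1 n2 n3 =
     smult (fst g $ 1 $ 3 * fst g $ 3 $ 2 - fst g $ 1 $ 2 * fst g $ 3 $ 3) n1
   + smult (fst g $ 1 $ 1 * fst g $ 3 $ 3 - fst g $ 1 $ 3 * fst g $ 3 $ 1) n2
   + smult (fst g $ 1 $ 2 * fst g $ 3 $ 1 - fst g $ 1 $ 1 * fst g $ 3 $ 2) n3"

definition dual3 :: "(real^3^3) \<times> (real^3) \<Rightarrow> real poly \<Rightarrow> real poly \<Rightarrow> real poly \<Rightarrow> real poly" where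
  "dual3 g n1 n2 n3 =
     smult (fst g $ 1 $ 2 * fst g $ 2 $ 3 - fst g $ 1 $ 3 * fst g $ 2 $ 2) n1
   + smult (fst g $ 1 $ 3 * fst g $ 2 $ 1 - fst g $ 1 $ 1 * fst g $ 2 $ 3) n2
   + smult (fst g $ 1 $ 1 * fst g $ 2 $ 2 - fst g $ 1 $ 2 * fst g $ 2 $ 1) n3"

definition dualm :: "(real^3^3) \<times> (real^3) \<Rightarrow> real poly \<Rightarrow> real poly \<Rightarrow> real poly \<Rightarrow> real poly \<Rightarrow> real poly" where
  "dualm g n1 n2 n3 m = m + smult (snd g $ 1) (dual1 g n1 n2 n3) + smult (snd g $ 2) (dual2 g n1 n2 n3)
     + smult (snd g $ 3) (dual3 g n1 n2 n3)"

text \<open>By the cofactor identity the transformed normal applied to \<open>A P\<close> is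
  \<open>det A\<close> times the original normal applied to \<open>P\<close>. The action on normals
  is linear with coefficients free of \<open>t\<close>, so it commutes with \<open>pderiv\<close>
  and both envelope equations are treated alike.\<close>

lemma on_envelope_dual:
  assumes "g \<in> SA3"
  shows "on_envelope (dual1 g n1 n2 n3) (dual2 g n1 n2 n3) (dual3 g n1 n2 n3) (dualm g n1 n2 n3 m) t
      (affine_act g P $ 1) (affine_act g P $ 2) (affine_act g P $ 3)
    \<longleftrightarrow> on_envelope n1 n2 n3 m t (P $ 1) (P $ 2) (P $ 3)"
proof -
  have det: "fst g $ 1 $ 1 * (fst g $ 2 $ 2 * fst g $ 3 $ 3 - fst g $ 2 $ 3 * fst g $ 3 $ 2)
      - fst g $ 1 $ 2 * (fst g $ 2 $ 1 * fst g $ 3 $ 3 - fst g $ 2 $ 3 * fst g $ 3 $ 1)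
      + fst g $ 1 $ 3 * (fst g $ 2 $ 1 * fst g $ 3 $ 2 - fst g $ 2 $ 2 * fst g $ 3 $ 1) = 1"
    using assms by (auto simp: SA3_def det_3 algebra_simps)
  have id: "(A22 * A33 - A23 * A32) * k1 + (A23 * A31 - A21 * A33) * k2 + (A21 * A32 - A22 * A31) * k3 = N1 \<Longrightarrow>
     (A13 * A32 - A12 * A33) * k1 + (A11 * A33 - A13 * A31) * k2 + (A12 * A31 - A11 * A32) * k3 = N2 \<Longrightarrow>
     (A12 * A23 - A13 * A22) * k1 + (A13 * A21 - A11 * A23) * k2 + (A11 * A22 - A12 * A21) * k3 = N3 \<Longrightarrow>
     A11 * (A22 * A33 - A23 * A32) - A12 * (A21 * A33 - A23 * A31) + A13 * (A21 * A32 - A22 * A31) = 1 \<Longrightarrow>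
     (N1 * (A11 * P1 + A12 * P2 + A13 * P3 + B1) + N2 * (A21 * P1 + A22 * P2 + A23 * P3 + B2)
      + N3 * (A31 * P1 + A32 * P2 + A33 * P3 + B3) = k + B1 * N1 + B2 * N2 + B3 * N3)
      = (k1 * P1 + k2 * P2 + k3 * P3 = k)"
    for A11 A12 A13 A21 A22 A23 A31 A32 A33 B1 B2 B3 P1 P2 P3 k k1 k2 k3 N1 N2 N3 :: real
  proof -
    assume N: "(A22 * A33 - A23 * A32) * k1 + (A23 * A31 - A21 * A33) * k2 + (A21 * A32 - A22 * A31) * k3 = N1"
      "(A13 * A32 - A12 * A33) * k1 + (A11 * A33 - A13 * A31) * k2 + (A12 * A31 - A11 * A32) * k3 = N2"
      "(A12 * A23 - A13 * A22) * k1 + (A13 * A21 - A11 * A23) * k2 + (A11 * A22 - A12 * A21) * k3 = N3"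
      and D: "A11 * (A22 * A33 - A23 * A32) - A12 * (A21 * A33 - A23 * A31) + A13 * (A21 * A32 - A22 * A31) = 1"
    have "N1 * (A11 * P1 + A12 * P2 + A13 * P3) + N2 * (A21 * P1 + A22 * P2 + A23 * P3) + N3 * (A31 * P1 + A32 * P2 + A33 * P3)
      = (A11 * (A22 * A33 - A23 * A32) - A12 * (A21 * A33 - A23 * A31) + A13 * (A21 * A32 - A22 * A31)) * (k1 * P1 + k2 * P2 + k3 * P3)"
      unfolding N[symmetric] by algebra
    then have "N1 * (A11 * P1 + A12 * P2 + A13 * P3) + N2 * (A21 * P1 + A22 * P2 + A23 * P3) + N3 * (A31 * P1 + A32 * P2 + A33 * P3)
      = k1 * P1 + k2 * P2 + k3 * P3" by (simp add: D)
    moreover have "N1 * (A11 * P1 + A12 * P2 + A13 * P3 + B1) + N2 * (A21 * P1 + A22 * P2 + A23 * P3 + B2)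
      + N3 * (A31 * P1 + A32 * P2 + A33 * P3 + B3) = (N1 * (A11 * P1 + A12 * P2 + A13 * P3)
        + N2 * (A21 * P1 + A22 * P2 + A23 * P3) + N3 * (A31 * P1 + A32 * P2 + A33 * P3)) + B1 * N1 + B2 * N2 + B3 * N3"
      by algebra
    ultimately show ?thesis by simp
  qed
  have act: "affine_act g P $ 1 = fst g $ 1 $ 1 * P $ 1 + fst g $ 1 $ 2 * P $ 2 + fst g $ 1 $ 3 * P $ 3 + snd g $ 1"
    "affine_act g P $ 2 = fst g $ 2 $ 1 * P $ 1 + fst g $ 2 $ 2 * P $ 2 + fst g $ 2 $ 3 * P $ 3 + snd g $ 2"
    "affine_act g P $ 3 = fst g $ 3 $ 1 * P $ 1 + fst g $ 3 $ 2 * P $ 2 + fst g $ 3 $ 3 * P $ 3 + snd g $ 3"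
    by (simp_all add: affine_act_def matrix_vector_mult_def sum_3)
  have 1:
    "(fst g $ 2 $ 2 * fst g $ 3 $ 3 - fst g $ 2 $ 3 * fst g $ 3 $ 2) * poly l1 t
      + (fst g $ 2 $ 3 * fst g $ 3 $ 1 - fst g $ 2 $ 1 * fst g $ 3 $ 3) * poly l2 t
      + (fst g $ 2 $ 1 * fst g $ 3 $ 2 - fst g $ 2 $ 2 * fst g $ 3 $ 1) * poly l3 t = poly (dual1 g l1 l2 l3) t"
    "(fst g $ 1 $ 3 * fst g $ 3 $ 2 - fst g $ 1 $ 2 * fst g $ 3 $ 3) * poly l1 t
      + (fst g $ 1 $ 1 * fst g $ 3 $ 3 - fst g $ 1 $ 3 * fst g $ 3 $ 1) * poly l2 t
      + (fst g $ 1 $ 2 * fst g $ 3 $ 1 - fst g $ 1 $ 1 * fst g $ 3 $ 2) * poly l3 t = poly (dual2 g l1 l2 l3) t"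
    "(fst g $ 1 $ 2 * fst g $ 2 $ 3 - fst g $ 1 $ 3 * fst g $ 2 $ 2) * poly l1 t
      + (fst g $ 1 $ 3 * fst g $ 2 $ 1 - fst g $ 1 $ 1 * fst g $ 2 $ 3) * poly l2 t
      + (fst g $ 1 $ 1 * fst g $ 2 $ 2 - fst g $ 1 $ 2 * fst g $ 2 $ 1) * poly l3 t = poly (dual3 g l1 l2 l3) t"
    for l1 l2 l3 by (simp_all add: dual1_def dual2_def dual3_def)
  have pd: "pderiv (dual1 g n1 n2 n3) = dual1 g (pderiv n1) (pderiv n2) (pderiv n3)"
    "pderiv (dual2 g n1 n2 n3) = dual2 g (pderiv n1) (pderiv n2) (pderiv n3)"
    "pderiv (dual3 g n1 n2 n3) = dual3 g (pderiv n1) (pderiv n2) (pderiv n3)"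
    by (simp_all add: dual1_def dual2_def dual3_def pderiv_add pderiv_smult)
  have 2: "poly (dualm g n1 n2 n3 m) t = poly m t + snd g $ 1 * poly (dual1 g n1 n2 n3) t
      + snd g $ 2 * poly (dual2 g n1 n2 n3) t + snd g $ 3 * poly (dual3 g n1 n2 n3) t"
    "poly (pderiv (dualm g n1 n2 n3 m)) t = poly (pderiv m) t + snd g $ 1 * poly (pderiv (dual1 g n1 n2 n3)) t
      + snd g $ 2 * poly (pderiv (dual2 g n1 n2 n3)) t + snd g $ 3 * poly (pderiv (dual3 g n1 n2 n3)) t"
    by (simp_all add: dualm_def pderiv_add pderiv_smult)
  show ?thesis
    unfolding on_envelope_def act 2 pd
    by (simp only: id[OF 1 det])
qed

section \<open>Realization of a jet together with its image\<close>

lemma developable_subset: "developable U F \<Longrightarrow> open U' \<Longrightarrow> U' \<subseteq> U \<Longrightarrow> developable U' F"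
  by (auto simp: developable_def real_analytic_on_def)

lemma affine_act_inverse:
  assumes "g \<in> SA3"
  obtains B where "\<And>P. B *v (affine_act g P - snd g) = P" "\<And>Q. affine_act g (B *v (Q - snd g)) = Q"
proof -
  have "invertible (fst g)" using assms by (auto simp: SA3_def invertible_det_nz)
  then obtain B where "fst g ** B = mat 1" "B ** fst g = mat 1" by (auto simp: invertible_def)
  then show ?thesis
    by (intro that[of B]) (simp_all add: affine_act_def matrix_vector_mul_assoc)
qed

context prescribed_jet
begin

definition "base_point = (vector [x0, y0, u0] :: real^3)"

text \<open>The regularity condition is a nonvanishing polynomial expression in the entries of
  \<open>g\<close>, nonzero at the identity.\<close>

lemma regularity_dual:
  "\<forall>\<^sub>F g in nhds (mat 1, 0). regularity (dual1 g n1 n2 n3) (dual2 g n1 n2 n3) (dual3 g n1 n2 n3)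
     (dualm g n1 n2 n3 m) (affine_act g base_point $ 1) (affine_act g base_point $ 2) \<noteq> 0"
proof -
  let ?I = "(mat 1, 0) :: (real^3^3) \<times> (real^3)"
  let ?r = "\<lambda>g. regularity (dual1 g n1 n2 n3) (dual2 g n1 n2 n3) (dual3 g n1 n2 n3)
     (dualm g n1 n2 n3 m) (affine_act g base_point $ 1) (affine_act g base_point $ 2)"
  have "dual1 ?I n1 n2 n3 = n1" "dual2 ?I n1 n2 n3 = n2" "dual3 ?I n1 n2 n3 = n3" "dualm ?I n1 n2 n3 m = m"
    by (simp_all add: dual1_def dual2_def dual3_def dualm_def mat_def)
  moreover have "affine_act ?I base_point = base_point" by (simp add: affine_act_def)
  ultimately have "?r ?I \<noteq> 0" using regularity_base by (simp add: base_point_def)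
  moreover have "isCont ?r ?I"
    unfolding regularity_def dual1_def dual2_def dual3_def dualm_def affine_act_def matrix_vector_mult_def sum_3
      pderiv_add pderiv_smult pderiv_mult pderiv_diff poly_add poly_smult poly_mult poly_diff
      vector_add_component vec_lambda_beta
    by (intro continuous_intros)
  ultimately show ?thesis
    using continuous_at_avoid[of ?I ?r 0] by (auto simp: eventually_nhds_metric dist_commute)
qed

text \<open>A plane and its image carry the same parameter. A point of the first envelope is mapped
  to a point satisfying the equations of the second one with this parameter, and local uniqueness
  puts it on the graph of \<open>G\<close>; the inverse map is treated in the same way.\<close>

lemma realization:
  "\<forall>\<^sub>F g in nhds (mat 1, 0). g \<in> SA3 \<longrightarrow> (\<exists>U F V G. parabolic_surface U F \<and> parabolic_surface V G \<and>
     affine_act g ` graph_point F ` U = graph_point G ` V \<and>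
     (x0, y0) \<in> U \<and> jet F (x0, y0) = jet_of x0 y0 u0 p q h a s b c d)"
  using regularity_dual
proof eventually_elim
  fix g :: "(real^3^3) \<times> (real^3)"
  define k1 k2 k3 k where "k1 = dual1 g n1 n2 n3" and "k2 = dual2 g n1 n2 n3" and "k3 = dual3 g n1 n2 n3"
    and "k = dualm g n1 n2 n3 m"
  define Q where "Q = affine_act g base_point"
  assume "regularity (dual1 g n1 n2 n3) (dual2 g n1 n2 n3) (dual3 g n1 n2 n3)
     (dualm g n1 n2 n3 m) (affine_act g base_point $ 1) (affine_act g base_point $ 2) \<noteq> 0"
  note reg = this[folded k1_def k2_def k3_def k_def Q_def]
  show "g \<in> SA3 \<longrightarrow> (\<exists>U F V G. parabolic_surface U F \<and> parabolic_surface V G \<and>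
     affine_act g ` graph_point F ` U = graph_point G ` V \<and>
     (x0, y0) \<in> U \<and> jet F (x0, y0) = jet_of x0 y0 u0 p q h a s b c d)"
  proof
    assume g: "g \<in> SA3"
    note env_g = on_envelope_dual[OF g, of n1 n2 n3 m, folded k1_def k2_def k3_def k_def]
    obtain \<epsilon>1 \<delta>1 F TF where F: "\<epsilon>1 > 0" "\<delta>1 > 0" "developable (ball (x0, y0) \<epsilon>1) F" "TF (x0, y0) = 0"
      "continuous_on (ball (x0, y0) \<epsilon>1) TF"
      "\<And>z. z \<in> ball (x0, y0) \<epsilon>1 \<Longrightarrow> on_envelope n1 n2 n3 m (TF z) (fst z) (snd z) (F z)"
      "\<And>z t u. z \<in> ball (x0, y0) \<epsilon>1 \<Longrightarrow> \<bar>t\<bar> < \<delta>1 \<Longrightarrow> on_envelope n1 n2 n3 m t (fst z) (snd z) u \<Longrightarrow> t = TF z \<and> u = F z"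
      "\<And>z. z \<in> ball (x0, y0) \<epsilon>1 \<Longrightarrow> partial 1 0 F z = - poly n1 (TF z) / poly n3 (TF z)"
      "\<And>z. z \<in> ball (x0, y0) \<epsilon>1 \<Longrightarrow> partial 0 1 F z = - poly n2 (TF z) / poly n3 (TF z)"
      by (rule envelope_surface[OF on_envelope_base regularity_base]) (rule that; assumption)
    have jetF: "jet F (x0, y0) = jet_of x0 y0 u0 p q h a s b c d"
      by (rule jet_envelope[OF F(1,2,3,7,8,9)])
    have z0: "(x0, y0) \<in> ball (x0, y0) \<epsilon>1" using F(1) by simp
    have Fz0: "F (x0, y0) = u0" using jetF by (simp add: jet_def jet_of_def)
    have gp0: "graph_point F (x0, y0) = base_point"
      by (simp add: graph_point_def base_point_def Fz0)
    have "S_fun F (x0, y0) = s"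
    proof -
      have "partial 2 0 F (x0, y0) = a" "partial 1 1 F (x0, y0) = h * a" "partial 3 0 F (x0, y0) = c"
        "partial 2 1 F (x0, y0) = s * a + h * c"
        using jetF by (auto simp: jet_def jet_of_def)
      then show ?thesis using a by (simp add: S_fun_def field_simps power2_eq_square)
    qed
    moreover have "isCont (S_fun F) (x0, y0)"
      by (rule has_grad_continuous[OF structure_equations(6)[OF F(3) z0]])
    ultimately obtain \<epsilon>s where \<epsilon>s: "\<epsilon>s > 0" "\<And>z. dist (x0, y0) z < \<epsilon>s \<Longrightarrow> S_fun F z \<noteq> 0"
      using continuous_at_avoid[of "(x0, y0)" "S_fun F" 0] s by auto
    define BF where "BF = ball (x0, y0) (min \<epsilon>1 \<epsilon>s)"
    have BF1: "z \<in> ball (x0, y0) \<epsilon>1" if "z \<in> BF" for z using that by (simp add: BF_def)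
    have BF_S: "S_fun F z \<noteq> 0" if "z \<in> BF" for z using that \<epsilon>s by (simp add: BF_def)
    have BF_open: "open BF" by (simp add: BF_def)
    have onQ: "on_envelope k1 k2 k3 k 0 (Q $ 1) (Q $ 2) (Q $ 3)"
      unfolding Q_def env_g using on_envelope_base by (simp add: base_point_def)
    obtain \<epsilon>2 \<delta>2 G TG where G: "\<epsilon>2 > 0" "\<delta>2 > 0" "developable (ball (Q $ 1, Q $ 2) \<epsilon>2) G" "TG (Q $ 1, Q $ 2) = 0"
      "continuous_on (ball (Q $ 1, Q $ 2) \<epsilon>2) TG"
      "\<And>z. z \<in> ball (Q $ 1, Q $ 2) \<epsilon>2 \<Longrightarrow> on_envelope k1 k2 k3 k (TG z) (fst z) (snd z) (G z)"
      "\<And>z t u. z \<in> ball (Q $ 1, Q $ 2) \<epsilon>2 \<Longrightarrow> \<bar>t\<bar> < \<delta>2 \<Longrightarrow> on_envelope k1 k2 k3 k t (fst z) (snd z) u \<Longrightarrow> t = TG z \<and> u = G z"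
      "\<And>z. z \<in> ball (Q $ 1, Q $ 2) \<epsilon>2 \<Longrightarrow> partial 1 0 G z = - poly k1 (TG z) / poly k3 (TG z)"
      "\<And>z. z \<in> ball (Q $ 1, Q $ 2) \<epsilon>2 \<Longrightarrow> partial 0 1 G z = - poly k2 (TG z) / poly k3 (TG z)"
      by (rule envelope_surface[OF onQ reg]) (rule that; assumption)
    define BG where "BG = ball (Q $ 1, Q $ 2) \<epsilon>2"
    obtain B where B: "\<And>P. B *v (affine_act g P - snd g) = P" "\<And>Q. affine_act g (B *v (Q - snd g)) = Q"
      using affine_act_inverse[OF g] by blast
    define pr where "pr P = (P $ 1, P $ 2)" for P :: "real^3"
    define \<delta> where "\<delta> = min \<delta>1 \<delta>2"
    have \<delta>: "\<delta> > 0" using F(2) G(2) by (simp add: \<delta>_def)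
    \<comment> \<open>Both domains are cut out by symmetric conditions, with one common bound on the
      parameters. Corresponding points have equal parameters, so the map and its inverse exchange
      \<open>U\<close> and \<open>V\<close> exactly.\<close>
    define U where "U = {w \<in> BF. pr (affine_act g (graph_point F w)) \<in> BG \<and> \<bar>TF w\<bar> < \<delta>}"
    define V where "V = {v \<in> BG. pr (B *v (graph_point G v - snd g)) \<in> BF \<and> \<bar>TG v\<bar> < \<delta>}"
    have gp: "graph_point H w $ 1 = fst w" "graph_point H w $ 2 = snd w" "graph_point H w $ 3 = H w" for H w
      by (simp_all add: graph_point_def)
    have gp_eqI: "P = graph_point H (pr P)" if "P $ 3 = H (pr P)" for P H
      using that by (simp add: vec_eq_iff forall_3 gp pr_def)
    have forward: "affine_act g (graph_point F w) = graph_point G (pr (affine_act g (graph_point F w)))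
        \<and> TG (pr (affine_act g (graph_point F w))) = TF w" if w: "w \<in> U" for w
    proof -
      let ?P = "affine_act g (graph_point F w)"
      have "on_envelope n1 n2 n3 m (TF w) (fst w) (snd w) (F w)"
        using F(6)[OF BF1] w by (simp add: U_def)
      then have "on_envelope k1 k2 k3 k (TF w) (?P $ 1) (?P $ 2) (?P $ 3)"
        unfolding env_g by (simp add: gp)
      then have "TF w = TG (pr ?P) \<and> ?P $ 3 = G (pr ?P)"
        using G(7)[of "pr ?P" "TF w" "?P $ 3"] w by (simp add: U_def BG_def \<delta>_def pr_def)
      then show ?thesis using gp_eqI[of ?P G] by simp
    qed
    have backward: "B *v (graph_point G v - snd g) = graph_point F (pr (B *v (graph_point G v - snd g)))
        \<and> TF (pr (B *v (graph_point G v - snd g))) = TG v" if v: "v \<in> V" for v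
    proof -
      let ?P = "B *v (graph_point G v - snd g)"
      have "on_envelope k1 k2 k3 k (TG v) (fst v) (snd v) (G v)"
        using G(6)[of v] v by (simp add: V_def BG_def)
      then have "on_envelope k1 k2 k3 k (TG v) (affine_act g ?P $ 1) (affine_act g ?P $ 2) (affine_act g ?P $ 3)"
        by (simp add: B(2) gp)
      then have "on_envelope n1 n2 n3 m (TG v) (?P $ 1) (?P $ 2) (?P $ 3)" unfolding env_g .
      then have "TG v = TF (pr ?P) \<and> ?P $ 3 = F (pr ?P)"
        using F(7)[of "pr ?P" "TG v" "?P $ 3"] BF1[of "pr ?P"] v by (simp add: V_def \<delta>_def pr_def)
      then show ?thesis using gp_eqI[of ?P F] by simp
    qed
    have fst_snd: "pr (graph_point H w) = w" for H w by (simp add: pr_def gp)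
    have U_V: "pr (affine_act g (graph_point F w)) \<in> V" if w: "w \<in> U" for w
    proof -
      have "B *v (graph_point G (pr (affine_act g (graph_point F w))) - snd g) = graph_point F w"
        using forward[OF w] B(1) by metis
      then show ?thesis using forward[OF w] w by (simp add: V_def U_def fst_snd)
    qed
    have V_U: "pr (B *v (graph_point G v - snd g)) \<in> U" if v: "v \<in> V" for v
    proof -
      have "affine_act g (graph_point F (pr (B *v (graph_point G v - snd g)))) = graph_point G v"
        using backward[OF v] B(2) by metis
      then show ?thesis using backward[OF v] v by (simp add: V_def U_def fst_snd)
    qed
    have img: "affine_act g ` graph_point F ` U = graph_point G ` V"
    proof
      show "affine_act g ` graph_point F ` U \<subseteq> graph_point G ` V" using forward U_V by blast
      show "graph_point G ` V \<subseteq> affine_act g ` graph_point F ` U"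
      proof
        fix R assume "R \<in> graph_point G ` V"
        then obtain v where v: "v \<in> V" "R = graph_point G v" by blast
        have "R = affine_act g (graph_point F (pr (B *v (graph_point G v - snd g))))"
          using backward[OF v(1)] B(2) v(2) by metis
        then show "R \<in> affine_act g ` graph_point F ` U" using V_U[OF v(1)] by blast
      qed
    qed
    have contF: "continuous_on BF F" and contG: "continuous_on BG G"
      using F(3) G(3) BF1
      by (auto simp: BG_def developable_def real_analytic_on_def intro!: continuous_at_imp_continuous_on real_analytic_at_isCont)
    have contTF: "continuous_on BF TF" using F(5) by (rule continuous_on_subset) (use BF1 in auto)
    have openU: "open U"
    proof -
      have "continuous_on BF (\<lambda>w. (pr (affine_act g (graph_point F w)), TF w))"
        unfolding affine_act_graph_point pr_def by (auto intro!: continuous_intros contF contTF)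
      from continuous_open_preimage[OF this BF_open, of "BG \<times> {- \<delta><..<\<delta>}"]
      have "open (BF \<inter> (\<lambda>w. (pr (affine_act g (graph_point F w)), TF w)) -` (BG \<times> {- \<delta><..<\<delta>}))"
        by (simp add: BG_def open_Times)
      also have "BF \<inter> (\<lambda>w. (pr (affine_act g (graph_point F w)), TF w)) -` (BG \<times> {- \<delta><..<\<delta>}) = U"
        by (auto simp: U_def abs_less_iff)
      finally show ?thesis .
    qed
    have openV: "open V"
    proof -
      have "continuous_on BG (\<lambda>v. (pr (B *v (graph_point G v - snd g)), TG v))"
        unfolding pr_def matrix_vector_mult_def using G(5)
        by (auto simp: sum_3 gp BG_def intro!: continuous_intros contG[unfolded BG_def])
      from continuous_open_preimage[OF this, of "BF \<times> {- \<delta><..<\<delta>}"]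
      have "open (BG \<inter> (\<lambda>v. (pr (B *v (graph_point G v - snd g)), TG v)) -` (BF \<times> {- \<delta><..<\<delta>}))"
        by (simp add: BG_def BF_open open_Times)
      also have "BG \<inter> (\<lambda>v. (pr (B *v (graph_point G v - snd g)), TG v)) -` (BF \<times> {- \<delta><..<\<delta>}) = V"
        by (auto simp: V_def abs_less_iff)
      finally show ?thesis .
    qed
    have devF: "developable U F" by (rule developable_subset[OF F(3) openU]) (use BF1 in \<open>auto simp: U_def\<close>)
    have devG: "developable V G" by (rule developable_subset[OF G(3) openV]) (auto simp: V_def BG_def)
    interpret developable_map U V F G "fst g $ 1 $ 1" "fst g $ 1 $ 2" "fst g $ 1 $ 3"
      "fst g $ 2 $ 1" "fst g $ 2 $ 2" "fst g $ 2 $ 3" "fst g $ 3 $ 1" "fst g $ 3 $ 2" "fst g $ 3 $ 3"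
      "snd g $ 1" "snd g $ 2" "snd g $ 3"
      using g devF devG img by (intro developable_map_affine_act) auto
    have SF: "S_fun F w \<noteq> 0" if "w \<in> U" for w using that BF_S by (simp add: U_def)
    have SG: "S_fun G v \<noteq> 0" if v: "v \<in> V" for v
    proof -
      obtain w where w: "w \<in> U" "affine_act g (graph_point F w) = graph_point G v"
        using img v by (metis imageE imageI)
      then have "v = (X w, Y w)"
        by (simp add: affine_act_graph_point vector_3_eq_graph_point X_def Y_def)
      then show ?thesis using S_fun_transform[OF w(1)] SF[OF w(1)] by auto
    qed
    have "(x0, y0) \<in> U"
      using F(1,4) G(1) \<epsilon>s(1) \<delta> by (simp add: U_def BF_def BG_def gp0 pr_def flip: Q_def)
    moreover have "parabolic_surface U F" "parabolic_surface V G"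
      using devF devG SF SG by (auto simp: parabolic_surface_iff)
    ultimately show "\<exists>U F V G. parabolic_surface U F \<and> parabolic_surface V G \<and>
       affine_act g ` graph_point F ` U = graph_point G ` V \<and>
       (x0, y0) \<in> U \<and> jet F (x0, y0) = jet_of x0 y0 u0 p q h a s b c d"
      using img jetF by blast
  qed
qed

end

section \<open>Differential invariants of fourth order\<close>


type_synonym chart_coords =
  "real \<times> real \<times> real \<times> real \<times> real \<times> real \<times> real \<times> real \<times> real \<times> real"

text \<open>For fixed \<open>w\<close> a parametrization of a level set of \<open>W\<close>: the
  formula for \<open>W\<close> is solved for \<open>h_xx\<close>.\<close>

definition chart :: "real \<Rightarrow> chart_coords \<Rightarrow> jet4" where
  "chart w z = (case z of (x, y, u, p, q, h, a, s, c, d) \<Rightarrow>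
     jet_of x y u p q h a s (w * (root 3 a * (root 3 s)\<^sup>2)) c d)"

definition chart_inv :: "jet4 \<Rightarrow> chart_coords" where
  "chart_inv j = (case j of (x, y, u, p, a, c, d, q, k, l, m) \<Rightarrow>
     (x, y, u, p, q, k / a, a, (a * l - k * c) / a\<^sup>2, c, d))"

lemma chart_inv_jet_of:
  assumes "a \<noteq> 0"
  shows "chart_inv (jet_of x y u p q h a s b c d) = (x, y, u, p, q, h, a, s, c, d)"
  using assms by (simp add: chart_inv_def jet_of_def field_simps power2_eq_square)

lemma jet_of_eq_chart:
  assumes "a \<noteq> 0" "s \<noteq> 0"
  shows "jet_of x y u p q h a s b c d = chart (W (jet_of x y u p q h a s b c d)) (x, y, u, p, q, h, a, s, c, d)"
  using assms by (simp add: chart_def W_jet_of)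

lemma chart_chart_inv: "j \<in> jet_region \<Longrightarrow> chart (W j) (chart_inv j) = j"
  by (erule jet_region_cases) (simp add: chart_inv_jet_of flip: jet_of_eq_chart)

text \<open>Invariance of \<open>W\<close> keeps the image in the same level set, so only ten
  coordinates have to be followed.\<close>

lemma (in developable_map) jet_eq_chart:
  assumes w: "w \<in> U" and S: "S_fun F w \<noteq> 0"
  shows "jet G (X w, Y w) = chart (W (jet F w)) (X w, Y w, Z w, partial 1 0 G (X w, Y w),
    partial 0 1 G (X w, Y w), slope G (X w, Y w), partial 2 0 G (X w, Y w), S_fun G (X w, Y w),
    partial 3 0 G (X w, Y w), partial 4 0 G (X w, Y w))"
proof -
  have "partial 2 0 G (X w, Y w) \<noteq> 0" using dev_G XY_in[OF w] by (auto simp: developable_def)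
  moreover have "S_fun G (X w, Y w) \<noteq> 0" using S S_fun_transform[OF w] by auto
  ultimately show ?thesis
    unfolding W_invariant[OF assms, symmetric] jet_eq_jet_of[OF dev_G XY_in[OF w]]
    by (subst jet_of_eq_chart) (simp_all add: G_XY w)
qed

lemma jet_of_components:
  assumes "developable U F" "w \<in> U" "jet F w = jet_of x y u p q h a s b c d"
  shows "fst w = x" "snd w = y" "F w = u" "partial 1 0 F w = p" "partial 0 1 F w = q" "slope F w = h"
    "partial 2 0 F w = a" "S_fun F w = s" "slope_xx F w = b" "partial 3 0 F w = c" "partial 4 0 F w = d"
proof -
  have a: "partial 2 0 F w \<noteq> 0" using assms by (auto simp: developable_def)
  have e: "jet_of (fst w) (snd w) (F w) (partial 1 0 F w) (partial 0 1 F w) (slope F w)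
    (partial 2 0 F w) (S_fun F w) (slope_xx F w) (partial 3 0 F w) (partial 4 0 F w)
    = jet_of x y u p q h a s b c d" using assms by (simp add: jet_eq_jet_of)
  show "fst w = x" "snd w = y" "F w = u" "partial 1 0 F w = p" "partial 0 1 F w = q"
    and a': "partial 2 0 F w = a" and c: "partial 3 0 F w = c" and d: "partial 4 0 F w = d"
    using e by (auto simp: jet_of_def)
  have "slope F w * a = h * a" using e a' by (auto simp: jet_of_def)
  then show h: "slope F w = h" using a a' by simp
  have "S_fun F w * a + h * c = s * a + h * c" using e a' c h by (auto simp: jet_of_def)
  then show s: "S_fun F w = s" using a a' by simp
  have "slope_xx F w * a + 2 * s * c + h * d = b * a + 2 * s * c + h * d" using e a' c h s d by (auto simp: jet_of_def)
  then show "slope_xx F w = b" using a a' by simp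
qed

section \<open>Families of affine maps and the jets they reach\<close>

definition affine3 :: "real \<Rightarrow> real \<Rightarrow> real \<Rightarrow> real \<Rightarrow> real \<Rightarrow> real \<Rightarrow> real \<Rightarrow> real \<Rightarrow> real \<Rightarrow> real \<Rightarrow> real \<Rightarrow> real
    \<Rightarrow> (real^3^3) \<times> (real^3)" where
  "affine3 m11 m12 m13 m21 m22 m23 m31 m32 m33 b1 b2 b3 =
    (vector [vector [m11, m12, m13], vector [m21, m22, m23], vector [m31, m32, m33]], vector [b1, b2, b3])"

lemma affine3_components [simp]:
  "fst (affine3 m11 m12 m13 m21 m22 m23 m31 m32 m33 b1 b2 b3) $ 1 $ 1 = m11"
  "fst (affine3 m11 m12 m13 m21 m22 m23 m31 m32 m33 b1 b2 b3) $ 1 $ 2 = m12"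
  "fst (affine3 m11 m12 m13 m21 m22 m23 m31 m32 m33 b1 b2 b3) $ 1 $ 3 = m13"
  "fst (affine3 m11 m12 m13 m21 m22 m23 m31 m32 m33 b1 b2 b3) $ 2 $ 1 = m21"
  "fst (affine3 m11 m12 m13 m21 m22 m23 m31 m32 m33 b1 b2 b3) $ 2 $ 2 = m22"
  "fst (affine3 m11 m12 m13 m21 m22 m23 m31 m32 m33 b1 b2 b3) $ 2 $ 3 = m23"
  "fst (affine3 m11 m12 m13 m21 m22 m23 m31 m32 m33 b1 b2 b3) $ 3 $ 1 = m31"
  "fst (affine3 m11 m12 m13 m21 m22 m23 m31 m32 m33 b1 b2 b3) $ 3 $ 2 = m32"
  "fst (affine3 m11 m12 m13 m21 m22 m23 m31 m32 m33 b1 b2 b3) $ 3 $ 3 = m33"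
  "snd (affine3 m11 m12 m13 m21 m22 m23 m31 m32 m33 b1 b2 b3) $ 1 = b1"
  "snd (affine3 m11 m12 m13 m21 m22 m23 m31 m32 m33 b1 b2 b3) $ 2 = b2"
  "snd (affine3 m11 m12 m13 m21 m22 m23 m31 m32 m33 b1 b2 b3) $ 3 = b3"
  by (simp_all add: affine3_def)

lemma affine3_in_SA3:
  "affine3 m11 m12 m13 m21 m22 m23 m31 m32 m33 b1 b2 b3 \<in> SA3 \<longleftrightarrow>
    m11 * (m22 * m33 - m23 * m32) - m12 * (m21 * m33 - m23 * m31) + m13 * (m21 * m32 - m22 * m31) = 1"
  by (simp add: affine3_def SA3_def det_3 algebra_simps)

lemma tendsto_affine3:
  assumes "(m11 \<longlongrightarrow> 1) T" "(m12 \<longlongrightarrow> 0) T" "(m13 \<longlongrightarrow> 0) T" "(m21 \<longlongrightarrow> 0) T" "(m22 \<longlongrightarrow> 1) T"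
    "(m23 \<longlongrightarrow> 0) T" "(m31 \<longlongrightarrow> 0) T" "(m32 \<longlongrightarrow> 0) T" "(m33 \<longlongrightarrow> 1) T"
    "(b1 \<longlongrightarrow> 0) T" "(b2 \<longlongrightarrow> 0) T" "(b3 \<longlongrightarrow> 0) T"
  shows "((\<lambda>t. affine3 (m11 t) (m12 t) (m13 t) (m21 t) (m22 t) (m23 t) (m31 t) (m32 t) (m33 t)
    (b1 t) (b2 t) (b3 t)) \<longlongrightarrow> (mat 1, 0)) T"
proof -
  have "((\<lambda>t. fst (affine3 (m11 t) (m12 t) (m13 t) (m21 t) (m22 t) (m23 t) (m31 t) (m32 t) (m33 t)
    (b1 t) (b2 t) (b3 t)) $ i $ j) \<longlongrightarrow> mat 1 $ i $ j) T" for i j :: 3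
    using assms exhaust_3[of i] exhaust_3[of j] by (auto simp: mat_def)
  moreover have "((\<lambda>t. snd (affine3 (m11 t) (m12 t) (m13 t) (m21 t) (m22 t) (m23 t) (m31 t) (m32 t) (m33 t)
    (b1 t) (b2 t) (b3 t)) $ i) \<longlongrightarrow> 0 $ i) T" for i :: 3
    using assms exhaust_3[of i] by auto
  ultimately have "((\<lambda>t. (fst (affine3 (m11 t) (m12 t) (m13 t) (m21 t) (m22 t) (m23 t) (m31 t) (m32 t) (m33 t)
    (b1 t) (b2 t) (b3 t)), snd (affine3 (m11 t) (m12 t) (m13 t) (m21 t) (m22 t) (m23 t) (m31 t) (m32 t) (m33 t)
    (b1 t) (b2 t) (b3 t)))) \<longlongrightarrow> (mat 1, 0)) T"
    by (intro tendsto_Pair vec_tendstoI)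
  then show ?thesis by simp
qed

text \<open>The image jet is the same for all surfaces with jet \<open>k\<close>. Existence of such
  surfaces is not asserted; \<open>realization\<close> supplies them near the identity.\<close>

definition maps_jet :: "(real^3^3) \<times> (real^3) \<Rightarrow> jet4 \<Rightarrow> jet4 \<Rightarrow> bool" where
  "maps_jet g k k' \<longleftrightarrow> (\<forall>U V F G z.
     developable_map U V F G (fst g $ 1 $ 1) (fst g $ 1 $ 2) (fst g $ 1 $ 3) (fst g $ 2 $ 1) (fst g $ 2 $ 2)
       (fst g $ 2 $ 3) (fst g $ 3 $ 1) (fst g $ 3 $ 2) (fst g $ 3 $ 3) (snd g $ 1) (snd g $ 2) (snd g $ 3) \<longrightarrow>
     z \<in> U \<longrightarrow> jet F z = k \<longrightarrow>
     jet G (developable_map.X F (fst g $ 1 $ 1) (fst g $ 1 $ 2) (fst g $ 1 $ 3) (snd g $ 1) z,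
            developable_map.Y F (fst g $ 2 $ 1) (fst g $ 2 $ 2) (fst g $ 2 $ 3) (snd g $ 2) z) = k')"

lemma maps_jet_affine3I:
  assumes "\<And>U V F G z. developable_map U V F G m11 m12 m13 m21 m22 m23 m31 m32 m33 b1 b2 b3 \<Longrightarrow> z \<in> U \<Longrightarrow> jet F z = k \<Longrightarrow>
    jet G (developable_map.X F m11 m12 m13 b1 z, developable_map.Y F m21 m22 m23 b2 z) = k'"
  shows "maps_jet (affine3 m11 m12 m13 m21 m22 m23 m31 m32 m33 b1 b2 b3) k k'"
  using assms unfolding maps_jet_def affine3_components by blast

text \<open>The bound \<open>\<epsilon>\<close> belongs to the fixed jet \<open>k\<close>, so one
  bound serves all maps \<open>g t\<close> with \<open>t\<close> close to 0, each applied to its own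
  pair of realizing surfaces.\<close>

lemma orbit_constant:
  assumes inv: "differential_invariant D I" and k: "k = chart w (x, y, u, p, q, h, a, s, c, d)" "k \<in> D"
    and g: "(g \<longlongrightarrow> (mat 1, 0)) (at (0::real))" "\<forall>\<^sub>F t in at 0. g t \<in> SA3"
    and J: "((\<lambda>t. chart w (\<zeta> t)) \<longlongrightarrow> k) (at 0)"
    and law: "\<forall>\<^sub>F t in at 0. maps_jet (g t) k (chart w (\<zeta> t))"
  shows "\<forall>\<^sub>F t in at 0. I (chart w (\<zeta> t)) = I k"
proof -
  have D: "open D" "D \<subseteq> jet_region" using inv by (auto simp: differential_invariant_def)
  obtain \<epsilon> where \<epsilon>: "\<epsilon> > 0" "\<And>g U F V G z z'. g \<in> SA3 \<Longrightarrow> dist g (mat 1, 0) < \<epsilon> \<Longrightarrow>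
      parabolic_surface U F \<Longrightarrow> parabolic_surface V G \<Longrightarrow>
      affine_act g ` graph_point F ` U = graph_point G ` V \<Longrightarrow> z \<in> U \<Longrightarrow> z' \<in> V \<Longrightarrow>
      affine_act g (graph_point F z) = graph_point G z' \<Longrightarrow> jet F z = k \<Longrightarrow> jet G z' \<in> D \<Longrightarrow> I (jet G z') = I (jet F z)"
    using inv k(2) unfolding differential_invariant_def by metis
  define b where "b = w * (root 3 a * (root 3 s)\<^sup>2)"
  have kj: "k = jet_of x y u p q h a s b c d" using k(1) by (simp add: chart_def b_def)
  have "a \<noteq> 0" "s \<noteq> 0" using k(2) D(2) by (auto simp: kj)
  then interpret prescribed_jet x y u p q h a s b c d by unfold_locales
  have "\<forall>\<^sub>F t in at 0. dist (g t) (mat 1, 0) < \<epsilon>" by (rule tendstoD[OF g(1) \<epsilon>(1)])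
  moreover have "\<forall>\<^sub>F t in at 0. chart w (\<zeta> t) \<in> D" by (rule topological_tendstoD[OF J D(1) k(2)])
  moreover have "\<forall>\<^sub>F t in at 0. g t \<in> SA3 \<longrightarrow> (\<exists>U F V G. parabolic_surface U F \<and> parabolic_surface V G \<and>
     affine_act (g t) ` graph_point F ` U = graph_point G ` V \<and>
     (x, y) \<in> U \<and> jet F (x, y) = jet_of x y u p q h a s b c d)"
    by (rule eventually_compose_filterlim[OF realization g(1)])
  ultimately show ?thesis using g(2) law
  proof eventually_elim
    case (elim t)
    then obtain U F V G where S: "parabolic_surface U F" "parabolic_surface V G"
      "affine_act (g t) ` graph_point F ` U = graph_point G ` V" "(x, y) \<in> U" "jet F (x, y) = k"
      by (auto simp: kj)
    interpret M: developable_map U V F G "fst (g t) $ 1 $ 1" "fst (g t) $ 1 $ 2" "fst (g t) $ 1 $ 3"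
        "fst (g t) $ 2 $ 1" "fst (g t) $ 2 $ 2" "fst (g t) $ 2 $ 3" "fst (g t) $ 3 $ 1" "fst (g t) $ 3 $ 2"
        "fst (g t) $ 3 $ 3" "snd (g t) $ 1" "snd (g t) $ 2" "snd (g t) $ 3"
      using elim S by (intro developable_map_affine_act) (auto simp: parabolic_surface_iff)
    have J: "jet G (M.X (x, y), M.Y (x, y)) = chart w (\<zeta> t)"
      using elim S(4,5) M.developable_map_axioms unfolding maps_jet_def by blast
    have "I (jet G (M.X (x, y), M.Y (x, y))) = I (jet F (x, y))"
    proof (rule \<epsilon>(2)[OF _ _ S(1,2,3,4) M.XY_in[OF S(4)] _ S(5)])
      show "affine_act (g t) (graph_point F (x, y)) = graph_point G (M.X (x, y), M.Y (x, y))"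
        using M.G_XY[OF S(4)]
        by (simp add: affine_act_graph_point vector_3_eq_graph_point M.X_def M.Y_def M.Z_def)
    qed (use elim J in auto)
    then show ?case using J S(5) by simp
  qed
qed

context developable_map
begin

text \<open>With these zero entries the base is mapped affinely and horizontal lines stay
  horizontal: \<open>Yx\<close> and \<open>Jx\<close> vanish, and the third and fourth order laws
  lose all their lower order terms.\<close>

lemma triangular_law:
  assumes m0: "m13 = 0" "m23 = 0" "m21 = 0" and w: "w \<in> U"
    and j: "jet F w = jet_of x y u p q h a s b c d" and s: "s \<noteq> 0"
  shows "jet G (X w, Y w) = chart (W (jet F w)) (m11 * x + m12 * y + b1, m22 * y + b2, m31 * x + m32 * y + m33 * u + b3,
    (m31 + m33 * p) / m11, (m11 * (m32 + m33 * q) - m12 * (m31 + m33 * p)) / (m11 * m22),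
    (h * m11 - m12) / m22, m22\<^sup>2 * a / (m11 * m22) ^ 3, s / m22, m22 ^ 3 * c / (m11 * m22) ^ 4, m22 ^ 4 * d / (m11 * m22) ^ 5)"
proof -
  note c = jet_of_components[OF dev_F w j]
  have S: "S_fun F w \<noteq> 0" using s c by simp
  have v: "Xx w = m11" "Xy w = m12" "Yx w = 0" "Yy w = m22" "Zx w = m31 + m33 * p" "Zy w = m32 + m33 * q"
    unfolding Xx_def Xy_def Yx_def Yy_def Zx_def Zy_def unfolding c m0 by simp_all
  have v': "Jac w = m11 * m22" "Den w = m22" "Num w = h * m11 - m12" "Jx w = 0"
    unfolding Jac_def Den_def Num_def Jx_def unfolding v c unfolding m0 by simp_all
  have K: "K w = m11 * m22 * (m22 * c)" unfolding K_def unfolding v v' c by simp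
  have nz: "m11 \<noteq> 0" "m22 \<noteq> 0" using first_order(3)[OF w] by (auto simp: v')
  have XYZ: "X w = m11 * x + m12 * y + b1" "Y w = m22 * y + b2" "Z w = m31 * x + m32 * y + m33 * u + b3"
    unfolding X_def Y_def Z_def unfolding c m0 by simp_all
  have P: "partial 1 0 G (X w, Y w) = (m31 + m33 * p) / m11"
  proof -
    have "(partial 1 0 G (X w, Y w) * m11) * m22 = (m31 + m33 * p) * m22"
      using first_order(1)[OF w] unfolding v v' by (simp add: algebra_simps)
    then have "partial 1 0 G (X w, Y w) * m11 = m31 + m33 * p" by (simp only: mult_right_cancel[OF nz(2)])
    then show ?thesis using nz by (simp add: field_simps)
  qed
  have Q: "partial 0 1 G (X w, Y w) = (m11 * (m32 + m33 * q) - m12 * (m31 + m33 * p)) / (m11 * m22)"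
    using first_order(2)[OF w] nz unfolding v v' by (simp add: field_simps)
  have H: "slope G (X w, Y w) = (h * m11 - m12) / m22"
    and A: "partial 2 0 G (X w, Y w) = m22\<^sup>2 * a / (m11 * m22) ^ 3"
    using second_order(1,3)[OF w] nz unfolding v' c by (simp_all add: field_simps)
  have S': "S_fun G (X w, Y w) = s / m22"
    using S_fun_transform[OF w] nz unfolding v' c by (simp add: field_simps)
  have C: "partial 3 0 G (X w, Y w) = m22 ^ 3 * c / (m11 * m22) ^ 4"
  proof -
    have "partial 3 0 G (X w, Y w) * (m11 * m22) ^ 4 * (m11 * m22) = m22 ^ 3 * c * (m11 * m22)"
      using third_order[OF w] unfolding v' K by (simp add: eval_nat_numeral mult_ac)
    then show ?thesis using nz by (simp add: field_simps)
  qed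
  have D: "partial 4 0 G (X w, Y w) = m22 ^ 4 * d / (m11 * m22) ^ 5"
  proof -
    have "partial 4 0 G (X w, Y w) * (m11 * m22) ^ 5 * (m11 * m22) = m22 ^ 4 * d * (m11 * m22)"
      using fourth_order[OF w] unfolding v v' c by (simp add: m0 eval_nat_numeral mult_ac)
    then show ?thesis using nz by (simp add: field_simps)
  qed
  show ?thesis unfolding jet_eq_chart[OF w S] P Q H A S' C D unfolding XYZ ..
qed

text \<open>The normalization is required at the point \<open>w\<close> only. The derivatives of
  \<open>Den\<close> and \<open>Jx\<close> there need not vanish, and they produce the terms with
  \<open>Yx\<close> and \<open>m23\<close>.\<close>

lemma unimodular_law:
  assumes w: "w \<in> U" and J: "Jac w = 1" "Den w = 1" "Jx w = 0"
    and j: "jet F w = jet_of x y u p q h a s b c d" and s: "s \<noteq> 0"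
  shows "jet G (X w, Y w) = chart (W (jet F w)) (X w, Y w, Z w,
    Zx w * Yy w - Zy w * Yx w, Xx w * Zy w - Xy w * Zx w, Num w, a, s, c - 3 * s * Yx w * a,
    d - 4 * Yx w * (a * b + 2 * s * c) + 12 * (s * Yx w)\<^sup>2 * a - 3 * s * a\<^sup>2 * (m23 + m23 * Xx w - m13 * Yx w))"
proof -
  note c = jet_of_components[OF dev_F w j]
  have S: "S_fun F w \<noteq> 0" using s c by simp
  have K: "K w = c - 3 * s * Yx w * a" by (simp add: K_def J c)
  have PQ: "partial 1 0 G (X w, Y w) = Zx w * Yy w - Zy w * Yx w" "partial 0 1 G (X w, Y w) = Xx w * Zy w - Xy w * Zx w"
    using first_order(1,2)[OF w] by (simp_all add: J)
  have HA: "slope G (X w, Y w) = Num w" "partial 2 0 G (X w, Y w) = a"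
    using second_order(1,3)[OF w] by (simp_all add: J c)
  have S': "S_fun G (X w, Y w) = s" and B: "slope_xx G (X w, Y w) = b"
    using S_fun_transform[OF w] slope_xx_transform[OF w] by (simp_all add: J c)
  have C: "partial 3 0 G (X w, Y w) = c - 3 * s * Yx w * a"
    using third_order[OF w] by (simp add: J K)
  have D: "partial 4 0 G (X w, Y w) = d - 4 * Yx w * (a * b + 2 * s * c) + 12 * (s * Yx w)\<^sup>2 * a - 3 * s * a\<^sup>2 * (m23 + m23 * Xx w - m13 * Yx w)"
    using fourth_order[OF w] by (simp add: J K c HA S' B C algebra_simps power2_eq_square)
  show ?thesis unfolding jet_eq_chart[OF w S] PQ HA S' C D ..
qed

end

lemma isCont_chart: "isCont (chart w) z"
  unfolding chart_def[abs_def] jet_of_def case_prod_beta by (intro continuous_intros)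

lemma W_chart: "a \<noteq> 0 \<Longrightarrow> s \<noteq> 0 \<Longrightarrow> W (chart w (x, y, u, p, q, h, a, s, c, d)) = w"
  by (simp add: chart_def W_jet_of)

lemma chart_in_jet_region:
  "chart w (x, y, u, p, q, h, a, s, c, d) \<in> jet_region \<longleftrightarrow> a \<noteq> 0 \<and> s \<noteq> 0"
  by (simp add: chart_def)

lemma derivative_along_level_curve:
  fixes f :: "'a::real_normed_vector \<Rightarrow> real"
  assumes f: "(f has_derivative L) (at (\<zeta> 0))" and \<zeta>: "(\<zeta> has_vector_derivative v) (at (0::real))"
    and const: "\<forall>\<^sub>F t in at 0. f (\<zeta> t) = f (\<zeta> 0)"
  shows "L v = 0"
proof -
  have "((\<lambda>t. f (\<zeta> t)) has_derivative (\<lambda>r. L (r *\<^sub>R v))) (at 0)"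
    using has_derivative_compose[OF \<zeta>[unfolded has_vector_derivative_def]] f by blast
  then have "((\<lambda>_. f (\<zeta> 0)) has_derivative (\<lambda>r. L (r *\<^sub>R v))) (at 0)"
    by (rule has_derivative_transform_eventually) (use const in auto)
  from has_derivative_unique[OF this has_derivative_const] have "(\<lambda>r. L (r *\<^sub>R v)) = (\<lambda>_. 0)" .
  from fun_cong[OF this, of 1] show ?thesis by simp
qed

section \<open>Vanishing of the derivative along level sets of \<open>W\<close>\<close>

locale invariant_at =
  fixes D I w x y u p q h a s c d and L :: "chart_coords \<Rightarrow> real"
  assumes inv: "differential_invariant D I" and k: "chart w (x, y, u, p, q, h, a, s, c, d) \<in> D"
    and deriv: "((\<lambda>z. I (chart w z)) has_derivative L) (at (x, y, u, p, q, h, a, s, c, d))"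
begin

abbreviation "z0 \<equiv> (x, y, u, p, q, h, a, s, c, d)"

definition "b = w * (root 3 a * (root 3 s)\<^sup>2)"

lemma nz: "a \<noteq> 0" "s \<noteq> 0"
proof -
  have "chart w z0 \<in> jet_region" using inv k by (auto simp: differential_invariant_def)
  then show "a \<noteq> 0" "s \<noteq> 0" by (simp_all add: chart_in_jet_region)
qed

lemma chart_z0: "chart w z0 = jet_of x y u p q h a s b c d"
  by (simp add: chart_def b_def)

text \<open>The curve \<open>\<zeta>\<close> describes the images of one jet under maps tending to
  the identity; the invariant is constant along it, so its velocity lies in the kernel of
  \<open>L\<close>.\<close>

lemma annihilates:
  assumes \<zeta>: "\<zeta> 0 = z0" "(\<zeta> has_vector_derivative v) (at 0)"
    and g: "(g \<longlongrightarrow> (mat 1, 0)) (at (0::real))" "\<forall>\<^sub>F t in at 0. g t \<in> SA3"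
    and law: "\<forall>\<^sub>F t in at 0. maps_jet (g t) (chart w z0) (chart w (\<zeta> t))"
  shows "L v = 0"
proof (rule derivative_along_level_curve[of "\<lambda>z. I (chart w z)" L \<zeta>])
  have "isCont \<zeta> 0" using \<zeta>(2) by (rule has_vector_derivative_continuous)
  then have "((\<lambda>t. chart w (\<zeta> t)) \<longlongrightarrow> chart w z0) (at 0)"
    using isCont_tendsto_compose[OF isCont_chart, of \<zeta> z0 "at 0" w] \<zeta>(1) by (simp add: isCont_def)
  from orbit_constant[OF inv refl k g this law]
  show "\<forall>\<^sub>F t in at 0. I (chart w (\<zeta> t)) = I (chart w (\<zeta> 0))" by (simp add: \<zeta>(1))
qed (use deriv \<zeta> in auto)

text \<open>The argument of \<open>L\<close> is the derivative of the image in
  \<open>triangular_law\<close> at the identity. The families need not be one-parameter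
  subgroups.\<close>

lemma triangular_annihilates:
  assumes m: "(m11 has_real_derivative m11') (at 0)" "(m12 has_real_derivative m12') (at 0)"
    "(m22 has_real_derivative m22') (at 0)" "(m31 has_real_derivative m31') (at 0)"
    "(m32 has_real_derivative m32') (at 0)" "(m33 has_real_derivative m33') (at 0)"
    "(b1 has_real_derivative b1') (at 0)" "(b2 has_real_derivative b2') (at 0)" "(b3 has_real_derivative b3') (at 0)"
    and m0: "m11 0 = 1" "m12 0 = 0" "m22 0 = 1" "m31 0 = 0" "m32 0 = 0" "m33 0 = 1" "b1 0 = 0" "b2 0 = 0" "b3 0 = 0"
    and det: "\<forall>\<^sub>F t in at 0. m11 t * m22 t * m33 t = 1"
  shows "L (m11' * x + m12' * y + b1', m22' * y + b2', m31' * x + m32' * y + m33' * u + b3',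
    m31' + m33' * p - m11' * p, m32' + m33' * q - m12' * p - m22' * q, h * m11' - m12' - h * m22',
    - a * (3 * m11' + m22'), - s * m22', - c * (4 * m11' + m22'), - d * (5 * m11' + m22')) = 0"
proof -
  define \<zeta> where "\<zeta> t = (m11 t * x + m12 t * y + b1 t, m22 t * y + b2 t, m31 t * x + m32 t * y + m33 t * u + b3 t,
    (m31 t + m33 t * p) / m11 t, (m11 t * (m32 t + m33 t * q) - m12 t * (m31 t + m33 t * p)) / (m11 t * m22 t),
    (h * m11 t - m12 t) / m22 t, (m22 t)\<^sup>2 * a / (m11 t * m22 t) ^ 3, s / m22 t,
    m22 t ^ 3 * c / (m11 t * m22 t) ^ 4, m22 t ^ 4 * d / (m11 t * m22 t) ^ 5)" for t
  let ?g = "\<lambda>t. affine3 (m11 t) (m12 t) 0 0 (m22 t) 0 (m31 t) (m32 t) (m33 t) (b1 t) (b2 t) (b3 t)"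
  have lim: "(f \<longlongrightarrow> f 0) (at 0)" if "(f has_real_derivative f') (at 0)" for f :: "real \<Rightarrow> real" and f'
    using DERIV_isCont[OF that] by (simp add: isCont_def)
  show ?thesis
  proof (rule annihilates[of \<zeta> _ ?g])
    show "\<zeta> 0 = z0" by (simp add: \<zeta>_def m0)
    show "(\<zeta> has_vector_derivative (m11' * x + m12' * y + b1', m22' * y + b2', m31' * x + m32' * y + m33' * u + b3',
      m31' + m33' * p - m11' * p, m32' + m33' * q - m12' * p - m22' * q, h * m11' - m12' - h * m22',
      - a * (3 * m11' + m22'), - s * m22', - c * (4 * m11' + m22'), - d * (5 * m11' + m22'))) (at 0)"
      unfolding \<zeta>_def[abs_def]
      by (intro has_vector_derivative_Pair; unfold has_real_derivative_iff_has_vector_derivative[symmetric])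
        (auto intro!: derivative_eq_intros m simp: m0 algebra_simps)
    show "(?g \<longlongrightarrow> (mat 1, 0)) (at 0)"
      using m[THEN lim] by (intro tendsto_affine3 tendsto_const) (simp_all add: m0)
    show "\<forall>\<^sub>F t in at 0. ?g t \<in> SA3"
      using det by eventually_elim (simp add: affine3_in_SA3 mult.assoc)
    show "\<forall>\<^sub>F t in at 0. maps_jet (?g t) (chart w z0) (chart w (\<zeta> t))"
    proof (intro always_eventually allI maps_jet_affine3I)
      fix t U V F G z
      assume M: "developable_map U V F G (m11 t) (m12 t) 0 0 (m22 t) 0 (m31 t) (m32 t) (m33 t) (b1 t) (b2 t) (b3 t)"
        and z: "z \<in> U" and j: "jet F z = chart w z0"
      interpret M: developable_map U V F G "m11 t" "m12 t" 0 0 "m22 t" 0 "m31 t" "m32 t" "m33 t" "b1 t" "b2 t" "b3 t" by (rule M)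
      have W: "W (jet F z) = w" using nz by (simp add: j W_chart)
      show "jet G (M.X z, M.Y z) = chart w (\<zeta> t)"
        unfolding \<zeta>_def using M.triangular_law[OF refl refl refl z j[unfolded chart_z0] nz(2)] unfolding W .
    qed
  qed
qed

text \<open>The shear \<open>(x, y) \<mapsto> (x, y) + t (- h, 1) (x + h y - const)\<close> fixes the ruling direction, hence moves
  among the chart coordinates only \<open>u\<^sub>x\<close>, \<open>u\<^sub>y\<close>, \<open>u\<^sub>x\<^sub>x\<^sub>x\<close> and \<open>u\<^sub>x\<^sub>x\<^sub>x\<^sub>x\<close>.\<close>

lemma ruling_shear_annihilates:
  "L (0, 0, 0, h * p - q, h * (h * p - q), 0, 0, 0, - 3 * s * a, - 4 * (a * b + 2 * s * c)) = 0"
proof -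
  define \<zeta> where "\<zeta> t = (x, y, u, p + t * (h * p - q), q + t * (h * (h * p - q)), h, a, s, c - 3 * s * t * a,
    d - 4 * t * (a * b + 2 * s * c) + 12 * (s * t)\<^sup>2 * a)" for t
  \<comment> \<open>The linear part on the base adds \<open>t\<close> times the product of the
    column \<open>(- h, 1)\<close> with the row \<open>(1, h)\<close>. This matrix has square 0,
    whence determinant 1; the translation fixes \<open>(x, y)\<close>.\<close>
  let ?g = "\<lambda>t. affine3 (1 - t * h) (- t * h\<^sup>2) 0 t (1 + t * h) 0 0 0 1 (t * h * (x + h * y)) (- t * (x + h * y)) 0"
  show ?thesis
  proof (rule annihilates[of \<zeta> _ ?g])
    show "\<zeta> 0 = z0" by (simp add: \<zeta>_def)
    show "(\<zeta> has_vector_derivative (0, 0, 0, h * p - q, h * (h * p - q), 0, 0, 0, - 3 * s * a, - 4 * (a * b + 2 * s * c))) (at 0)"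
      unfolding \<zeta>_def[abs_def]
      by (intro has_vector_derivative_Pair; unfold has_real_derivative_iff_has_vector_derivative[symmetric])
        (auto intro!: derivative_eq_intros)
    show "(?g \<longlongrightarrow> (mat 1, 0)) (at 0)"
      by (intro tendsto_affine3) (auto intro!: tendsto_eq_intros)
    show "\<forall>\<^sub>F t in at 0. ?g t \<in> SA3"
      by (simp add: affine3_in_SA3 algebra_simps power2_eq_square)
    show "\<forall>\<^sub>F t in at 0. maps_jet (?g t) (chart w z0) (chart w (\<zeta> t))"
    proof (intro always_eventually allI maps_jet_affine3I)
      fix t U V F G z
      assume M: "developable_map U V F G (1 - t * h) (- t * h\<^sup>2) 0 t (1 + t * h) 0 0 0 1 (t * h * (x + h * y)) (- t * (x + h * y)) 0"
        and z: "z \<in> U" and j: "jet F z = chart w z0"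
      interpret M: developable_map U V F G "1 - t * h" "- t * h\<^sup>2" 0 t "1 + t * h" 0 0 0 1 "t * h * (x + h * y)" "- t * (x + h * y)" 0 by (rule M)
      have W: "W (jet F z) = w" using nz by (simp add: j W_chart)
      note c = jet_of_components[OF M.dev_F z j[unfolded chart_z0]]
      have v: "M.Xx z = 1 - t * h" "M.Xy z = - t * h\<^sup>2" "M.Yx z = t" "M.Yy z = 1 + t * h" "M.Zx z = p" "M.Zy z = q"
        unfolding M.Xx_def M.Xy_def M.Yx_def M.Yy_def M.Zx_def M.Zy_def c by simp_all
      have v': "M.Jac z = 1" "M.Den z = 1" "M.Num z = h" "M.Jx z = 0"
        unfolding M.Jac_def M.Den_def M.Num_def M.Jx_def v c by (simp_all add: algebra_simps power2_eq_square)
      have XYZ: "M.X z = x" "M.Y z = y" "M.Z z = u"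
        unfolding M.X_def M.Y_def M.Z_def c by (simp_all add: algebra_simps power2_eq_square)
      have "jet G (M.X z, M.Y z) = chart w (M.X z, M.Y z, M.Z z, M.Zx z * M.Yy z - M.Zy z * M.Yx z,
          M.Xx z * M.Zy z - M.Xy z * M.Zx z, M.Num z, a, s, c - 3 * s * M.Yx z * a,
          d - 4 * M.Yx z * (a * b + 2 * s * c) + 12 * (s * M.Yx z)\<^sup>2 * a - 3 * s * a\<^sup>2 * (0 + 0 * M.Xx z - 0 * M.Yx z))"
        using M.unimodular_law[OF z v'(1,2,4) j[unfolded chart_z0] nz(2)] unfolding W .
      also have "\<dots> = chart w (\<zeta> t)"
        unfolding \<zeta>_def XYZ v v' by (simp add: algebra_simps power2_eq_square)
      finally show "jet G (M.X z, M.Y z) = chart w (\<zeta> t)" .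
    qed
  qed
qed

text \<open>The shear along the ruling in space that fixes the tangent plane pointwise moves only \<open>u\<^sub>x\<^sub>x\<^sub>x\<^sub>x\<close>. It is
  the only transformation needed that does not preserve the direction of the \<open>u\<close>-axis.\<close>

lemma tangent_shear_annihilates: "L (0, 0, 0, 0, 0, 0, 0, 0, 0, - 6 * s * a\<^sup>2) = 0"
proof -
  \<comment> \<open>\<open>(- h, 1, e)\<close> is the direction of the ruling in space, and the
    affine form \<open>u - p x - q y - \<kappa>\<close>, with \<open>p\<close>, \<open>q\<close>,
    \<open>\<kappa>\<close> fixed, vanishes on the tangent plane. The map adds \<open>t\<close>
    times this form times that vector.\<close>
  define e where "e = q - h * p"
  define \<kappa> where "\<kappa> = u - p * x - q * y"
  define \<zeta> where "\<zeta> t = (x, y, u, p, q, h, a, s, c, d - 6 * t * s * a\<^sup>2)" for t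
  let ?g = "\<lambda>t. affine3 (1 + t * h * p) (t * h * q) (- t * h) (- t * p) (1 - t * q) t
    (- t * e * p) (- t * e * q) (1 + t * e) (t * h * \<kappa>) (- t * \<kappa>) (- t * e * \<kappa>)"
  show ?thesis
  proof (rule annihilates[of \<zeta> _ ?g])
    show "\<zeta> 0 = z0" by (simp add: \<zeta>_def)
    show "(\<zeta> has_vector_derivative (0, 0, 0, 0, 0, 0, 0, 0, 0, - 6 * s * a\<^sup>2)) (at 0)"
      unfolding \<zeta>_def[abs_def]
      by (intro has_vector_derivative_Pair; unfold has_real_derivative_iff_has_vector_derivative[symmetric])
        (auto intro!: derivative_eq_intros)
    show "(?g \<longlongrightarrow> (mat 1, 0)) (at 0)"
      by (intro tendsto_affine3) (auto intro!: tendsto_eq_intros)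
    show "\<forall>\<^sub>F t in at 0. ?g t \<in> SA3"
      by (simp add: affine3_in_SA3 e_def algebra_simps power2_eq_square)
    show "\<forall>\<^sub>F t in at 0. maps_jet (?g t) (chart w z0) (chart w (\<zeta> t))"
    proof (intro always_eventually allI maps_jet_affine3I)
      fix t U V F G z
      assume M: "developable_map U V F G (1 + t * h * p) (t * h * q) (- t * h) (- t * p) (1 - t * q) t
          (- t * e * p) (- t * e * q) (1 + t * e) (t * h * \<kappa>) (- t * \<kappa>) (- t * e * \<kappa>)"
        and z: "z \<in> U" and j: "jet F z = chart w z0"
      interpret M: developable_map U V F G "1 + t * h * p" "t * h * q" "- t * h" "- t * p" "1 - t * q" t
          "- t * e * p" "- t * e * q" "1 + t * e" "t * h * \<kappa>" "- t * \<kappa>" "- t * e * \<kappa>" by (rule M)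
      have W: "W (jet F z) = w" using nz by (simp add: j W_chart)
      note c = jet_of_components[OF M.dev_F z j[unfolded chart_z0]]
      have v: "M.Xx z = 1" "M.Xy z = 0" "M.Yx z = 0" "M.Yy z = 1" "M.Zx z = p" "M.Zy z = q"
        unfolding M.Xx_def M.Xy_def M.Yx_def M.Yy_def M.Zx_def M.Zy_def c by (simp_all add: algebra_simps)
      have v': "M.Jac z = 1" "M.Den z = 1" "M.Num z = h"
        unfolding M.Jac_def M.Den_def M.Num_def v c by simp_all
      have Jx: "M.Jx z = 0"
        unfolding M.Jx_def v' c by simp
      have XYZ: "M.X z = x" "M.Y z = y" "M.Z z = u"
        unfolding M.X_def M.Y_def M.Z_def c by (simp_all add: \<kappa>_def algebra_simps)
      have "jet G (M.X z, M.Y z) = chart w (M.X z, M.Y z, M.Z z, M.Zx z * M.Yy z - M.Zy z * M.Yx z,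
          M.Xx z * M.Zy z - M.Xy z * M.Zx z, M.Num z, a, s, c - 3 * s * M.Yx z * a,
          d - 4 * M.Yx z * (a * b + 2 * s * c) + 12 * (s * M.Yx z)\<^sup>2 * a - 3 * s * a\<^sup>2 * (t + t * M.Xx z - - t * h * M.Yx z))"
        using M.unimodular_law[OF z v'(1,2) Jx j[unfolded chart_z0] nz(2)] unfolding W .
      also have "\<dots> = chart w (\<zeta> t)"
        unfolding \<zeta>_def XYZ v v' by (simp add: algebra_simps)
      finally show "jet G (M.X z, M.Y z) = chart w (\<zeta> t)" .
    qed
  qed
qed

lemma unipotent_annihilates:
  "L (k12 * y + k1, k2, k31 * x + k32 * y + k3, k31, k32 - k12 * p, - k12, 0, 0, 0, 0) = 0"
proof -
  have "L (0 * x + k12 * y + k1, 0 * y + k2, k31 * x + k32 * y + 0 * u + k3, k31 + 0 * p - 0 * p,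
      k32 + 0 * q - k12 * p - 0 * q, h * 0 - k12 - h * 0, - a * (3 * 0 + 0), - s * 0, - c * (4 * 0 + 0), - d * (5 * 0 + 0)) = 0"
    by (rule triangular_annihilates[of "\<lambda>_. 1" _ "\<lambda>t. k12 * t" _ "\<lambda>_. 1" _ "\<lambda>t. k31 * t" _ "\<lambda>t. k32 * t" _
          "\<lambda>_. 1" _ "\<lambda>t. k1 * t" _ "\<lambda>t. k2 * t" _ "\<lambda>t. k3 * t"]) (auto intro!: derivative_eq_intros)
  then show ?thesis by simp
qed

lemma scaling_annihilates:
  "L (0, 0, 0, - (2 * r1 + r2) * p, - (r1 + 2 * r2) * q, h * (r1 - r2),
    - a * (3 * r1 + r2), - s * r2, - c * (4 * r1 + r2), - d * (5 * r1 + r2)) = 0"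
proof -
  have "L (r1 * x + 0 * y + - r1 * x, r2 * y + - r2 * y, 0 * x + 0 * y + - (r1 + r2) * u + (r1 + r2) * u,
      0 + - (r1 + r2) * p - r1 * p, 0 + - (r1 + r2) * q - 0 * p - r2 * q, h * r1 - 0 - h * r2,
      - a * (3 * r1 + r2), - s * r2, - c * (4 * r1 + r2), - d * (5 * r1 + r2)) = 0"
    \<comment> \<open>The third factor makes the determinant 1, and the translations keep
      \<open>(x, y, u)\<close> fixed, so no velocity appears in the first three coordinates.\<close>
    by (rule triangular_annihilates[of "\<lambda>t. exp (r1 * t)" _ "\<lambda>_. 0" _ "\<lambda>t. exp (r2 * t)" _ "\<lambda>_. 0" _ "\<lambda>_. 0" _
          "\<lambda>t. exp (- (r1 + r2) * t)" _ "\<lambda>t. (1 - exp (r1 * t)) * x" _ "\<lambda>t. (1 - exp (r2 * t)) * y" _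
          "\<lambda>t. (1 - exp (- (r1 + r2) * t)) * u"])
       (auto intro!: derivative_eq_intros simp: algebra_simps simp flip: exp_add)
  then show ?thesis by (simp add: algebra_simps)
qed

text \<open>The velocities form a triangular system. Up to sign the pivots are 1 six times, then
  \<open>6 s a^2\<close>, \<open>3 s a\<close>, \<open>3 a\<close> and \<open>s\<close>; this is
  where \<open>u_xx \<noteq> 0\<close> and \<open>S \<noteq> 0\<close> enter.\<close>

lemma derivative_zero: "L = (\<lambda>_. 0)"
proof
  have lin: "linear L" using deriv by (rule has_derivative_linear)
  have L: "L (v1, v2, v3, v4, v5, v6, v7, v8, v9, v10) =
    v1 * L (1, 0, 0, 0, 0, 0, 0, 0, 0, 0) + v2 * L (0, 1, 0, 0, 0, 0, 0, 0, 0, 0) + v3 * L (0, 0, 1, 0, 0, 0, 0, 0, 0, 0) + v4 * L (0, 0, 0, 1, 0, 0, 0, 0, 0, 0) + v5 * L (0, 0, 0, 0, 1, 0, 0, 0, 0, 0) + v6 * L (0, 0, 0, 0, 0, 1, 0, 0, 0, 0) + v7 * L (0, 0, 0, 0, 0, 0, 1, 0, 0, 0) + v8 * L (0, 0, 0, 0, 0, 0, 0, 1, 0, 0) + v9 * L (0, 0, 0, 0, 0, 0, 0, 0, 1, 0) + v10 * L (0, 0, 0, 0, 0, 0, 0, 0, 0, 1)"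
    for v1 v2 v3 v4 v5 v6 v7 v8 v9 v10
  proof -
    have "(v1, v2, v3, v4, v5, v6, v7, v8, v9, v10) =
      v1 *\<^sub>R (1, 0, 0, 0, 0, 0, 0, 0, 0, 0) + v2 *\<^sub>R (0, 1, 0, 0, 0, 0, 0, 0, 0, 0) + v3 *\<^sub>R (0, 0, 1, 0, 0, 0, 0, 0, 0, 0) + v4 *\<^sub>R (0, 0, 0, 1, 0, 0, 0, 0, 0, 0) + v5 *\<^sub>R (0, 0, 0, 0, 1, 0, 0, 0, 0, 0) + v6 *\<^sub>R (0, 0, 0, 0, 0, 1, 0, 0, 0, 0) + v7 *\<^sub>R (0, 0, 0, 0, 0, 0, 1, 0, 0, 0) + v8 *\<^sub>R (0, 0, 0, 0, 0, 0, 0, 1, 0, 0) + v9 *\<^sub>R (0, 0, 0, 0, 0, 0, 0, 0, 1, 0) + v10 *\<^sub>R (0, 0, 0, 0, 0, 0, 0, 0, 0, 1)" by simp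
    then show ?thesis by (simp only: linear_add[OF lin] linear_scale[OF lin] real_scaleR_def)
  qed
  define l1 where "l1 = L (1, 0, 0, 0, 0, 0, 0, 0, 0, 0)"
  define l2 where "l2 = L (0, 1, 0, 0, 0, 0, 0, 0, 0, 0)"
  define l3 where "l3 = L (0, 0, 1, 0, 0, 0, 0, 0, 0, 0)"
  define l4 where "l4 = L (0, 0, 0, 1, 0, 0, 0, 0, 0, 0)"
  define l5 where "l5 = L (0, 0, 0, 0, 1, 0, 0, 0, 0, 0)"
  define l6 where "l6 = L (0, 0, 0, 0, 0, 1, 0, 0, 0, 0)"
  define l7 where "l7 = L (0, 0, 0, 0, 0, 0, 1, 0, 0, 0)"
  define l8 where "l8 = L (0, 0, 0, 0, 0, 0, 0, 1, 0, 0)"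
  define l9 where "l9 = L (0, 0, 0, 0, 0, 0, 0, 0, 1, 0)"
  define l10 where "l10 = L (0, 0, 0, 0, 0, 0, 0, 0, 0, 1)"
  note L = L[folded l1_def l2_def l3_def l4_def l5_def l6_def l7_def l8_def l9_def l10_def]
  have l1: "l1 = 0" using unipotent_annihilates[of 0 1 0 0 0 0] unfolding L by simp
  have l2: "l2 = 0" using unipotent_annihilates[of 0 0 1 0 0 0] unfolding L by simp
  have l3: "l3 = 0" using unipotent_annihilates[of 0 0 0 0 0 1] unfolding L by simp
  have l4: "l4 = 0" using unipotent_annihilates[of 0 0 0 1 0 0] l1 l2 l3 unfolding L by simp
  have l5: "l5 = 0" using unipotent_annihilates[of 0 0 0 0 1 0] l1 l2 l3 l4 unfolding L by simp
  have l6: "l6 = 0" using unipotent_annihilates[of 1 0 0 0 0 0] l1 l2 l3 l4 l5 unfolding L by simp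
  have l10: "l10 = 0" using tangent_shear_annihilates nz unfolding L by simp
  have l9: "l9 = 0" using ruling_shear_annihilates nz l4 l5 l10 unfolding L by simp
  have l7: "l7 = 0" using scaling_annihilates[of 1 0] nz l4 l5 l6 l9 l10 unfolding L by simp
  have l8: "l8 = 0" using scaling_annihilates[of 0 1] nz l4 l5 l6 l7 l9 l10 unfolding L by simp
  show "L v = 0" for v
  proof -
    obtain v1 v2 v3 v4 v5 v6 v7 v8 v9 v10 where "v = (v1, v2, v3, v4, v5, v6, v7, v8, v9, v10)" by (metis surj_pair)
    then show ?thesis by (simp only: L l1 l2 l3 l4 l5 l6 l7 l8 l9 l10 mult_zero_right add_0_left)
  qed
qed

end

section \<open>From vanishing derivatives to a function of \<open>W\<close>\<close>

lemma real_analytic_at_jet4: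
  assumes "real_analytic_at f1 z" "real_analytic_at f2 z" "real_analytic_at f3 z" "real_analytic_at f4 z"
    "real_analytic_at f5 z" "real_analytic_at f6 z" "real_analytic_at f7 z" "real_analytic_at f8 z"
    "real_analytic_at f9 z" "real_analytic_at f10 z" "real_analytic_at f11 z"
  shows "real_analytic_at (\<lambda>z. (f1 z, f2 z, f3 z, f4 z, f5 z, f6 z, f7 z, f8 z, f9 z, f10 z, f11 z) \<bullet> e) z"
  unfolding inner_prod_def fst_conv snd_conv inner_real_def
  by (intro real_analytic_at_add real_analytic_at_mult real_analytic_at_const assms)

lemma chart_projections:
  "chart w z = jet_of (fst z) (fst (snd z)) (fst (snd (snd z))) (fst (snd (snd (snd z))))
    (fst (snd (snd (snd (snd z))))) (fst (snd (snd (snd (snd (snd z)))))) (fst (snd (snd (snd (snd (snd (snd z)))))))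
    (fst (snd (snd (snd (snd (snd (snd (snd z))))))))
    (w * (root 3 (fst (snd (snd (snd (snd (snd (snd z))))))) * (root 3 (fst (snd (snd (snd (snd (snd (snd (snd z)))))))))\<^sup>2))
    (fst (snd (snd (snd (snd (snd (snd (snd (snd z)))))))))
    (snd (snd (snd (snd (snd (snd (snd (snd (snd z)))))))))"
  by (simp add: chart_def case_prod_beta)

text \<open>Membership in \<open>jet_region\<close> keeps \<open>a\<close> and \<open>s\<close> away
  from 0, the only point where the cube roots in the chart fail to be analytic.\<close>

lemma real_analytic_at_comp_chart:
  assumes I: "real_analytic_at I (chart w z)" and z: "chart w z \<in> jet_region"
  shows "real_analytic_at (\<lambda>z. I (chart w z)) z"
proof (rule real_analytic_at_compose[where f=I and g="chart w", OF I])
  fix e :: jet4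
  define a where "a z = fst (snd (snd (snd (snd (snd (snd z))))))" for z :: chart_coords
  define s where "s z = fst (snd (snd (snd (snd (snd (snd (snd z)))))))" for z :: chart_coords
  have nz: "a z \<noteq> 0" "s z \<noteq> 0"
    using z unfolding chart_projections a_def s_def by simp_all
  have lin: "real_analytic_at f z" if "linear f" for f :: "chart_coords \<Rightarrow> real"
    using that by (rule real_analytic_at_linear)
  have as: "real_analytic_at a z" "real_analytic_at s z"
    unfolding a_def s_def by (rule lin, rule linearI, simp_all)+
  have roots: "real_analytic_at (\<lambda>z. root 3 (a z)) z" "real_analytic_at (\<lambda>z. root 3 (s z)) z"
    using nz as by (auto intro!: real_analytic_at_compose_real[OF real_analytic_at_root_real])
  show "real_analytic_at (\<lambda>z. chart w z \<bullet> e) z"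
    unfolding chart_projections jet_of_def a_def[symmetric] s_def[symmetric]
    by (intro real_analytic_at_jet4 real_analytic_at_add real_analytic_at_mult real_analytic_at_power
        real_analytic_at_const roots as; (rule lin, rule linearI; simp))
qed

lemma real_analytic_at_comp_chart_W:
  assumes "real_analytic_at I (chart w z)"
  shows "real_analytic_at (\<lambda>w. I (chart w z)) w"
proof (rule real_analytic_at_compose[where f=I and g="\<lambda>w. chart w z", OF assms])
  show "real_analytic_at (\<lambda>w. chart w z \<bullet> e) w" for e
    unfolding chart_projections jet_of_def
    by (intro real_analytic_at_jet4 real_analytic_at_add real_analytic_at_mult real_analytic_at_power
        real_analytic_at_const real_analytic_at_linear linearI) (simp_all add: algebra_simps)
qed

lemma continuous_chart: "isCont (\<lambda>v. chart (fst v) (snd v)) v"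
  unfolding chart_projections jet_of_def by (intro continuous_intros)

lemma continuous_on_chart_inv: "continuous_on jet_region chart_inv"
proof -
  have "fst (snd (snd (snd (snd j)))) \<noteq> 0" if "j \<in> jet_region" for j
    using that by (auto simp: jet_region_def)
  then show ?thesis
    unfolding chart_inv_def[abs_def] case_prod_beta by (intro continuous_intros) auto
qed

lemma continuous_on_W: "continuous_on jet_region W"
  using real_analytic_on_W
  by (auto simp: real_analytic_on_def intro!: continuous_at_imp_continuous_on real_analytic_at_isCont)

text \<open>Every point of \<open>B\<close> is itself a jet at which \<open>derivative_zero\<close>
  applies; convexity turns vanishing derivatives into constancy.\<close>

lemma differential_invariant_constant_in_chart:
  assumes inv: "differential_invariant D I" and B: "convex B" "open B"
    and sub: "\<And>z. z \<in> B \<Longrightarrow> chart w z \<in> D" and z: "z \<in> B" "z' \<in> B"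
  shows "I (chart w z) = I (chart w z')"
proof (rule has_derivative_zero_unique[OF B(1) _ z])
  fix v assume v: "v \<in> B"
  have k: "chart w v \<in> D" using sub[OF v] .
  then have "real_analytic_at (\<lambda>z. I (chart w z)) v"
    using inv by (intro real_analytic_at_comp_chart) (auto simp: differential_invariant_def real_analytic_on_def)
  then obtain L where L: "((\<lambda>z. I (chart w z)) has_derivative L) (at v)"
    by (rule real_analytic_at_differentiable)
  obtain x y u p q h a s c d where v': "v = (x, y, u, p, q, h, a, s, c, d)" by (metis surj_pair)
  interpret invariant_at D I w x y u p q h a s c d L
    using inv k L by unfold_locales (simp_all add: v')
  show "((\<lambda>z. I (chart w z)) has_derivative (\<lambda>_. 0)) (at v within B)"
    using L unfolding derivative_zero by (rule has_derivative_at_withinI)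
qed

text \<open>Near \<open>j\<close> the pair of \<open>W\<close> and \<open>chart_inv\<close> ranges
  over a product of balls, and \<open>I\<close> does not depend on the second factor. Freezing it at
  \<open>z0\<close> gives \<open>\<phi>\<close>, analytic because the chart is affine in
  \<open>w\<close>.\<close>

lemma differential_invariant_function_of_W:
  assumes inv: "differential_invariant D I" and j: "j \<in> D"
  shows "\<exists>N T \<phi>. open N \<and> j \<in> N \<and> N \<subseteq> D \<and>
    open T \<and> W ` N \<subseteq> T \<and> real_analytic_on \<phi> T \<and> (\<forall>k\<in>N. I k = \<phi> (W k))"
proof -
  have D: "open D" "D \<subseteq> jet_region" and an: "real_analytic_on I D"
    using inv by (auto simp: differential_invariant_def)
  have jr: "j \<in> jet_region" using j D by blast
  define w0 z0 where "w0 = W j" and "z0 = chart_inv j"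
  have j_eq: "chart w0 z0 = j" using chart_chart_inv[OF jr] by (simp add: w0_def z0_def)
  define V where "V = (\<lambda>v. chart (fst v) (snd v)) -` D"
  have V: "open V" "(w0, z0) \<in> V"
    using D(1) j continuous_chart
    by (auto simp: V_def j_eq intro!: open_vimage continuous_at_imp_continuous_on)
  obtain A B where AB: "open A" "open B" "w0 \<in> A" "z0 \<in> B" "A \<times> B \<subseteq> V"
    using open_prod_elim[OF V] by (metis mem_Sigma_iff)
  obtain \<delta> where \<delta>: "\<delta> > 0" "ball w0 \<delta> \<subseteq> A" "ball z0 \<delta> \<subseteq> B"
  proof -
    obtain d1 where "d1 > 0" "ball w0 d1 \<subseteq> A" using AB(1,3) by (meson openE)
    moreover obtain d2 where "d2 > 0" "ball z0 d2 \<subseteq> B" using AB(2,4) by (meson openE)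
    ultimately show ?thesis by (intro that[of "min d1 d2"]) auto
  qed
  have inD: "chart w z \<in> D" if "w \<in> ball w0 \<delta>" "z \<in> ball z0 \<delta>" for w z
    proof -
    have "(w, z) \<in> V" using AB(5) \<delta> that by blast
    then show ?thesis by (simp add: V_def)
  qed
  define N where "N = D \<inter> (\<lambda>k. (W k, chart_inv k)) -` (ball w0 \<delta> \<times> ball z0 \<delta>)"
  have "continuous_on D (\<lambda>k. (W k, chart_inv k))"
    using continuous_on_W continuous_on_chart_inv D(2)
    by (intro continuous_on_Pair) (auto intro: continuous_on_subset)
  then have "open N" unfolding N_def
    by (intro continuous_open_preimage D(1) open_Times open_ball)
  moreover have "j \<in> N" using j \<delta>(1) by (simp add: N_def flip: w0_def z0_def)
  moreover have "W ` N \<subseteq> ball w0 \<delta>" by (auto simp: N_def)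
  moreover have "real_analytic_on (\<lambda>w. I (chart w z0)) (ball w0 \<delta>)"
    using an inD \<delta>(1) unfolding real_analytic_on_def by (intro ballI real_analytic_at_comp_chart_W) auto
  moreover have "I k = I (chart (W k) z0)" if k: "k \<in> N" for k
  proof -
    have kb: "W k \<in> ball w0 \<delta>" "chart_inv k \<in> ball z0 \<delta>" and kD: "k \<in> D" using k by (auto simp: N_def)
    have "I (chart (W k) (chart_inv k)) = I (chart (W k) z0)"
      by (rule differential_invariant_constant_in_chart[OF inv convex_ball open_ball])
         (use kb inD \<delta>(1) in auto)
    moreover have "k \<in> jet_region" using kD D(2) by blast
    ultimately show ?thesis by (simp add: chart_chart_inv)
  qed
  ultimately show ?thesis
    by (intro exI[of _ N] exI[of _ "ball w0 \<delta>"] exI[of _ "\<lambda>w. I (chart w z0)"]) (auto simp: N_def)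
qed

theorem theorem2p10:
  shows "differential_invariant jet_region W \<and>
    (\<forall>D I. differential_invariant D I \<longrightarrow>
       (\<forall>j\<in>D. \<exists>N T \<phi>. open N \<and> j \<in> N \<and> N \<subseteq> D \<and>
          open T \<and> W ` N \<subseteq> T \<and> real_analytic_on \<phi> T \<and> (\<forall>k\<in>N. I k = \<phi> (W k))))"
  using differential_invariant_W differential_invariant_function_of_W by blast

end
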